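(* Let $\Omega=\mathbb{R}^2\times(0,1)$ and let $\boldsymbol{u}$ be a smooth axisymmetric solution of the steady Navier-Stokes system $$-\Delta\boldsymbol{u}+(\boldsymbol{u}\cdot\nabla)\boldsymbol{u}+\nabla P=0,\qquad \nabla\cdot\boldsymbol{u}=0\qquad\text{in }\Omega,$$ with no-slip boundary conditions $\boldsymbol{u}=0$ at $x_3=0$ and $x_3=1$. For $R>0$ set $$\mathcal{E}(R)=\int_0^1\int_{\{x_1^2+x_2^2<R^2\}}|\nabla\boldsymbol{u}|^2\,dx_1\,dx_2\,dx_3 .$$ Then $\boldsymbol{u}\equiv 0$ if either (a) $\displaystyle\liminf_{R\to+\infty}R^{-4}\mathcal{E}(R)=0$, or (b) $\displaystyle\lim_{R\to+\infty}R^{-1}\sup_{z\in[0,1]}|\boldsymbol{u}(R,z)|=0$.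
   Context: $\boldsymbol{u}=(u^1,u^2,u^3)$ is a real vector field (velocity) and $P$ is a scalar function (pressure). A smooth solution means that there is a smooth scalar $P$ such that the smooth field $\boldsymbol{u}$ and $P$ satisfy the system; smoothness is understood up to the boundary, i.e. on $\mathbb{R}^2\times[0,1]$. Cylindrical coordinates $(r,\theta,z)$ are $x_1=r\cos\theta$, $x_2=r\sin\theta$, $x_3=z$, and $\boldsymbol{u}=u^r\boldsymbol{e}_r+u^\theta\boldsymbol{e}_\theta+u^z\boldsymbol{e}_z$ with $\boldsymbol{e}_r=(\cos\theta,\sin\theta,0)$, $\boldsymbol{e}_\theta=(-\sin\theta,\cos\theta,0)$, $\boldsymbol{e}_z=(0,0,1)$. The solution is axisymmetric if $u^r,u^\theta,u^z$ are all independent of $\theta$; then $|\boldsymbol{u}|$ depends only on $(r,z)$, and $|\boldsymbol{u}(R,z)|$ denotes its value at radius $r=R$ and height $z$. *)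

theory Defs
  imports "HOL-Analysis.Analysis"
begin

definition slab :: "(real ^ 3) set" where
  "slab = {x. 0 < x $ 3 \<and> x $ 3 < 1}"

definition closed_slab :: "(real ^ 3) set" where
  "closed_slab = {x. 0 \<le> x $ 3 \<and> x $ 3 \<le> 1}"

text \<open>
  The derivative is taken relative to \<open>S\<close>, hence is one-sided at boundary points. It is unique
  when \<open>S\<close> is open or is the closed slab (more generally, convex with nonempty interior);
  for other sets \<open>S\<close> the definition need not be meaningful.
\<close>

fun Ck_on :: "nat \<Rightarrow> ('a::euclidean_space \<Rightarrow> 'b::real_normed_vector) \<Rightarrow> 'a set \<Rightarrow> bool" where
  "Ck_on 0 f S \<longleftrightarrow> continuous_on S f"
| "Ck_on (Suc k) f S \<longleftrightarrow> f differentiable_on S \<and>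
     (\<forall>v. Ck_on k (\<lambda>x. frechet_derivative f (at x within S) v) S)"

definition smooth_on :: "('a::euclidean_space \<Rightarrow> 'b::real_normed_vector) \<Rightarrow> 'a set \<Rightarrow> bool" where
  "smooth_on f S \<longleftrightarrow> (\<forall>k. Ck_on k f S)"

text \<open>
  The operators below use the full derivative at \<open>x\<close>; they are only applied at points of
  the open slab, where this agrees with the derivative relative to the closed slab.
\<close>

definition partial :: "3 \<Rightarrow> (real ^ 3 \<Rightarrow> 'b::real_normed_vector) \<Rightarrow> real ^ 3 \<Rightarrow> 'b" where
  "partial i f x = frechet_derivative f (at x) (axis i 1)"

definition laplacian :: "(real ^ 3 \<Rightarrow> 'b::real_normed_vector) \<Rightarrow> real ^ 3 \<Rightarrow> 'b" where
  "laplacian f x = (\<Sum>i\<in>UNIV. partial i (partial i f) x)"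

definition gradient :: "(real ^ 3 \<Rightarrow> real) \<Rightarrow> real ^ 3 \<Rightarrow> real ^ 3" where
  "gradient p x = (\<chi> i. partial i p x)"

definition divergence :: "(real ^ 3 \<Rightarrow> real ^ 3) \<Rightarrow> real ^ 3 \<Rightarrow> real" where
  "divergence u x = (\<Sum>i\<in>UNIV. partial i u x $ i)"

definition convection :: "(real ^ 3 \<Rightarrow> real ^ 3) \<Rightarrow> real ^ 3 \<Rightarrow> real ^ 3" where
  "convection u x = (\<Sum>i\<in>UNIV. u x $ i *\<^sub>R partial i u x)"

definition grad_norm_sq :: "(real ^ 3 \<Rightarrow> real ^ 3) \<Rightarrow> real ^ 3 \<Rightarrow> real" where
  "grad_norm_sq u x = (\<Sum>i\<in>UNIV. \<Sum>j\<in>UNIV. (partial i u x $ j)\<^sup>2)"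

definition smooth_steady_NS :: "(real ^ 3 \<Rightarrow> real ^ 3) \<Rightarrow> bool" where
  "smooth_steady_NS u \<longleftrightarrow> smooth_on u closed_slab \<and>
     (\<exists>P :: real ^ 3 \<Rightarrow> real. smooth_on P closed_slab \<and>
       (\<forall>x\<in>slab. - laplacian u x + convection u x + gradient P x = 0 \<and> divergence u x = 0))"

definition no_slip :: "(real ^ 3 \<Rightarrow> real ^ 3) \<Rightarrow> bool" where
  "no_slip u \<longleftrightarrow> (\<forall>x. x $ 3 = 0 \<or> x $ 3 = 1 \<longrightarrow> u x = 0)"

definition cyl :: "real \<Rightarrow> real \<Rightarrow> real \<Rightarrow> real ^ 3" where
  "cyl r \<theta> z = vector [r * cos \<theta>, r * sin \<theta>, z]"

definition e_r :: "real \<Rightarrow> real ^ 3" where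
  "e_r \<theta> = vector [cos \<theta>, sin \<theta>, 0]"

definition e_theta :: "real \<Rightarrow> real ^ 3" where
  "e_theta \<theta> = vector [- sin \<theta>, cos \<theta>, 0]"

definition e_z :: "real ^ 3" where
  "e_z = vector [0, 0, 1]"

text \<open>
  The cylindrical components are required to be independent of the angle for \<open>r > 0\<close>, where
  the cylindrical frame is defined.
\<close>

definition axisymmetric :: "(real ^ 3 \<Rightarrow> real ^ 3) \<Rightarrow> bool" where
  "axisymmetric u \<longleftrightarrow> (\<forall>r>0. \<forall>z\<in>{0..1}. \<forall>\<theta> \<phi>.
     u (cyl r \<theta> z) \<bullet> e_r \<theta> = u (cyl r \<phi> z) \<bullet> e_r \<phi> \<and>
     u (cyl r \<theta> z) \<bullet> e_theta \<theta> = u (cyl r \<phi> z) \<bullet> e_theta \<phi> \<and>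
     u (cyl r \<theta> z) \<bullet> e_z = u (cyl r \<phi> z) \<bullet> e_z)"

definition energy :: "(real ^ 3 \<Rightarrow> real ^ 3) \<Rightarrow> real \<Rightarrow> real" where
  "energy u R = (LINT x:{x \<in> slab. (x $ 1)\<^sup>2 + (x $ 2)\<^sup>2 < R\<^sup>2}|lborel. grad_norm_sq u x)"

text \<open>For axisymmetric \<open>u\<close> the choice of the angle \<open>0\<close> is immaterial.\<close>

definition speed :: "(real ^ 3 \<Rightarrow> real ^ 3) \<Rightarrow> real \<Rightarrow> real \<Rightarrow> real" where
  "speed u r z = norm (u (cyl r 0 z))"

end

theory Submission
  imports Defs
begin

text \<open>
  Write \<open>r\<^sup>2 = x\<^sub>1\<^sup>2 + x\<^sub>2\<^sup>2\<close>, let \<open>\<phi>\<close> be a cutoff depending on \<open>r\<close> only, equal to \<open>1\<close> for \<open>r \<le> R\<close> and to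
  \<open>0\<close> for \<open>r \<ge> R + d\<close>, and let \<open>F(R)\<close> be the integral of \<open>\<phi> |\<nabla>u|\<^sup>2\<close> over the slab.

  The pressure is removed exactly. Testing the equation with \<open>\<phi> u\<close> would leave the integral of
  \<open>P u \<cdot> \<nabla>\<phi>\<close>. Put \<open>W(x) = \<integral>\<^sub>0\<^sup>z r u\<^sup>r dz\<close>. Incompressibility, axisymmetry and the no-slip condition give
  \<open>\<partial>\<^sub>1W = - x\<^sub>1u\<^sup>z\<close>, \<open>\<partial>\<^sub>2W = - x\<^sub>2u\<^sup>z\<close> and hence \<open>W = 0\<close> at the upper wall as well: no net flux passes through
  a coaxial cylinder. If \<open>\<nabla>\<phi> = \<psi> (x\<^sub>1, x\<^sub>2, 0)\<close>, the field \<open>v = \<phi> u - \<psi> W e\<^sub>z\<close> vanishes on the walls and outside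
  a bounded set, and \<open>div v = u \<cdot> \<nabla>\<phi> - \<psi> \<partial>\<^sub>3W = 0\<close>. Testing with \<open>v\<close> gives \<open>F(R)\<close> as an integral over
  \<open>R < r < R + d\<close> of terms that are quadratic or cubic in \<open>u\<close> and of first order at most
  (\<open>energy_identity\<close>, \<open>energy_balance\<close>). Since the gradient of \<open>W\<close> contains no derivative of \<open>u\<close>, all
  these terms are easy to bound.

  A lower bound for the growth of \<open>F\<close>. Take \<open>d = 1\<close> and let \<open>e\<close> be the energy \<open>F(R + 1) - F(R - 1)\<close> near
  the annulus. By the Poincare inequality in \<open>z\<close> the quadratic terms are at most \<open>C e\<close>. The cubic terms gain a
  factor from axisymmetry: \<open>\<integral>\<^sub>0\<^sup>1 |u|\<^sup>2 dz\<close> is a function of \<open>r\<close> alone, so its maximum over the annulus is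
  controlled by the energy per unit of circumference and is at most \<open>3 e / R\<close> (\<open>slice_V_le_window_energy\<close>). Together,
  \<open>F(R) \<le> C (e + \<lambda> e + e\<^sup>2 / (R \<lambda>))\<close> for every \<open>\<lambda> > 0\<close> (\<open>disk_energy_growth\<close>); the best \<open>\<lambda>\<close> turns this into
  a discrete form of \<open>F' \<ge> c min (F, R\<^bsup>1/3\<^esup> F\<^bsup>2/3\<^esup>)\<close>. Thus either \<open>u = 0\<close> or \<open>F(R) \<ge> \<delta> R\<^sup>4\<close> for some
  \<open>\<delta> > 0\<close> and all large \<open>R\<close> (\<open>quartic_growth\<close>, \<open>disk_energy_quartic\<close>). This settles (a).

  An upper bound for \<open>F\<close> under (b). Take \<open>d = R\<close> and let \<open>m\<close> bound \<open>|u|\<close> on \<open>r \<le> 2R\<close>. All terms containing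
  \<open>\<nabla>u\<close> can be absorbed into \<open>\<phi> |\<nabla>u|\<^sup>2\<close>, and \<open>F(R) \<le> C R\<^sup>2 (m\<^sup>2/R\<^sup>2 + m\<^sup>3/R + m\<^sup>4/R\<^sup>2)\<close> remains
  (\<open>caccioppoli\<close>). Under (b), \<open>m = 2 \<epsilon> R\<close> is admissible for large \<open>R\<close>, so \<open>F(R) = o(R\<^sup>4)\<close>, which contradicts
  the lower bound unless \<open>u = 0\<close>.
\<close>

section \<open>Scalar functions with continuous gradient on the closed slab\<close>

abbreviation pt :: "real \<Rightarrow> real \<Rightarrow> real \<Rightarrow> real ^ 3" where
  "pt a b c \<equiv> vector [a, b, c]"

lemma pt_eta: "pt (x $ 1) (x $ 2) (x $ 3) = x"
  by (simp add: vec_eq_iff forall_3)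

lemma pt_in_closed_slab: "pt a b c \<in> closed_slab \<longleftrightarrow> c \<in> {0..1}"
  by (simp add: closed_slab_def)

lemma mem_cbox_pt: "x \<in> cbox (pt a b c) (pt a' b' c') \<longleftrightarrow>
  x $ 1 \<in> {a..a'} \<and> x $ 2 \<in> {b..b'} \<and> x $ 3 \<in> {c..c'}"
  by (auto simp: mem_box_cart forall_3)

lemma continuous_on_pt:
  assumes "continuous_on A f" "continuous_on A g" "continuous_on A h"
  shows "continuous_on A (\<lambda>x. pt (f x) (g x) (h x))"
proof -
  have "(\<lambda>x. pt (f x) (g x) (h x)) = (\<lambda>x. \<chi> i. if i = 1 then f x else if i = 2 then g x else h x)"
    by (rule ext) (simp add: vec_eq_iff forall_3)
  moreover have "continuous_on A (\<lambda>x. if i = (1::3) then f x else if i = 2 then g x else h x)" for i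
    using assms by (cases "i = 1"; cases "i = 2") auto
  ultimately show ?thesis by (simp only: continuous_on_vec_lambda)
qed

text \<open>
  Only derivatives along coordinate lines are recorded, one-sided in the third variable at the walls.
  This is what the product rule and the fundamental theorem of calculus use, and it allows
  primitives in the third variable to be differentiated one variable at a time.
\<close>

definition has_grad :: "(real ^ 3 \<Rightarrow> real) \<Rightarrow> (3 \<Rightarrow> real ^ 3 \<Rightarrow> real) \<Rightarrow> bool" where
  "has_grad f f' \<longleftrightarrow> continuous_on closed_slab f \<and> (\<forall>i. continuous_on closed_slab (f' i)) \<and>
     (\<forall>a b. \<forall>c\<in>{0..1}.
        ((\<lambda>t. f (pt t b c)) has_real_derivative f' 1 (pt a b c)) (at a) \<and>
        ((\<lambda>t. f (pt a t c)) has_real_derivative f' 2 (pt a b c)) (at b) \<and>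
        ((\<lambda>t. f (pt a b t)) has_real_derivative f' 3 (pt a b c)) (at c within {0..1}))"

lemma has_gradI:
  assumes "continuous_on closed_slab f" "\<And>i. continuous_on closed_slab (f' i)"
    and "\<And>a b c. 0 \<le> c \<Longrightarrow> c \<le> 1 \<Longrightarrow> ((\<lambda>t. f (pt t b c)) has_real_derivative f' 1 (pt a b c)) (at a)"
    and "\<And>a b c. 0 \<le> c \<Longrightarrow> c \<le> 1 \<Longrightarrow> ((\<lambda>t. f (pt a t c)) has_real_derivative f' 2 (pt a b c)) (at b)"
    and "\<And>a b c. 0 \<le> c \<Longrightarrow> c \<le> 1 \<Longrightarrow> ((\<lambda>t. f (pt a b t)) has_real_derivative f' 3 (pt a b c)) (at c within {0..1})"
  shows "has_grad f f'"
  using assms unfolding has_grad_def by auto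

lemma has_gradD:
  assumes "has_grad f f'"
  shows "continuous_on closed_slab f" "continuous_on closed_slab (f' i)"
    and "0 \<le> c \<Longrightarrow> c \<le> 1 \<Longrightarrow> ((\<lambda>t. f (pt t b c)) has_real_derivative f' 1 (pt a b c)) (at a)"
    and "0 \<le> c \<Longrightarrow> c \<le> 1 \<Longrightarrow> ((\<lambda>t. f (pt a t c)) has_real_derivative f' 2 (pt a b c)) (at b)"
    and "0 \<le> c \<Longrightarrow> c \<le> 1 \<Longrightarrow> ((\<lambda>t. f (pt a b t)) has_real_derivative f' 3 (pt a b c)) (at c within {0..1})"
  using assms unfolding has_grad_def by auto

lemma has_grad_cong:
  assumes "has_grad f f'" "\<And>i x. x \<in> closed_slab \<Longrightarrow> f' i x = f'' i x"
  shows "has_grad f f''"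
proof -
  have "continuous_on closed_slab (f'' i)" for i
    using has_gradD(2)[OF assms(1), of i] assms(2) continuous_on_cong by metis
  then show ?thesis
    using assms by (auto simp: has_grad_def pt_in_closed_slab)
qed

lemma has_grad_add:
  assumes "has_grad f f'" "has_grad g g'"
  shows "has_grad (\<lambda>x. f x + g x) (\<lambda>i x. f' i x + g' i x)"
  by (intro has_gradI continuous_intros derivative_intros has_gradD[OF assms(1)] has_gradD[OF assms(2)])

lemma has_grad_mult:
  assumes "has_grad f f'" "has_grad g g'"
  shows "has_grad (\<lambda>x. f x * g x) (\<lambda>i x. f' i x * g x + f x * g' i x)"
proof (intro has_gradI)
  show "continuous_on closed_slab (\<lambda>x. f' i x * g x + f x * g' i x)" for i
    by (intro continuous_intros has_gradD[OF assms(1)] has_gradD[OF assms(2)])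
qed (auto intro!: derivative_eq_intros continuous_intros has_gradD[OF assms(1)] has_gradD[OF assms(2)])

lemma has_grad_const: "has_grad (\<lambda>x. k) (\<lambda>i x. 0)"
  by (intro has_gradI) auto

lemma has_grad_cmult:
  assumes "has_grad f f'"
  shows "has_grad (\<lambda>x. k * f x) (\<lambda>i x. k * f' i x)"
  using has_grad_mult[OF has_grad_const[of k] assms] by simp

lemma has_grad_sum:
  assumes "\<And>j. j \<in> A \<Longrightarrow> has_grad (f j) (f' j)"
  shows "has_grad (\<lambda>x. \<Sum>j\<in>A. f j x) (\<lambda>i x. \<Sum>j\<in>A. f' j i x)"
proof (cases "finite A")
  case True
  then show ?thesis using assms
  proof (induction A rule: finite_induct)
    case empty
    show ?case by (simp add: has_grad_const)
  next
    case (insert k A)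
    then show ?case by (simp add: has_grad_add)
  qed
qed (simp add: has_grad_const)

lemma has_grad_coord: "has_grad (\<lambda>x. x $ k) (\<lambda>i x. if i = k then 1 else 0)"
proof (intro has_gradI)
  show "((\<lambda>t. pt t b c $ k) has_real_derivative (if 1 = k then 1 else 0)) (at a)" for a b c
    using exhaust_3[of k] by auto
  show "((\<lambda>t. pt a t c $ k) has_real_derivative (if 2 = k then 1 else 0)) (at b)" for a b c
    using exhaust_3[of k] by auto
  show "((\<lambda>t. pt a b t $ k) has_real_derivative (if 3 = k then 1 else 0)) (at c within {0..1})" for a b c
    using exhaust_3[of k] by auto
qed (auto intro!: continuous_intros)

lemma has_grad_chain:
  assumes "has_grad f f'"
    and g: "\<And>y. (g has_real_derivative g' y) (at y)" "continuous_on UNIV g'"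
  shows "has_grad (\<lambda>x. g (f x)) (\<lambda>i x. g' (f x) * f' i x)"
proof -
  have cg: "continuous_on UNIV g"
    using g(1) by (meson DERIV_isCont continuous_at_imp_continuous_on)
  show ?thesis
    by (intro has_gradI DERIV_chain2[where f=g, OF g(1)] has_gradD[OF assms(1)] 
        continuous_on_compose2[OF cg] continuous_on_compose2[OF g(2)] continuous_intros)
       auto
qed

section \<open>Integration over boxes and integration by parts\<close>

definition cyl_box :: "real \<Rightarrow> (real ^ 3) set" where
  "cyl_box M = cbox (pt (-M) (-M) 0) (pt M M 1)"

lemma cyl_box_sub: "cyl_box M \<subseteq> closed_slab"
  by (auto simp: cyl_box_def closed_slab_def mem_cbox_pt)

lemma Basis_R3: "(Basis :: (real \<times> real \<times> real) set) = {(1,0,0),(0,1,0),(0,0,1)}"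
  by (auto simp: Basis_prod_def zero_prod_def)

lemma content_triple_eq_cart:
  "measure lborel (cbox (pt a b c) (pt a' b' c')) = measure lborel (cbox (a,b,c) (a',b',c'))"
proof (cases "a \<le> a' \<and> b \<le> b' \<and> c \<le> c'")
  case True
  then have ne: "cbox (pt a b c) (pt a' b' c') \<noteq> {}"
    by (simp add: interval_ne_empty_cart forall_3)
  show ?thesis
    using True
    unfolding content_cbox_cart[OF ne] UNIV_3
    by (simp add: content_cbox Basis_R3 inner_prod_def)
next
  case False
  then have "cbox (pt a b c) (pt a' b' c') = {}" "cbox (a,b,c) (a',b',c') = {}"
    by (auto simp: mem_cbox_pt cbox_Pair_eq)
  then show ?thesis by simp
qed

text \<open>
  The volume-preserving identification of \<open>real ^ 3\<close> with a threefold product, on which Fubini's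
  theorem can be iterated.
\<close>

lemma has_integral_pt:
  assumes "(f has_integral I) (cbox (pt a b c) (pt a' b' c'))"
  shows "((\<lambda>(x,y,z). f (pt x y z)) has_integral I) (cbox (a,b,c) (a',b',c'))"
proof -
  let ?g = "\<lambda>(x,y,z). pt x y z" and ?h = "\<lambda>v::real^3. (v $ 1, v $ 2, v $ 3)"
  have hg: "?h (?g p) = p" for p by (cases p) auto
  have gh: "?g (?h v) = v" for v by (simp add: pt_eta)
  have gim: "?g ` cbox (a,b,c) (a',b',c') = cbox (pt a b c) (pt a' b' c')" for a b c a' b' c'
  proof (intro equalityI subsetI)
    fix v assume "v \<in> cbox (pt a b c) (pt a' b' c')"
    then have "?h v \<in> cbox (a,b,c) (a',b',c')"
      by (auto simp: mem_cbox_pt cbox_Pair_eq)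
    then have "?g (?h v) \<in> ?g ` cbox (a,b,c) (a',b',c')" by (rule imageI)
    then show "v \<in> ?g ` cbox (a,b,c) (a',b',c')" unfolding gh .
  qed (auto simp: mem_cbox_pt cbox_Pair_eq)
  have him: "?h ` cbox (pt a b c) (pt a' b' c') = cbox (a,b,c) (a',b',c')" for a b c a' b' c'
    unfolding gim[symmetric] image_image using hg by simp
  have "((\<lambda>p. f (?g p)) has_integral (1 / 1) *\<^sub>R I) (?h ` cbox (pt a b c) (pt a' b' c'))"
  proof (rule has_integral_twiddle[OF _ hg gh _ _ _ _ assms])
    have "continuous_on UNIV ?g"
      unfolding case_prod_beta by (intro continuous_on_pt continuous_intros)
    then show "continuous (at p) ?g" for p
      using continuous_on_eq_continuous_at[OF open_UNIV] by blast
    show "\<exists>w z. ?g ` cbox u v = cbox w z" for u v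
      using gim by (cases u; cases v) blast
    show "\<exists>w z. ?h ` cbox u v = cbox w z" for u v
      using him[of "u $ 1" "u $ 2" "u $ 3" "v $ 1" "v $ 2" "v $ 3"] unfolding pt_eta by blast
    show "measure lborel (?g ` cbox u v) = 1 * measure lborel (cbox u v)" for u v
      by (cases u; cases v) (simp add: gim content_triple_eq_cart)
  qed simp
  then show ?thesis by (simp add: him case_prod_beta')
qed

lemma continuous_on_slab_pt:
  assumes "continuous_on closed_slab f" "continuous_on A a" "continuous_on A b" "continuous_on A c"
    and "\<And>x. x \<in> A \<Longrightarrow> c x \<in> {0..1}"
  shows "continuous_on A (\<lambda>x. f (pt (a x) (b x) (c x)))"
  by (rule continuous_on_compose2[OF assms(1)]) (use assms in \<open>auto intro!: continuous_on_pt simp: pt_in_closed_slab\<close>)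

lemma integrable_cyl_box:
  fixes f :: "real ^ 3 \<Rightarrow> real"
  assumes "continuous_on closed_slab f"
  shows "f integrable_on cyl_box M"
  unfolding cyl_box_def
  by (rule integrable_continuous, rule continuous_on_subset[OF assms cyl_box_sub[unfolded cyl_box_def]])

lemma integral_cyl_box_triple:
  fixes f :: "real ^ 3 \<Rightarrow> real"
  assumes "continuous_on closed_slab f"
  shows "integral (cyl_box M) f = integral (cbox (-M,-M,0) (M,M,1)) (\<lambda>(x,y,z). f (pt x y z))"
  unfolding cyl_box_def
  by (rule sym, rule integral_unique, rule has_integral_pt, rule integrable_integral,
      rule integrable_cyl_box[OF assms, unfolded cyl_box_def])

lemma continuous_on_slab_triple:
  assumes "continuous_on closed_slab f"
  shows "continuous_on (cbox (a,b,0) (a',b',1)) (\<lambda>(x,y,z). f (pt x y z))"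
  unfolding case_prod_beta
  by (intro continuous_on_slab_pt[OF assms] continuous_intros) (auto simp: cbox_Pair_eq)

lemma integral_cyl_box:
  fixes f :: "real ^ 3 \<Rightarrow> real"
  assumes "continuous_on closed_slab f"
  shows "integral (cyl_box M) f =
    integral {-M..M} (\<lambda>a. integral {-M..M} (\<lambda>b. integral {0..1} (\<lambda>c. f (pt a b c))))"
proof -
  have "integral (cyl_box M) f =
    integral {-M..M} (\<lambda>a. integral (cbox (-M,0) (M,1)) (\<lambda>y. case y of (b,c) \<Rightarrow> f (pt a b c)))"
    unfolding integral_cyl_box_triple[OF assms]
    by (subst integral_prod_continuous[OF continuous_on_slab_triple[OF assms]]) simp
  also have "\<dots> = integral {-M..M} (\<lambda>a. integral {-M..M} (\<lambda>b. integral {0..1} (\<lambda>c. f (pt a b c))))"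
  proof (rule arg_cong[where f="integral {-M..M}"], rule ext)
    fix a
    have "continuous_on (cbox (-M,0) (M,1)) (\<lambda>(b,c). f (pt a b c))"
      unfolding case_prod_beta
      by (intro continuous_on_slab_pt[OF assms] continuous_intros) (auto simp: cbox_Pair_eq)
    then show "integral (cbox (-M,0) (M,1)) (\<lambda>(b,c). f (pt a b c)) =
       integral {-M..M} (\<lambda>b. integral {0..1} (\<lambda>c. f (pt a b c)))"
      by (subst integral_prod_continuous) auto
  qed
  finally show ?thesis .
qed

lemma integral_cyl_box_swap:
  fixes f :: "real ^ 3 \<Rightarrow> real"
  assumes "continuous_on closed_slab f"
  shows "integral (cyl_box M) f = integral {-M..M} (\<lambda>b. integral {-M..M} (\<lambda>a. integral {0..1} (\<lambda>c. f (pt a b c))))"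
proof -
  have cont: "continuous_on (cbox (-M, -M) (M, M)) (\<lambda>p. integral (cbox 0 1) (\<lambda>c. f (pt (fst p) (snd p) c)))"
  proof (rule integral_continuous_on_param, unfold case_prod_beta)
    show "continuous_on (cbox (-M, -M) (M, M) \<times> cbox 0 1) (\<lambda>q. f (pt (fst (fst q)) (snd (fst q)) (snd q)))"
      by (intro continuous_on_slab_pt[OF assms] continuous_intros) auto
  qed
  have "integral (cbox (-M) M) (\<lambda>a. integral (cbox (-M) M) (\<lambda>b. integral {0..1} (\<lambda>c. f (pt a b c)))) =
      integral (cbox (-M) M) (\<lambda>b. integral (cbox (-M) M) (\<lambda>a. integral {0..1} (\<lambda>c. f (pt a b c))))"
    by (rule integral_swap_continuous) (use cont in \<open>simp add: case_prod_beta\<close>)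
  then show ?thesis
    by (simp add: integral_cyl_box[OF assms])
qed

text \<open>
  Integrate first in direction \<open>i\<close>: the inner integral is a difference of two boundary values of
  \<open>f\<close>. Summed over the components of a vector field this is the divergence theorem.
\<close>

lemma integral_partial_eq_0:
  assumes f: "has_grad f f'" and "M \<ge> 0"
    and side: "\<And>x. x \<in> closed_slab \<Longrightarrow> \<bar>x $ 1\<bar> \<ge> M \<or> \<bar>x $ 2\<bar> \<ge> M \<Longrightarrow> f x = 0"
    and wall: "\<And>x. i = 3 \<Longrightarrow> x $ 3 = 0 \<or> x $ 3 = 1 \<Longrightarrow> f x = 0"
  shows "integral (cyl_box M) (f' i) = 0"
proof -
  note cont = has_gradD(2)[OF f]
  have MM: "-M \<le> M" using \<open>M \<ge> 0\<close> by simp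
  consider "i = 1" | "i = 2" | "i = 3" using exhaust_3[of i] by blast
  then show ?thesis
  proof cases
    case 1
    have "integral (cyl_box M) (f' 1) =
      integral (cbox (-M) M) (\<lambda>a. integral (cbox (-M,0) (M,1)) (\<lambda>p. f' 1 (pt a (fst p) (snd p))))"
      unfolding integral_cyl_box_triple[OF cont]
      by (subst integral_prod_continuous[OF continuous_on_slab_triple[OF cont]]) (simp add: case_prod_beta)
    also have "\<dots> = integral (cbox (-M,0) (M,1)) (\<lambda>p. integral (cbox (-M) M) (\<lambda>a. f' 1 (pt a (fst p) (snd p))))"
      using continuous_on_slab_triple[OF cont[of 1], of "-M" "-M" M M]
      by (intro integral_swap_continuous) (simp add: case_prod_beta)
    also have "\<dots> = integral (cbox (-M,0) (M,1::real)) (\<lambda>p. 0)"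
    proof (rule Henstock_Kurzweil_Integration.integral_cong)
      fix p assume "p \<in> cbox (-M, 0) (M, 1::real)"
      then have p: "0 \<le> snd p" "snd p \<le> 1" by (auto simp: cbox_Pair_eq)
      have "((\<lambda>a. f' 1 (pt a (fst p) (snd p))) has_integral
          f (pt M (fst p) (snd p)) - f (pt (-M) (fst p) (snd p))) {-M..M}"
        by (rule fundamental_theorem_of_calculus[OF MM])
           (use has_gradD(3)[OF f p] in \<open>auto simp: has_real_derivative_iff_has_vector_derivative
              intro: has_vector_derivative_at_within\<close>)
      moreover have "f (pt M (fst p) (snd p)) = 0" "f (pt (-M) (fst p) (snd p)) = 0"
        using p \<open>M \<ge> 0\<close> by (auto intro!: side simp: pt_in_closed_slab)
      ultimately show "integral (cbox (-M) M) (\<lambda>a. f' 1 (pt a (fst p) (snd p))) = 0"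
        by (simp add: integral_unique)
    qed
    finally show ?thesis by (simp add: 1)
  next
    case 2
    have "integral {-M..M} (\<lambda>b. integral {0..1} (\<lambda>c. f' 2 (pt a b c))) = 0" for a
    proof -
      have "continuous_on (cbox (-M, 0) (M, 1)) (\<lambda>(b,c). f' 2 (pt a b c))"
        unfolding case_prod_beta
        by (intro continuous_on_slab_pt[OF cont] continuous_intros) (auto simp: cbox_Pair_eq)
      then have "integral (cbox (-M) M) (\<lambda>b. integral (cbox 0 1) (\<lambda>c. f' 2 (pt a b c))) =
        integral (cbox 0 1) (\<lambda>c. integral (cbox (-M) M) (\<lambda>b. f' 2 (pt a b c)))"
        by (rule integral_swap_continuous)
      also have "\<dots> = integral (cbox 0 (1::real)) (\<lambda>c. 0)"
      proof (rule Henstock_Kurzweil_Integration.integral_cong)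
        fix c :: real assume "c \<in> cbox 0 1"
        then have c: "0 \<le> c" "c \<le> 1" by auto
        have "((\<lambda>b. f' 2 (pt a b c)) has_integral f (pt a M c) - f (pt a (-M) c)) {-M..M}"
          by (rule fundamental_theorem_of_calculus[OF MM])
             (use has_gradD(4)[OF f c] in \<open>auto simp: has_real_derivative_iff_has_vector_derivative
                intro: has_vector_derivative_at_within\<close>)
        moreover have "f (pt a M c) = 0" "f (pt a (-M) c) = 0"
          using c \<open>M \<ge> 0\<close> by (auto intro!: side simp: pt_in_closed_slab)
        ultimately show "integral (cbox (-M) M) (\<lambda>b. f' 2 (pt a b c)) = 0"
          by (simp add: integral_unique)
      qed
      finally show ?thesis by simp
    qed
    then show ?thesis by (simp add: 2 integral_cyl_box[OF cont])
  next
    case 3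
    have "integral {0..1} (\<lambda>c. f' 3 (pt a b c)) = 0" for a b
    proof -
      have "((\<lambda>c. f' 3 (pt a b c)) has_integral f (pt a b 1) - f (pt a b 0)) {0..1}"
        by (rule fundamental_theorem_of_calculus)
           (use has_gradD(5)[OF f] in \<open>auto simp: has_real_derivative_iff_has_vector_derivative\<close>)
      then show ?thesis using wall[OF 3] by (simp add: integral_unique)
    qed
    then show ?thesis by (simp add: 3 integral_cyl_box[OF cont])
  qed
qed

lemma integral_cyl_box_extend:
  fixes f :: "real ^ 3 \<Rightarrow> real"
  assumes "M \<le> M'" "\<And>x. x \<in> closed_slab \<Longrightarrow> M < \<bar>x $ 1\<bar> \<or> M < \<bar>x $ 2\<bar> \<Longrightarrow> f x = 0"
  shows "integral (cyl_box M') f = integral (cyl_box M) f"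
proof -
  have "integral (cyl_box M') f = integral (cyl_box M') (\<lambda>x. if x \<in> cyl_box M then f x else 0)"
  proof (rule Henstock_Kurzweil_Integration.integral_cong)
    fix x assume "x \<in> cyl_box M'"
    then show "f x = (if x \<in> cyl_box M then f x else 0)"
      using assms(2)[of x] cyl_box_sub[of M'] by (auto simp: cyl_box_def mem_cbox_pt abs_real_def split: if_splits)
  qed
  also have "\<dots> = integral (cyl_box M \<inter> cyl_box M') f"
    by (rule integral_restrict_Int)
  also have "cyl_box M \<inter> cyl_box M' = cyl_box M"
    using assms(1) by (auto simp: cyl_box_def mem_cbox_pt)
  finally show ?thesis .
qed

lemma integral_cyl_box_mono:
  fixes f g :: "real ^ 3 \<Rightarrow> real"
  assumes "continuous_on closed_slab f" "continuous_on closed_slab g"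
    and "\<And>x. x \<in> closed_slab \<Longrightarrow> f x \<le> g x"
  shows "integral (cyl_box M) f \<le> integral (cyl_box M) g"
  using assms cyl_box_sub by (intro integral_le integrable_cyl_box) auto

lemma integral_cyl_box_const:
  assumes "0 \<le> M"
  shows "integral (cyl_box M) (\<lambda>x. k) = 4 * M\<^sup>2 * k"
  using assms by (subst integral_cyl_box) (auto simp: power2_eq_square)

text \<open>
  Absorption of a product: the square root of \<open>a b\<close> is at most \<open>a/8 + 2b\<close>. Stating the hypothesis
  for \<open>X\<^sup>2\<close> keeps roots out of the applications.
\<close>

lemma young_of_square:
  fixes X a b :: real
  assumes "X\<^sup>2 \<le> a * b" "0 \<le> a" "0 \<le> b"
  shows "\<bar>X\<bar> \<le> a / 8 + 2 * b"
proof (rule abs_le_square_iff[THEN iffD2, of X "a / 8 + 2 * b", simplified, THEN order_trans])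
  have "0 \<le> (a / 8 - 2 * b)\<^sup>2" by simp
  then have "a * b \<le> (a / 8 + 2 * b)\<^sup>2" by (simp add: power2_eq_square algebra_simps)
  then show "X\<^sup>2 \<le> (a / 8 + 2 * b)\<^sup>2" using assms by simp
qed (use assms in auto)

text \<open>
  The Cauchy--Schwarz inequality in the form used below. With \<open>I = \<integral>\<^sub>0\<^sup>c f\<close>, integrating
  \<open>(f - I)\<^sup>2 \<ge> 0\<close> gives \<open>(2 - c) I\<^sup>2 \<le> \<integral>\<^sub>0\<^sup>c f\<^sup>2\<close>, and \<open>2 - c \<ge> 1\<close>.
\<close>

lemma square_integral_le:
  assumes f: "continuous_on {0..1} f" and c: "0 \<le> c" "c \<le> (1::real)"
  shows "(integral {0..c} f)\<^sup>2 \<le> integral {0..1} (\<lambda>s. (f s)\<^sup>2 :: real)"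
proof -
  define I where "I = integral {0..c} f"
  have f': "continuous_on {0..c} f" by (rule continuous_on_subset[OF f]) (use c in auto)
  have int: "f integrable_on {0..c}" "(\<lambda>s. (f s)\<^sup>2) integrable_on {0..c}"
    "(\<lambda>s. (f s)\<^sup>2) integrable_on {0..1}"
    using f f' by (auto intro!: integrable_continuous_interval continuous_intros)
  have "0 \<le> integral {0..c} (\<lambda>s. (f s - I)\<^sup>2)"
    by (intro integral_nonneg integrable_continuous_interval continuous_intros f') auto
  also have "\<dots> = integral {0..c} (\<lambda>s. (f s)\<^sup>2 + (I\<^sup>2 - 2 * I * f s))"
    by (simp add: power2_diff algebra_simps)
  also have "\<dots> = integral {0..c} (\<lambda>s. (f s)\<^sup>2) + integral {0..c} (\<lambda>s. I\<^sup>2 - 2 * I * f s)"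
    by (intro integral_add int integrable_continuous_interval continuous_intros f')
  also have "integral {0..c} (\<lambda>s. I\<^sup>2 - 2 * I * f s) = integral {0..c} (\<lambda>s. I\<^sup>2) - integral {0..c} (\<lambda>s. 2 * I * f s)"
    by (intro integral_diff integrable_continuous_interval continuous_intros f')
  also have "\<dots> = c * I\<^sup>2 - 2 * I * I"
    using c by (simp add: I_def)
  finally have "I\<^sup>2 * (2 - c) \<le> integral {0..c} (\<lambda>s. (f s)\<^sup>2)"
    by (simp add: power2_eq_square algebra_simps)
  moreover have "I\<^sup>2 * 1 \<le> I\<^sup>2 * (2 - c)" by (intro mult_left_mono) (use c in auto)
  moreover have "integral {0..c} (\<lambda>s. (f s)\<^sup>2) \<le> integral {0..1} (\<lambda>s. (f s)\<^sup>2)"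
    by (intro integral_subset_le int) (use c in auto)
  ultimately show ?thesis by (simp add: I_def)
qed

text \<open>
  On an interval of length at least \<open>1\<close> a nonnegative function is bounded by its integral plus its
  total variation: compare \<open>h t\<close> with every other value and average.
\<close>

lemma le_integral_of_derivative_bound:
  fixes h h' k :: "real \<Rightarrow> real"
  assumes ab: "a + 1 \<le> b"
    and deriv: "\<And>t. t \<in> {a..b} \<Longrightarrow> (h has_real_derivative h' t) (at t)"
    and cont: "continuous_on {a..b} h'" "continuous_on {a..b} k"
    and nn: "\<And>t. t \<in> {a..b} \<Longrightarrow> 0 \<le> h t"
    and bd: "\<And>t. t \<in> {a..b} \<Longrightarrow> \<bar>h' t\<bar> \<le> k t"
    and t: "t \<in> {a..b}"
  shows "h t \<le> integral {a..b} h + integral {a..b} k"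
proof -
  define K where "K = integral {a..b} k"
  have hc: "continuous_on {a..b} h"
    using deriv by (meson DERIV_isCont continuous_at_imp_continuous_on)
  have kint: "k integrable_on {a..b}" and hint: "h integrable_on {a..b}"
    using cont hc by (auto intro: integrable_continuous_interval)
  have k0: "0 \<le> k s" if "s \<in> {a..b}" for s using bd[OF that] by linarith
  have osc: "\<bar>h s' - h s\<bar> \<le> K" if s: "s \<in> {a..b}" "s' \<in> {a..b}" "s \<le> s'" for s s'
  proof -
    have sub: "{s..s'} \<subseteq> {a..b}" using s by auto
    have "(h' has_integral h s' - h s) {s..s'}"
      by (rule fundamental_theorem_of_calculus[OF s(3)])
         (use deriv sub in \<open>auto simp: has_real_derivative_iff_has_vector_derivative intro: has_vector_derivative_at_within\<close>)
    then have "\<bar>h s' - h s\<bar> = \<bar>integral {s..s'} h'\<bar>" by (simp add: integral_unique)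
    also have "\<dots> \<le> integral {s..s'} k"
    proof -
      have "norm (integral {s..s'} h') \<le> integral {s..s'} k"
        by (rule integral_norm_bound_integral)
           (use cont sub bd in \<open>auto intro!: integrable_continuous_interval intro: continuous_on_subset\<close>)
      then show ?thesis by simp
    qed
    also have "\<dots> \<le> K"
      unfolding K_def using sub k0 kint cont
      by (intro integral_subset_le) (auto intro!: integrable_continuous_interval intro: continuous_on_subset)
    finally show ?thesis .
  qed
  have "h t - K \<le> h s" if "s \<in> {a..b}" for s
    using osc[OF that t] osc[OF t that] by (cases "s \<le> t") auto
  then have "integral {a..b} (\<lambda>s. h t - K) \<le> integral {a..b} h"
    by (intro integral_le hint) auto
  then have le: "(b - a) * (h t - K) \<le> integral {a..b} h" using ab by simp
  have "0 \<le> integral {a..b} h" by (rule integral_nonneg[OF hint nn])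
  have "h t - K \<le> integral {a..b} h"
  proof (cases "h t - K \<le> 0")
    case False
    then have "1 * (h t - K) \<le> (b - a) * (h t - K)" by (intro mult_right_mono) (use ab in auto)
    then show ?thesis using le by simp
  qed (use \<open>0 \<le> integral {a..b} h\<close> in simp)
  then show ?thesis by (simp add: K_def)
qed

lemma eventually_at_top_minus_one:
  fixes P :: "real \<Rightarrow> bool"
  assumes "\<forall>\<^sub>F R in at_top. P R"
  shows "\<forall>\<^sub>F R in at_top. P (R - 1)"
proof -
  have "filterlim (\<lambda>R::real. R - 1) at_top at_top"
    unfolding filterlim_at_top
  proof
    show "\<forall>\<^sub>F R in at_top. Z \<le> R - 1" for Z :: real
      using eventually_ge_at_top[of "Z + 1"] by eventually_elim simp
  qed
  then show ?thesis by (rule eventually_compose_filterlim[OF assms])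
qed

text \<open>
  The upper limit depends on the point; rescaling to the fixed interval \<open>{0..1}\<close> turns this into an
  integral depending continuously on a parameter.
\<close>

lemma continuous_on_primitive:
  fixes w :: "real ^ 3 \<Rightarrow> real"
  assumes w: "continuous_on closed_slab w"
  shows "continuous_on closed_slab (\<lambda>x. integral {0..x $ 3} (\<lambda>s. w (pt (x $ 1) (x $ 2) s)))"
proof -
  have eq: "integral {0..x $ 3} (\<lambda>s. w (pt (x $ 1) (x $ 2) s)) =
      x $ 3 * integral (cbox 0 1) (\<lambda>s. w (pt (x $ 1) (x $ 2) (x $ 3 * s)))" if x: "x \<in> closed_slab" for x
  proof (cases "x $ 3 = 0")
    case False
    then have pos: "0 < x $ 3" "x $ 3 \<le> 1" using x by (auto simp: closed_slab_def)
    have "(\<lambda>t. t / x $ 3) ` {0..x $ 3} = {0..1}"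
    proof (intro equalityI subsetI)
      fix t :: real assume "t \<in> {0..1}"
      then have "t * x $ 3 \<in> {0..x $ 3}" using pos by (auto simp: mult_left_le_one_le)
      then show "t \<in> (\<lambda>t. t / x $ 3) ` {0..x $ 3}" using pos by (intro image_eqI[where x="t * x $ 3"]) auto
    qed (use pos in \<open>auto simp: divide_simps\<close>)
    then show ?thesis
      using integral_stretch_real[OF False, of 0 "x $ 3" "\<lambda>s. w (pt (x $ 1) (x $ 2) s)"] pos by simp
  qed simp
  have "continuous_on closed_slab (\<lambda>x. x $ 3 * integral (cbox 0 1) (\<lambda>s. w (pt (x $ 1) (x $ 2) (x $ 3 * s))))"
  proof (intro continuous_intros integral_continuous_on_param, unfold case_prod_beta)
    show "continuous_on (closed_slab \<times> cbox 0 1) (\<lambda>p. w (pt (fst p $ 1) (fst p $ 2) (fst p $ 3 * snd p)))"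
      by (intro continuous_on_slab_pt[OF w] continuous_intros) (auto simp: closed_slab_def mult_le_one)
  qed
  then show ?thesis using eq continuous_on_cong by (metis (no_types, lifting))
qed

section \<open>Axisymmetric flows and their stream function\<close>

text \<open>
  The components of a solution with their first and second partial derivatives, all continuous
  up to the walls. Axisymmetry enters only through three consequences: \<open>rot1\<close> and \<open>rot2\<close> are
  the derivative at angle \<open>0\<close> of the equivariance of \<open>u\<close> under rotations about the axis, and \<open>radial\<close> says
  that the speed is invariant under them.
\<close>

locale axisym_flow =
  fixes u :: "3 \<Rightarrow> real ^ 3 \<Rightarrow> real" and du :: "3 \<Rightarrow> 3 \<Rightarrow> real ^ 3 \<Rightarrow> real"
    and ddu :: "3 \<Rightarrow> 3 \<Rightarrow> 3 \<Rightarrow> real ^ 3 \<Rightarrow> real"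
    and p :: "real ^ 3 \<Rightarrow> real" and dp :: "3 \<Rightarrow> real ^ 3 \<Rightarrow> real"
  assumes u_grad: "\<And>j. has_grad (u j) (du j)"
    and du_grad: "\<And>j i. has_grad (du j i) (ddu j i)"
    and p_grad: "has_grad p dp"
    and momentum: "\<And>j x. x \<in> closed_slab \<Longrightarrow>
      - (\<Sum>i\<in>UNIV. ddu j i i x) + (\<Sum>i\<in>UNIV. u i x * du j i x) + dp j x = 0"
    and div_free: "\<And>x. x \<in> closed_slab \<Longrightarrow> (\<Sum>i\<in>UNIV. du i i x) = 0"
    and wall: "\<And>j x. x $ 3 = 0 \<or> x $ 3 = 1 \<Longrightarrow> u j x = 0"
    and rot1: "\<And>x. x \<in> closed_slab \<Longrightarrow> x $ 1 * du 1 2 x - x $ 2 * du 1 1 x = - u 2 x"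
    and rot2: "\<And>x. x \<in> closed_slab \<Longrightarrow> x $ 1 * du 2 2 x - x $ 2 * du 2 1 x = u 1 x"
    and radial: "\<And>x y. x \<in> closed_slab \<Longrightarrow> (x $ 1)\<^sup>2 + (x $ 2)\<^sup>2 = (y $ 1)\<^sup>2 + (y $ 2)\<^sup>2 \<Longrightarrow> x $ 3 = y $ 3 \<Longrightarrow>
      (\<Sum>j\<in>UNIV. (u j x)\<^sup>2) = (\<Sum>j\<in>UNIV. (u j y)\<^sup>2)"
begin

text \<open>
  In cylindrical coordinates \<open>w\<close> is \<open>r u\<^sup>r\<close>, and \<open>W\<close> is the Stokes stream function (up to sign and
  normalization). Both are smooth across the axis.
\<close>

definition w where "w x = x $ 1 * u 1 x + x $ 2 * u 2 x"
definition W where "W x = integral {0..x $ 3} (\<lambda>s. w (pt (x $ 1) (x $ 2) s))"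

lemma u_cont: "continuous_on closed_slab (u j)"
  and du_cont: "continuous_on closed_slab (du j i)"
  using has_gradD[OF u_grad] by auto

text \<open>
  For \<open>i = 1, 2\<close> the rotation identities turn \<open>\<partial>\<^sub>iw\<close> into \<open>x\<^sub>i (\<partial>\<^sub>1u\<^sub>1 + \<partial>\<^sub>2u\<^sub>2)\<close>, and this is
  \<open>- x\<^sub>i \<partial>\<^sub>3u\<^sub>3\<close> because \<open>u\<close> is divergence-free. The point of this form is that its
  primitive in \<open>x\<^sub>3\<close> is explicit.
\<close>

lemma w_grad: "has_grad w (\<lambda>i x. if i = 3 then x $ 1 * du 1 3 x + x $ 2 * du 2 3 x else - x $ i * du 3 3 x)"
proof -
  have "has_grad w (\<lambda>i x. ((if i = 1 then 1 else 0) * u 1 x + x $ 1 * du 1 i x) +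
     ((if i = 2 then 1 else 0) * u 2 x + x $ 2 * du 2 i x))"
    unfolding w_def[abs_def]
    by (intro has_grad_add has_grad_mult has_grad_coord u_grad)
  then show ?thesis
  proof (rule has_grad_cong)
    fix i x assume x: "x \<in> closed_slab"
    have d: "du 1 1 x + du 2 2 x + du 3 3 x = 0" using div_free[OF x] by (simp add: sum_3)
    have "u 1 x + x $ 1 * du 1 1 x + x $ 2 * du 2 1 x = x $ 1 * (du 1 1 x + du 2 2 x)"
         "u 2 x + x $ 1 * du 1 2 x + x $ 2 * du 2 2 x = x $ 2 * (du 1 1 x + du 2 2 x)"
      using rot1[OF x] rot2[OF x] by (simp_all add: algebra_simps)
    moreover have "du 1 1 x + du 2 2 x = - du 3 3 x" using d by simp
    ultimately show "((if i = 1 then 1 else 0) * u 1 x + x $ 1 * du 1 i x) +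
     ((if i = 2 then 1 else 0) * u 2 x + x $ 2 * du 2 i x) = 
      (if i = 3 then x $ 1 * du 1 3 x + x $ 2 * du 2 3 x else - x $ i * du 3 3 x)"
      using exhaust_3[of i] by (elim disjE) (simp_all add: algebra_simps)
  qed
qed

lemma w_cont: "continuous_on closed_slab w"
  using has_gradD[OF w_grad] by auto

lemma integral_du3:
  assumes "0 \<le> c" "c \<le> 1"
  shows "integral {0..c} (\<lambda>s. du j 3 (pt a b s)) = u j (pt a b c)"
proof -
  have "((\<lambda>s. du j 3 (pt a b s)) has_integral u j (pt a b c) - u j (pt a b 0)) {0..c}"
  proof (rule fundamental_theorem_of_calculus)
    fix s assume "s \<in> {0..c}"
    then have "((\<lambda>t. u j (pt a b t)) has_real_derivative du j 3 (pt a b s)) (at s within {0..1})"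
      using has_gradD(5)[OF u_grad[of j]] assms by auto
    then show "((\<lambda>t. u j (pt a b t)) has_vector_derivative du j 3 (pt a b s)) (at s within {0..c})"
      using assms by (auto simp: has_real_derivative_iff_has_vector_derivative intro: has_vector_derivative_within_subset)
  qed (use assms in auto)
  then show ?thesis using wall[of "pt a b 0" j] by (simp add: integral_unique)
qed

text \<open>
  Differentiate under the integral and integrate \<open>- x\<^sub>i \<partial>\<^sub>3u\<^sub>3\<close> from the lower wall. The gradient of \<open>W\<close>
  is an expression in \<open>u\<close> itself; no derivative of \<open>u\<close> is left.
\<close>

lemma W_grad: "has_grad W (\<lambda>i x. if i = 3 then w x else - x $ i * u 3 x)"
proof (intro has_gradI)
  show "continuous_on closed_slab W"
    unfolding W_def[abs_def] by (rule continuous_on_primitive[OF w_cont])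
  show "continuous_on closed_slab (\<lambda>x. if i = 3 then w x else - x $ i * u 3 x)" for i
    by (cases "i = 3") (auto intro!: continuous_intros w_cont u_cont)
next
  fix a b c :: real assume c: "0 \<le> c" "c \<le> 1"
  have "((\<lambda>t. integral (cbox 0 c) (\<lambda>s. w (pt t b s))) has_real_derivative
      integral (cbox 0 c) (\<lambda>s. - a * du 3 3 (pt a b s))) (at a within UNIV)"
  proof (rule leibniz_rule_field_derivative)
    show "((\<lambda>t. w (pt t b s)) has_real_derivative - t * du 3 3 (pt t b s)) (at t within UNIV)"
      if "s \<in> cbox 0 c" for t s
      using has_gradD(3)[OF w_grad, of s b t] that c by auto
    show "(\<lambda>s. w (pt t b s)) integrable_on cbox 0 c" for t
      by (intro integrable_continuous continuous_on_slab_pt[OF w_cont] continuous_intros) (use c in auto)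
    show "continuous_on (UNIV \<times> cbox 0 c) (\<lambda>(t, s). - t * du 3 3 (pt t b s))"
      unfolding case_prod_beta
      by (intro continuous_intros continuous_on_slab_pt[OF du_cont]) (use c in auto)
  qed auto
  then show "((\<lambda>t. W (pt t b c)) has_real_derivative
      (if (1::3) = 3 then w (pt a b c) else - pt a b c $ 1 * u 3 (pt a b c))) (at a)"
    using integral_du3[OF c, of 3 a b] by (simp add: W_def)
next
  fix a b c :: real assume c: "0 \<le> c" "c \<le> 1"
  have "((\<lambda>t. integral (cbox 0 c) (\<lambda>s. w (pt a t s))) has_real_derivative
      integral (cbox 0 c) (\<lambda>s. - b * du 3 3 (pt a b s))) (at b within UNIV)"
  proof (rule leibniz_rule_field_derivative)
    show "((\<lambda>t. w (pt a t s)) has_real_derivative - t * du 3 3 (pt a t s)) (at t within UNIV)"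
      if "s \<in> cbox 0 c" for t s
      using has_gradD(4)[OF w_grad, of s a t] that c by auto
    show "(\<lambda>s. w (pt a t s)) integrable_on cbox 0 c" for t
      by (intro integrable_continuous continuous_on_slab_pt[OF w_cont] continuous_intros) (use c in auto)
    show "continuous_on (UNIV \<times> cbox 0 c) (\<lambda>(t, s). - t * du 3 3 (pt a t s))"
      unfolding case_prod_beta
      by (intro continuous_intros continuous_on_slab_pt[OF du_cont]) (use c in auto)
  qed auto
  then show "((\<lambda>t. W (pt a t c)) has_real_derivative
      (if (2::3) = 3 then w (pt a b c) else - pt a b c $ 2 * u 3 (pt a b c))) (at b)"
    using integral_du3[OF c, of 3 a b] by (simp add: W_def)
next
  fix a b c :: real assume c: "0 \<le> c" "c \<le> 1"
  have "continuous_on {0..1} (\<lambda>s. w (pt a b s))"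
    by (intro continuous_on_slab_pt[OF w_cont] continuous_intros) auto
  from integral_has_real_derivative[OF this, of c]
  show "((\<lambda>t. W (pt a b t)) has_real_derivative
      (if (3::3) = 3 then w (pt a b c) else - pt a b c $ 3 * u 3 (pt a b c))) (at c within {0..1})"
    using c by (simp add: W_def)
qed

lemma W_bottom: "x $ 3 = 0 \<Longrightarrow> W x = 0"
  by (simp add: W_def)

text \<open>
  There is no net flux through a coaxial cylinder. On the upper wall \<open>u\<^sub>3 = 0\<close>, so \<open>W\<close> has vanishing
  horizontal derivatives there and is constant; on the axis \<open>w = 0\<close>, so the constant is \<open>0\<close>.
\<close>

lemma W_top:
  fixes x :: "real ^ 3"
  assumes "x $ 3 = 1"
  shows "W x = 0"
proof -
  have z: "u 3 (pt a b 1) = 0" for a b using wall by simp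
  have 1: "((\<lambda>t. W (pt t b 1)) has_real_derivative 0) (at a)" for a b
    using has_gradD(3)[OF W_grad, of 1 b a] z by simp
  have 2: "((\<lambda>t. W (pt a t 1)) has_real_derivative 0) (at b)" for a b
    using has_gradD(4)[OF W_grad, of 1 a b] z by simp
  have "W (pt a b 1) = W (pt 0 b 1)" for a b using DERIV_isconst_all[OF allI[OF 1]] by blast
  moreover have "W (pt 0 b 1) = W (pt 0 0 1)" for b using DERIV_isconst_all[OF allI[OF 2]] by blast
  moreover have "W (pt 0 0 1) = 0" by (simp add: W_def w_def)
  ultimately show ?thesis using assms pt_eta[of x] by metis
qed

definition energy_density where "energy_density x = (\<Sum>j\<in>UNIV. \<Sum>i\<in>UNIV. (du j i x)\<^sup>2)"
definition speed_sq where "speed_sq x = (\<Sum>j\<in>UNIV. (u j x)\<^sup>2)"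

text \<open>
  The condition on \<open>d\<Phi> 3\<close> says exactly that \<open>v = \<phi> u - \<Phi> e\<^sub>3\<close> is divergence-free, so the pressure
  enters only through the divergence of \<open>p v\<close>. The field \<open>G\<close> below collects everything that is
  integrated by parts: \<open>G\<^sub>i = - \<partial>\<^sub>iu \<cdot> v + p v\<^sub>i + |u|\<^sup>2 \<phi> u\<^sub>i / 2\<close>. It vanishes on the boundary, and the momentum
  equation tested with \<open>v\<close> identifies its divergence with the difference of the two integrands.
\<close>

lemma energy_identity:
  assumes phi: "has_grad \<phi> d\<phi>" and Phi: "has_grad \<Phi> d\<Phi>"
    and M: "M \<ge> 0"
    and side: "\<And>x. x \<in> closed_slab \<Longrightarrow> \<bar>x $ 1\<bar> \<ge> M \<or> \<bar>x $ 2\<bar> \<ge> M \<Longrightarrow> \<phi> x = 0 \<and> \<Phi> x = 0"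
    and wall': "\<And>x. x $ 3 = 0 \<or> x $ 3 = 1 \<Longrightarrow> \<Phi> x = 0"
    and compat: "\<And>x. x \<in> closed_slab \<Longrightarrow> d\<Phi> 3 x = (\<Sum>i\<in>UNIV. u i x * d\<phi> i x)"
  shows "integral (cyl_box M) (\<lambda>x. \<phi> x * energy_density x) =
    integral (cyl_box M) (\<lambda>x. - (\<Sum>j\<in>UNIV. \<Sum>i\<in>UNIV. d\<phi> i x * du j i x * u j x)
       + (\<Sum>i\<in>UNIV. du 3 i x * d\<Phi> i x) + (\<Sum>i\<in>UNIV. u i x * du 3 i x) * \<Phi> x
       + speed_sq x / 2 * (\<Sum>i\<in>UNIV. u i x * d\<phi> i x))"
    (is "integral _ ?L = integral _ ?R")
proof -
  define v where "v j x = \<phi> x * u j x + (if j = 3 then - 1 else 0) * \<Phi> x" for j x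
  define dv where "dv j i x = (d\<phi> i x * u j x + \<phi> x * du j i x) + (if j = 3 then - 1 else 0) * d\<Phi> i x" for j i x
  define G where "G i x = (\<Sum>j\<in>UNIV. - 1 * (du j i x * v j x)) + (p x * v i x + 1 / 2 * (\<Sum>j\<in>UNIV. u j x * u j x) * (\<phi> x * u i x))" for i x
  define dG where "dG i k x = (\<Sum>j\<in>UNIV. - 1 * (ddu j i k x * v j x + du j i x * dv j k x)) +
     ((dp k x * v i x + p x * dv i k x) + 
      ((1 / 2 * (\<Sum>j\<in>UNIV. du j k x * u j x + u j x * du j k x)) * (\<phi> x * u i x) +
       1 / 2 * (\<Sum>j\<in>UNIV. u j x * u j x) * (d\<phi> k x * u i x + \<phi> x * du i k x)))" for i k x
  have v: "has_grad (v j) (dv j)" for j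
    unfolding v_def dv_def by (intro has_grad_add has_grad_mult has_grad_cmult phi Phi u_grad)
  have G: "has_grad (G i) (dG i)" for i
    unfolding G_def dG_def
    by (intro has_grad_add has_grad_mult has_grad_cmult has_grad_sum phi v p_grad u_grad du_grad)
  have vside: "v j x = 0" if "x \<in> closed_slab" "\<bar>x $ 1\<bar> \<ge> M \<or> \<bar>x $ 2\<bar> \<ge> M" for j x
    using side[OF that] by (simp add: v_def)
  have G0: "integral (cyl_box M) (dG i i) = 0" for i
  proof (rule integral_partial_eq_0[OF G M])
    fix x assume "x \<in> closed_slab" "M \<le> \<bar>x $ 1\<bar> \<or> M \<le> \<bar>x $ 2\<bar>"
    then show "G i x = 0" using side vside by (simp add: G_def)
  next
    fix x :: "real ^ 3" assume "x $ 3 = 0 \<or> x $ 3 = 1"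
    then show "G i x = 0" by (simp add: G_def v_def wall wall')
  qed
  have key: "(\<Sum>i\<in>UNIV. dG i i x) = ?R x - ?L x" if x: "x \<in> closed_slab" for x
  proof -
    have m: "dp 1 x = ddu 1 1 1 x + ddu 1 2 2 x + ddu 1 3 3 x - (u 1 x * du 1 1 x + u 2 x * du 1 2 x + u 3 x * du 1 3 x)"
       "dp 2 x = ddu 2 1 1 x + ddu 2 2 2 x + ddu 2 3 3 x - (u 1 x * du 2 1 x + u 2 x * du 2 2 x + u 3 x * du 2 3 x)"
       "dp 3 x = ddu 3 1 1 x + ddu 3 2 2 x + ddu 3 3 3 x - (u 1 x * du 3 1 x + u 2 x * du 3 2 x + u 3 x * du 3 3 x)"
      using momentum[OF x, of 1] momentum[OF x, of 2] momentum[OF x, of 3] by (simp_all add: sum_3)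
    have d: "du 3 3 x = - du 1 1 x - du 2 2 x" using div_free[OF x] by (simp add: sum_3)
    have e: "d\<Phi> 3 x = u 1 x * d\<phi> 1 x + u 2 x * d\<phi> 2 x + u 3 x * d\<phi> 3 x"
      using compat[OF x] by (simp add: sum_3)
    show ?thesis
      unfolding dG_def dv_def v_def sum_3 energy_density_def speed_sq_def
      by (simp add: m e) (simp add: d, simp add: field_simps power2_eq_square)
  qed
  have dGc: "continuous_on closed_slab (dG i i)" for i using has_gradD(2)[OF G] .
  have Lc: "continuous_on closed_slab ?L"
    unfolding energy_density_def by (intro continuous_intros du_cont has_gradD[OF phi])
  have Rc: "continuous_on closed_slab ?R"
    unfolding speed_sq_def by (intro continuous_intros du_cont u_cont has_gradD[OF phi] has_gradD[OF Phi]) auto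
  have "0 = integral (cyl_box M) (\<lambda>x. \<Sum>i\<in>UNIV. dG i i x)"
    using G0 integrable_cyl_box[OF dGc] by (subst integral_sum) auto
  also have "\<dots> = integral (cyl_box M) (\<lambda>x. ?R x - ?L x)"
    using key cyl_box_sub by (intro Henstock_Kurzweil_Integration.integral_cong) blast
  also have "\<dots> = integral (cyl_box M) ?R - integral (cyl_box M) ?L"
    by (rule integral_diff[OF integrable_cyl_box[OF Rc] integrable_cyl_box[OF Lc]])
  finally show ?thesis by simp
qed

end

section \<open>Cutoff functions\<close>

lemma has_real_derivative_pos_part_power:
  "((\<lambda>t::real. max 0 t ^ Suc (Suc n)) has_real_derivative real (Suc (Suc n)) * max 0 t ^ Suc n) (at t)"
proof (cases t "0::real" rule: linorder_cases)
  case less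
  have "((\<lambda>t::real. 0) has_real_derivative 0) (at t)" by simp
  then have "((\<lambda>t::real. max 0 t ^ Suc (Suc n)) has_real_derivative 0) (at t)"
    by (rule has_field_derivative_transform_within_open[where S="{..<0}"]) (use less in auto)
  then show ?thesis using less by simp
next
  case greater
  have "((\<lambda>t::real. t ^ Suc (Suc n)) has_real_derivative real (Suc (Suc n)) * t ^ Suc n) (at t)"
    using DERIV_pow[of "Suc (Suc n)" t UNIV] by simp
  then have "((\<lambda>t::real. max 0 t ^ Suc (Suc n)) has_real_derivative real (Suc (Suc n)) * t ^ Suc n) (at t)"
    by (rule has_field_derivative_transform_within_open[where S="{0<..}"]) (use greater in auto)
  then show ?thesis using greater by (simp add: max_def)
next
  case equal
  have "((\<lambda>h::real. max 0 h ^ Suc (Suc n) / h) \<longlongrightarrow> 0) (at 0)"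
  proof (rule Lim_null_comparison)
    show "\<forall>\<^sub>F h::real in at 0. norm (max 0 h ^ Suc (Suc n) / h) \<le> max 0 h ^ Suc n"
      by (rule always_eventually) (auto simp: max_def)
    have "((\<lambda>h::real. max 0 h ^ Suc n) \<longlongrightarrow> max 0 0 ^ Suc n) (at 0)"
      by (intro tendsto_intros)
    then show "((\<lambda>h::real. max 0 h ^ Suc n) \<longlongrightarrow> 0) (at 0)" by simp
  qed
  then show ?thesis
    using equal by (simp add: DERIV_def)
qed

text \<open>
  A transition from \<open>0\<close> on the negative half-line to \<open>1\<close> beyond \<open>1\<close>. Fourth powers make it twice
  continuously differentiable, and near \<open>0\<close> it behaves like \<open>4 t\<^sup>4\<close>, so that the squares of both derivatives are
  bounded by a multiple of the function itself. The latter is needed to absorb gradient terms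
  into \<open>\<phi> |\<nabla>u|\<^sup>2\<close>.
\<close>

definition step :: "real \<Rightarrow> real" where
  "step t = 1 - max 0 (1 - max 0 t ^ 4) ^ 4"

definition step' :: "real \<Rightarrow> real" where
  "step' t = 16 * max 0 (1 - max 0 t ^ 4) ^ 3 * max 0 t ^ 3"

definition step'' :: "real \<Rightarrow> real" where
  "step'' t = 48 * max 0 (1 - max 0 t ^ 4) ^ 3 * max 0 t ^ 2 - 192 * max 0 (1 - max 0 t ^ 4) ^ 2 * max 0 t ^ 6"

lemma pos_part_power_derivs:
  "((\<lambda>t::real. max 0 t ^ 4) has_real_derivative 4 * max 0 t ^ 3) (at t)"
  "((\<lambda>t::real. max 0 t ^ 3) has_real_derivative 3 * max 0 t ^ 2) (at t)"
  using has_real_derivative_pos_part_power[of 2 t] has_real_derivative_pos_part_power[of 1 t]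
  by (simp_all add: eval_nat_numeral)

lemma step_deriv: "(step has_real_derivative step' t) (at t)"
proof -
  have "((\<lambda>t. max 0 (1 - max 0 t ^ 4) ^ 4) has_real_derivative
     4 * max 0 (1 - max 0 t ^ 4) ^ 3 * (- (4 * max 0 t ^ 3))) (at t)"
    by (rule DERIV_chain2[OF pos_part_power_derivs(1)])
      (rule DERIV_cong[OF DERIV_diff[OF DERIV_const pos_part_power_derivs(1)]], simp)
  from DERIV_diff[OF DERIV_const this]
  show ?thesis
    unfolding step_def[abs_def] step'_def by (rule DERIV_cong) simp
qed

lemma step'_deriv: "(step' has_real_derivative step'' t) (at t)"
proof -
  have "((\<lambda>t. max 0 (1 - max 0 t ^ 4) ^ 3) has_real_derivative
     3 * max 0 (1 - max 0 t ^ 4) ^ 2 * (- (4 * max 0 t ^ 3))) (at t)"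
    by (rule DERIV_chain2[OF pos_part_power_derivs(2)])
      (rule DERIV_cong[OF DERIV_diff[OF DERIV_const pos_part_power_derivs(1)]], simp)
  from DERIV_mult[OF DERIV_cmult[OF this, of 16] pos_part_power_derivs(2)]
  show ?thesis
    unfolding step'_def[abs_def] step''_def
    by (rule DERIV_cong) (simp add: algebra_simps power_add[symmetric])
qed

lemma step'_cont: "continuous_on UNIV step'" and step''_cont: "continuous_on UNIV step''"
  unfolding step'_def[abs_def] step''_def[abs_def] by (intro continuous_intros)+

lemma step_le_0: "t \<le> 0 \<Longrightarrow> step t = 0 \<and> step' t = 0 \<and> step'' t = 0"
  by (simp add: step_def step'_def step''_def max_def)

lemma step_ge_1: assumes "t \<ge> 1" shows "step t = 1 \<and> step' t = 0 \<and> step'' t = 0"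
proof -
  have "1 \<le> t ^ 4" using assms by (rule one_le_power)
  then have "1 - max 0 t ^ 4 \<le> 0" using assms by (simp add: max_absorb2)
  then have "max 0 (1 - max 0 t ^ 4) = 0" by (rule max_absorb1)
  then show ?thesis by (simp add: step_def step'_def step''_def)
qed

text \<open>
  On \<open>[0, 1]\<close> both \<open>(step' t)\<^sup>2\<close> and \<open>(step'' t)\<^sup>2\<close> are at most constant multiples of \<open>t\<^sup>4\<close>, and
  \<open>t\<^sup>4 \<le> step t\<close>.
\<close>

lemma step_bounds:
  "0 \<le> step t" "step t \<le> 1" "(step' t)\<^sup>2 \<le> 256 * step t" "(step'' t)\<^sup>2 \<le> 57600 * step t"
proof -
  have "0 \<le> step t \<and> step t \<le> 1 \<and> (step' t)\<^sup>2 \<le> 256 * step t \<and> (step'' t)\<^sup>2 \<le> 57600 * step t"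
  proof (cases "t \<le> 0 \<or> 1 \<le> t")
    case True
    then show ?thesis using step_le_0[of t] step_ge_1[of t] by auto
  next
    case False
    define y where "y = 1 - t ^ 4"
    have t: "0 \<le> t" "t \<le> 1" using False by auto
    have t4: "0 \<le> t ^ 4" "t ^ 4 \<le> 1" using t by (auto intro: power_le_one)
    then have y: "0 \<le> y" "y \<le> 1" by (auto simp: y_def)
    have mx: "max 0 t = t" "max 0 (1 - t ^ 4) = y" using t y by (auto simp: y_def)
    have "y ^ 4 \<le> y" using power_decreasing[of 1 4 y] y by simp
    then have q: "t ^ 4 \<le> step t" unfolding step_def mx by (simp add: y_def)
    have s1: "step' t = 16 * y ^ 3 * t ^ 3" by (simp add: step'_def mx)
    have s2: "step'' t = 48 * y ^ 3 * t ^ 2 - 192 * y ^ 2 * t ^ 6" by (simp add: step''_def mx)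
    have "\<bar>step' t\<bar> \<le> 16 * t ^ 2"
    proof -
      have "y ^ 3 * t ^ 3 \<le> 1 * t ^ 2"
        by (intro mult_mono power_decreasing power_le_one) (use t y in auto)
      then show ?thesis using t y by (simp add: s1 abs_mult)
    qed
    then have "\<bar>step' t\<bar>\<^sup>2 \<le> (16 * t\<^sup>2)\<^sup>2" by (intro power_mono) auto
    then have 1: "(step' t)\<^sup>2 \<le> 256 * t ^ 4" by (simp add: power_mult_distrib flip: power_mult)
    have "\<bar>step'' t\<bar> \<le> 240 * t ^ 2"
    proof -
      have "y ^ 3 * t ^ 2 \<le> 1 * t ^ 2" "y ^ 2 * t ^ 6 \<le> 1 * t ^ 2"
        by (intro mult_mono power_decreasing power_le_one; use t y in auto)+
      moreover have "0 \<le> y ^ 3 * t ^ 2" "0 \<le> y ^ 2 * t ^ 6" using y by auto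
      ultimately show ?thesis unfolding s2 by linarith
    qed
    then have "\<bar>step'' t\<bar>\<^sup>2 \<le> (240 * t\<^sup>2)\<^sup>2" by (intro power_mono) auto
    then have 2: "(step'' t)\<^sup>2 \<le> 57600 * t ^ 4" by (simp add: power_mult_distrib flip: power_mult)
    have "0 \<le> step t" "step t \<le> 1" using q t4 y by (auto simp: step_def mx power_le_one)
    then show ?thesis using 1 2 q by auto
  qed
  then show "0 \<le> step t" "step t \<le> 1" "(step' t)\<^sup>2 \<le> 256 * step t" "(step'' t)\<^sup>2 \<le> 57600 * step t" by auto
qed

definition radius_sq :: "real ^ 3 \<Rightarrow> real" where "radius_sq x = (x $ 1)\<^sup>2 + (x $ 2)\<^sup>2"

lemma radius_sq_ge_of_coord:
  assumes "0 \<le> \<rho>" and x: "\<rho> \<le> \<bar>x $ 1\<bar> \<or> \<rho> \<le> \<bar>x $ 2\<bar>"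
  shows "\<rho>\<^sup>2 \<le> radius_sq x"
proof -
  have "\<rho>\<^sup>2 \<le> t\<^sup>2" if "\<rho> \<le> \<bar>t\<bar>" for t
    using power_mono[of "\<rho>" "\<bar>t\<bar>" 2] that assms by simp
  then have "\<rho>\<^sup>2 \<le> (x $ 1)\<^sup>2 \<or> \<rho>\<^sup>2 \<le> (x $ 2)\<^sup>2"
    using x by blast
  then show ?thesis by (auto simp: radius_sq_def intro: add_increasing add_increasing2)
qed

text \<open>
  The cutoff between the radii \<open>R\<close> and \<open>R + d\<close> is a function of the squared radius, which is smooth on
  the axis; note \<open>(R + d)\<^sup>2 - R\<^sup>2 = d (2 R + d)\<close>. The functions \<open>cutoff_slope\<close> and \<open>cutoff_curv\<close> are
  chosen such that \<open>\<partial>\<^sub>i cutoff = cutoff_slope x\<^sub>i\<close> and \<open>\<partial>\<^sub>i cutoff_slope = cutoff_curv x\<^sub>i\<close>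
  for \<open>i = 1, 2\<close>.
\<close>

definition cutoff_arg where "cutoff_arg R d x = ((R + d)\<^sup>2 - radius_sq x) / (d * (2 * R + d))"
definition cutoff where "cutoff R d x = step (cutoff_arg R d x)"
definition cutoff_slope where "cutoff_slope R d x = - 2 * step' (cutoff_arg R d x) / (d * (2 * R + d))"
definition cutoff_curv where "cutoff_curv R d x = 4 * step'' (cutoff_arg R d x) / (d * (2 * R + d))\<^sup>2"

lemma radius_sq_nonneg [simp]: "0 \<le> radius_sq x" by (simp add: radius_sq_def)
lemma radius_sq_pt [simp]: "radius_sq (pt a b c) = a\<^sup>2 + b\<^sup>2" by (simp add: radius_sq_def)

lemma cutoff_arg_grad:
  "has_grad (cutoff_arg R d) (\<lambda>i x. if i = 3 then 0 else - 2 * x $ i / (d * (2 * R + d)))"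
proof -
  let ?k = "1 / (d * (2 * R + d))"
  have "has_grad (\<lambda>x. ?k * ((R + d)\<^sup>2 + (- 1) * (x $ 1 * x $ 1 + x $ 2 * x $ 2)))
     (\<lambda>i x. ?k * (0 + (- 1) * (((if i = 1 then 1 else 0) * x $ 1 + x $ 1 * (if i = 1 then 1 else 0)) +
        ((if i = 2 then 1 else 0) * x $ 2 + x $ 2 * (if i = 2 then 1 else 0)))))"
    by (intro has_grad_cmult has_grad_add has_grad_mult has_grad_coord has_grad_const)
  moreover have "(\<lambda>x. ?k * ((R + d)\<^sup>2 + (- 1) * (x $ 1 * x $ 1 + x $ 2 * x $ 2))) = cutoff_arg R d"
    by (auto simp: cutoff_arg_def radius_sq_def power2_eq_square)
  ultimately have "has_grad (cutoff_arg R d)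
     (\<lambda>i x. ?k * (0 + (- 1) * (((if i = 1 then 1 else 0) * x $ 1 + x $ 1 * (if i = 1 then 1 else 0)) +
        ((if i = 2 then 1 else 0) * x $ 2 + x $ 2 * (if i = 2 then 1 else 0)))))"
    by simp
  then show ?thesis
  proof (rule has_grad_cong)
    show "?k * (0 + (- 1) * (((if i = 1 then 1 else 0) * x $ 1 + x $ 1 * (if i = 1 then 1 else 0)) +
        ((if i = 2 then 1 else 0) * x $ 2 + x $ 2 * (if i = 2 then 1 else 0)))) =
      (if i = 3 then 0 else - 2 * x $ i / (d * (2 * R + d)))" for i :: 3 and x
      using exhaust_3[of i] by (elim disjE) auto
  qed
qed

lemma cutoff_grad: "has_grad (cutoff R d) (\<lambda>i x. if i = 3 then 0 else cutoff_slope R d x * x $ i)"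
  unfolding cutoff_def[abs_def]
  by (rule has_grad_cong[OF has_grad_chain[OF cutoff_arg_grad step_deriv step'_cont]])
     (simp add: cutoff_slope_def)

lemma cutoff_cont: "continuous_on closed_slab (cutoff R d)"
  by (rule has_gradD(1)[OF cutoff_grad])

lemma cutoff_slope_grad: "has_grad (cutoff_slope R d) (\<lambda>i x. if i = 3 then 0 else cutoff_curv R d x * x $ i)"
proof -
  have "has_grad (\<lambda>x. (- 2 / (d * (2 * R + d))) * step' (cutoff_arg R d x))
    (\<lambda>i x. if i = 3 then 0 else cutoff_curv R d x * x $ i)"
    by (rule has_grad_cong[OF has_grad_cmult[OF has_grad_chain[OF cutoff_arg_grad step'_deriv step''_cont]]])
       (simp add: cutoff_curv_def power2_eq_square)
  then show ?thesis by (simp add: cutoff_slope_def[abs_def])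
qed

context
  fixes R d :: real
  assumes R: "0 \<le> R" and d: "0 < d"
begin

lemma cutoff_width_pos: "0 < d * (2 * R + d)"
  using R d by simp

lemma cutoff_outside:
  assumes "(R + d)\<^sup>2 \<le> radius_sq x"
  shows "cutoff R d x = 0" "cutoff_slope R d x = 0" "cutoff_curv R d x = 0"
proof -
  have "cutoff_arg R d x \<le> 0"
    unfolding cutoff_arg_def using assms cutoff_width_pos by (simp add: divide_nonpos_pos)
  then show "cutoff R d x = 0" "cutoff_slope R d x = 0" "cutoff_curv R d x = 0"
    using step_le_0 by (auto simp: cutoff_def cutoff_slope_def cutoff_curv_def)
qed

lemma cutoff_inside:
  assumes "radius_sq x \<le> R\<^sup>2"
  shows "cutoff R d x = 1" "cutoff_slope R d x = 0" "cutoff_curv R d x = 0"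
proof -
  have "d * (2 * R + d) \<le> (R + d)\<^sup>2 - radius_sq x"
    using assms by (simp add: power2_eq_square algebra_simps)
  then have "1 \<le> cutoff_arg R d x"
    unfolding cutoff_arg_def using cutoff_width_pos by simp
  then show "cutoff R d x = 1" "cutoff_slope R d x = 0" "cutoff_curv R d x = 0"
    using step_ge_1 by (auto simp: cutoff_def cutoff_slope_def cutoff_curv_def)
qed

lemma cutoff_bounds: "0 \<le> cutoff R d x" "cutoff R d x \<le> 1"
  using step_bounds by (auto simp: cutoff_def)

text \<open>
  The left-hand side is \<open>|\<nabla>\<phi>|\<^sup>2\<close>. On the support of the cutoff \<open>r \<le> 2 R + d\<close>, which cancels the
  factor \<open>2 R + d\<close> in the width \<open>d (2 R + d)\<close> and leaves the natural scaling \<open>|\<nabla>\<phi>|\<^sup>2 \<le> C \<phi> / d\<^sup>2\<close>; the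
  next bound is its second-order analogue.
\<close>

lemma cutoff_slope_bound: "(cutoff_slope R d x)\<^sup>2 * radius_sq x \<le> 1024 * cutoff R d x / d\<^sup>2"
proof (cases "(R + d)\<^sup>2 \<le> radius_sq x")
  case True
  then show ?thesis by (simp add: cutoff_outside)
next
  case False
  obtain N where N: "2 * R + d = N" "0 < N" using R d by simp
  have "(R + d)\<^sup>2 \<le> N\<^sup>2" using R d N by (intro power_mono) auto
  then have s: "radius_sq x \<le> N\<^sup>2" using False by simp
  have "(cutoff_slope R d x)\<^sup>2 * radius_sq x = 4 * (step' (cutoff_arg R d x))\<^sup>2 * radius_sq x / (d * N)\<^sup>2"
    by (simp add: cutoff_slope_def N power_divide power_mult_distrib)
  also have "\<dots> \<le> 4 * (256 * cutoff R d x) * N\<^sup>2 / (d * N)\<^sup>2"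
    by (intro divide_right_mono mult_mono mult_left_mono s)
       (use step_bounds(1,3) in \<open>auto simp: cutoff_def\<close>)
  also have "\<dots> = 1024 * cutoff R d x / d\<^sup>2"
    using N(2) d by (simp add: power_mult_distrib flip: power_mult)
  finally show ?thesis .
qed

lemma cutoff_curv_bound: "(cutoff_curv R d x)\<^sup>2 * (radius_sq x)\<^sup>2 \<le> 921600 * cutoff R d x / d ^ 4"
proof (cases "(R + d)\<^sup>2 \<le> radius_sq x")
  case True
  then show ?thesis by (simp add: cutoff_outside)
next
  case False
  obtain N where N: "2 * R + d = N" "0 < N" using R d by simp
  have "(R + d)\<^sup>2 \<le> N\<^sup>2" using R d N by (intro power_mono) auto
  then have s: "radius_sq x \<le> N\<^sup>2" using False by simp
  have "(cutoff_curv R d x)\<^sup>2 * (radius_sq x)\<^sup>2 =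
      16 * (step'' (cutoff_arg R d x))\<^sup>2 * (radius_sq x)\<^sup>2 / ((d * N)\<^sup>2)\<^sup>2"
    by (simp add: cutoff_curv_def N power_divide power_mult_distrib)
  also have "\<dots> \<le> 16 * (57600 * cutoff R d x) * (N\<^sup>2)\<^sup>2 / ((d * N)\<^sup>2)\<^sup>2"
    by (intro divide_right_mono mult_mono mult_left_mono power_mono s)
       (use step_bounds(1,4) in \<open>auto simp: cutoff_def\<close>)
  also have "\<dots> = 921600 * cutoff R d x / d ^ 4"
    using N(2) d by (simp add: power_mult_distrib flip: power_mult)
  finally show ?thesis .
qed

end

lemma cutoff_indep_height: "radius_sq x = radius_sq y \<Longrightarrow> cutoff R d x = cutoff R d y \<and> cutoff_slope R d x = cutoff_slope R d y"
  by (simp add: cutoff_def cutoff_slope_def cutoff_arg_def)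

text \<open>
  A continuous substitute for the indicator function of the annulus \<open>R \<le> r \<le> R + 1\<close>. Being a difference of
  two cutoffs, it makes the energy near the annulus a difference of two energies.
\<close>

definition window where "window R x = cutoff (R + 1) 1 x - cutoff (R - 1) 1 x"

lemma window_cont: "continuous_on closed_slab (window R)"
  unfolding window_def[abs_def] by (intro continuous_intros has_gradD(1)[OF cutoff_grad])

lemma window_bounds:
  assumes R: "1 \<le> R"
  shows "0 \<le> window R x" "window R x \<le> 1" "R\<^sup>2 \<le> radius_sq x \<Longrightarrow> radius_sq x \<le> (R + 1)\<^sup>2 \<Longrightarrow> window R x = 1"
proof -
  have b: "0 \<le> cutoff (R + 1) 1 x" "cutoff (R + 1) 1 x \<le> 1" "0 \<le> cutoff (R - 1) 1 x" "cutoff (R - 1) 1 x \<le> 1"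
    using R by (auto intro!: cutoff_bounds)
  have in1: "radius_sq x \<le> (R + 1)\<^sup>2 \<Longrightarrow> cutoff (R + 1) 1 x = 1"
    using R by (intro cutoff_inside) auto
  have out: "R\<^sup>2 \<le> radius_sq x \<Longrightarrow> cutoff (R - 1) 1 x = 0"
    using R by (intro cutoff_outside) auto
  have "R\<^sup>2 \<le> (R + 1)\<^sup>2" using R by (intro power_mono) auto
  then show "0 \<le> window R x"
    using b in1 out by (cases "R\<^sup>2 \<le> radius_sq x") (auto simp: window_def)
  show "window R x \<le> 1" using b by (simp add: window_def)
  show "R\<^sup>2 \<le> radius_sq x \<Longrightarrow> radius_sq x \<le> (R + 1)\<^sup>2 \<Longrightarrow> window R x = 1"
    using in1 out by (simp add: window_def)
qed

lemma window_indep: "radius_sq x = radius_sq y \<Longrightarrow> window R x = window R y"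
  using cutoff_indep_height by (metis window_def)

text \<open>
  The cutoff lies between the indicator functions of two concentric discs, whose areas are known.
\<close>

lemma disk_area_bounds:
  assumes R: "0 \<le> R" and M: "R + 1 \<le> M"
  shows "pi * R\<^sup>2 \<le> integral (cyl_box M) (cutoff R 1)" "integral (cyl_box M) (cutoff R 1) \<le> pi * (R + 1)\<^sup>2"
proof -
  let ?g = "\<lambda>p::real\<times>real. cutoff R 1 (pt (fst p) (snd p) 0)"
  let ?C = "cbox (-M,-M) (M,M)"
  have gc: "continuous_on ?C ?g"
    by (intro continuous_on_slab_pt[OF cutoff_cont] continuous_intros) auto
  then have gint: "?g integrable_on ?C" by (rule integrable_continuous)
  have "cutoff R 1 (pt a b c) = cutoff R 1 (pt a b 0)" for a b c
    using cutoff_indep_height[of "pt a b c" "pt a b 0"] by simp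
  then have "integral {0..1} (\<lambda>c. cutoff R 1 (pt a b c)) = integral {0..1::real} (\<lambda>c. cutoff R 1 (pt a b 0))" for a b
    by (intro Henstock_Kurzweil_Integration.integral_cong)
  then have "integral (cyl_box M) (cutoff R 1) = integral (cbox (-M) M) (\<lambda>a. integral (cbox (-M) M) (\<lambda>b. ?g (a, b)))"
    by (subst integral_cyl_box[OF cutoff_cont]) simp
  also have "\<dots> = integral ?C ?g"
    by (rule integral_prod_continuous[symmetric, OF gc])
  finally have eq: "integral (cyl_box M) (cutoff R 1) = integral ?C ?g" .
  have nrm: "norm p \<le> r \<longleftrightarrow> radius_sq (pt (fst p) (snd p) 0) \<le> r\<^sup>2" if "0 \<le> r" for r and p :: "real \<times> real"
    using that by (cases p) (simp add: norm_Pair real_sqrt_le_iff' sqrt_le_D real_le_lsqrt)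
  have ball: "indicat_real (cball (0::real\<times>real) r) integrable_on ?C \<and>
      integral ?C (indicat_real (cball (0::real\<times>real) r)) = pi * r\<^sup>2" if r: "0 \<le> r" "r \<le> M" for r
  proof -
    have "cball (0::real\<times>real) r \<subseteq> ?C"
    proof
      fix p :: "real \<times> real" assume "p \<in> cball 0 r"
      then have "norm p \<le> r" by simp
      then have "norm (fst p) \<le> M" "norm (snd p) \<le> M"
        using norm_fst_le[of "fst p" "snd p"] norm_snd_le[of "snd p" "fst p"] r by auto
      then show "p \<in> ?C" by (cases p) (auto simp: cbox_Pair_eq abs_le_iff)
    qed
    then have "cball (0::real\<times>real) r \<inter> ?C = cball 0 r" by blast
    moreover have "measure lebesgue (cball (0::real\<times>real) r) = pi * r\<^sup>2"
      using content_cball[of r "0::real\<times>real"] r unit_ball_vol_2 by (simp add: power2_eq_square)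
    ultimately show ?thesis
      by (simp add: integrable_on_indicator Equivalence_Lebesgue_Henstock_Integration.integral_indicator)
  qed
  have "integral ?C (indicat_real (cball (0::real\<times>real) R)) \<le> integral ?C ?g"
  proof (intro integral_le gint)
    show "indicat_real (cball 0 R) p \<le> ?g p" for p :: "real \<times> real"
      using cutoff_inside(1)[of R 1 "pt (fst p) (snd p) 0"] cutoff_bounds(1)[of R 1] R nrm[of R p]
      by (auto simp: indicator_def)
  qed (use ball[of R] R M in auto)
  then show "pi * R\<^sup>2 \<le> integral (cyl_box M) (cutoff R 1)" using ball[of R] R M by (simp add: eq)
  have "integral ?C ?g \<le> integral ?C (indicat_real (cball (0::real\<times>real) (R + 1)))"
  proof (intro integral_le gint)
    show "?g p \<le> indicat_real (cball 0 (R + 1)) p" for p :: "real \<times> real"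
      using cutoff_outside(1)[of R 1 "pt (fst p) (snd p) 0"] cutoff_bounds(2)[of R 1] R nrm[of "R + 1" p]
      by (auto simp: indicator_def)
  qed (use ball[of "R + 1"] R M in auto)
  then show "integral (cyl_box M) (cutoff R 1) \<le> pi * (R + 1)\<^sup>2" using ball[of "R + 1"] R M by (simp add: eq)
qed

text \<open>The area near a circle of radius \<open>R\<close> grows linearly in \<open>R\<close>; the quadratic terms cancel.\<close>

lemma window_area:
  assumes R: "1 \<le> R"
  shows "integral (cyl_box (R + 2)) (window R) \<le> 36 * R"
proof -
  have "integral (cyl_box (R + 2)) (window R) =
     integral (cyl_box (R + 2)) (cutoff (R + 1) 1) - integral (cyl_box (R + 2)) (cutoff (R - 1) 1)"
    unfolding window_def[abs_def] by (intro integral_diff integrable_cyl_box cutoff_cont)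
  also have "\<dots> \<le> pi * (R + 1 + 1)\<^sup>2 - pi * (R - 1)\<^sup>2"
    using disk_area_bounds(2)[of "R + 1" "R + 2"] disk_area_bounds(1)[of "R - 1" "R + 2"] R by simp
  also have "\<dots> = pi * (6 * R + 3)" by (simp add: power2_eq_square algebra_simps)
  also have "\<dots> \<le> 4 * (9 * R)" using pi_less_4 R by (intro mult_mono) auto
  finally show ?thesis by simp
qed

section \<open>Averages over vertical segments\<close>

definition slice :: "(real ^ 3 \<Rightarrow> real) \<Rightarrow> real ^ 3 \<Rightarrow> real" where
  "slice f x = integral {0..1} (\<lambda>s. f (pt (x $ 1) (x $ 2) s))"

lemma slice_cont:
  assumes "continuous_on closed_slab f"
  shows "continuous_on A (slice f)"
proof -
  have "continuous_on A (\<lambda>x. integral (cbox 0 1) (\<lambda>s. f (pt (x $ 1) (x $ 2) s)))"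
  proof (rule integral_continuous_on_param, unfold case_prod_beta)
    show "continuous_on (A \<times> cbox 0 1) (\<lambda>q. f (pt (fst q $ 1) (fst q $ 2) (snd q)))"
      by (intro continuous_on_slab_pt[OF assms] continuous_intros) auto
  qed
  then show ?thesis by (simp add: slice_def[abs_def])
qed

lemma slice_integrable:
  fixes f :: "real ^ 3 \<Rightarrow> real"
  assumes "continuous_on closed_slab f" "0 \<le> a" "b \<le> 1"
  shows "(\<lambda>s. f (pt x y s)) integrable_on {a..b}"
proof -
  have "continuous_on (cbox a b) (\<lambda>s. f (pt x y s))"
    by (intro continuous_on_slab_pt[OF assms(1)] continuous_intros) (use assms in auto)
  from integrable_continuous[OF this] show ?thesis by simp
qed

lemma slice_mono:
  assumes "continuous_on closed_slab f" "continuous_on closed_slab g"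
    and "\<And>s. 0 \<le> s \<Longrightarrow> s \<le> 1 \<Longrightarrow> f (pt (x $ 1) (x $ 2) s) \<le> g (pt (x $ 1) (x $ 2) s)"
  shows "slice f x \<le> slice g x"
  unfolding slice_def by (intro integral_le slice_integrable assms) (use assms in auto)

lemma slice_le_const:
  assumes "continuous_on closed_slab f"
    and "\<And>s. 0 \<le> s \<Longrightarrow> s \<le> 1 \<Longrightarrow> f (pt (x $ 1) (x $ 2) s) \<le> k"
  shows "slice f x \<le> k"
  using slice_mono[of f "\<lambda>_. k" x] assms by (auto simp: slice_def)

lemma slice_nonneg:
  assumes "continuous_on closed_slab f" "\<And>x. 0 \<le> f x"
  shows "0 \<le> slice f x"
  unfolding slice_def by (intro integral_nonneg slice_integrable assms) auto

text \<open>Fubini's theorem: against a weight that is independent of the height, \<open>f\<close> can be replaced by its average.\<close>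

lemma integral_weight_slice:
  assumes f: "continuous_on closed_slab f" and g: "continuous_on closed_slab g"
    and indep: "\<And>x y. x $ 1 = y $ 1 \<Longrightarrow> x $ 2 = y $ 2 \<Longrightarrow> g x = g y"
  shows "integral (cyl_box M) (\<lambda>x. g x * f x) = integral (cyl_box M) (\<lambda>x. g x * slice f x)"
proof -
  have "integral {0..1} (\<lambda>s. g (pt a b s) * f (pt a b s)) = integral {0..1} (\<lambda>s. g (pt a b s) * slice f (pt a b s))" for a b
  proof -
    have "g (pt a b s) = g (pt a b 0)" for s by (rule indep) simp_all
    then obtain k where "\<And>s. g (pt a b s) = k" by blast
    then show ?thesis by (simp add: slice_def)
  qed
  then show ?thesis
    by (subst (1 2) integral_cyl_box) (auto intro!: continuous_intros f g slice_cont)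
qed

section \<open>The energy balance with a cutoff\<close>

context axisym_flow
begin

abbreviation V where "V \<equiv> speed_sq"
abbreviation Q where "Q \<equiv> energy_density"

lemma V_cont: "continuous_on closed_slab V" and Q_cont: "continuous_on closed_slab Q"
  unfolding speed_sq_def energy_density_def by (intro continuous_intros u_cont du_cont)+

lemma V_nonneg [simp]: "0 \<le> V x" and Q_nonneg [simp]: "0 \<le> Q x"
  by (auto simp: speed_sq_def energy_density_def intro!: sum_nonneg)

lemma w_sq_le_horizontal: "(w x)\<^sup>2 \<le> radius_sq x * ((u 1 x)\<^sup>2 + (u 2 x)\<^sup>2)"
proof -
  have "0 \<le> (x $ 1 * u 2 x - x $ 2 * u 1 x)\<^sup>2" by simp
  then show ?thesis by (simp add: w_def radius_sq_def power2_eq_square algebra_simps)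
qed

lemma w_sq_le: "(w x)\<^sup>2 \<le> radius_sq x * V x"
proof -
  have "radius_sq x * ((u 1 x)\<^sup>2 + (u 2 x)\<^sup>2) \<le> radius_sq x * V x"
    by (intro mult_left_mono) (auto simp: speed_sq_def sum_3)
  with w_sq_le_horizontal show ?thesis by (rule order_trans)
qed

lemma W_sq_le:
  assumes x: "x \<in> closed_slab"
  shows "(W x)\<^sup>2 \<le> radius_sq x * slice V x"
proof -
  have x3: "0 \<le> x $ 3" "x $ 3 \<le> 1" using x by (auto simp: closed_slab_def)
  have "(W x)\<^sup>2 \<le> integral {0..1} (\<lambda>s. (w (pt (x $ 1) (x $ 2) s))\<^sup>2)"
    unfolding W_def
    by (intro square_integral_le x3 continuous_on_slab_pt[OF w_cont] continuous_intros) auto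
  also have "\<dots> = slice (\<lambda>y. (w y)\<^sup>2) x" by (simp add: slice_def)
  also have "\<dots> \<le> slice (\<lambda>y. radius_sq y * V y) x"
    unfolding radius_sq_def
    by (intro slice_mono continuous_intros w_cont V_cont w_sq_le[unfolded radius_sq_def])
  also have "\<dots> = radius_sq x * slice V x" by (simp add: slice_def radius_sq_def)
  finally show ?thesis .
qed

text \<open>
  The Poincare inequality in its pointwise form: \<open>u\<close> vanishes on the lower wall, so \<open>u\<^sub>j\<close> is the integral
  of \<open>\<partial>\<^sub>3u\<^sub>j\<close> over a part of the vertical segment.
\<close>

lemma V_le_slice_Q:
  assumes x: "x \<in> closed_slab"
  shows "V x \<le> slice Q x"
proof -
  have x3: "0 \<le> x $ 3" "x $ 3 \<le> 1" using x by (auto simp: closed_slab_def)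
  have "(u j x)\<^sup>2 \<le> slice (\<lambda>y. (du j 3 y)\<^sup>2) x" for j
  proof -
    have "u j x = integral {0..x $ 3} (\<lambda>s. du j 3 (pt (x $ 1) (x $ 2) s))"
      using integral_du3[OF x3] by (simp add: pt_eta)
    also have "\<dots>\<^sup>2 \<le> integral {0..1} (\<lambda>s. (du j 3 (pt (x $ 1) (x $ 2) s))\<^sup>2)"
      by (intro square_integral_le x3 continuous_on_slab_pt[OF du_cont] continuous_intros) auto
    finally show ?thesis by (simp add: slice_def)
  qed
  then have "V x \<le> (\<Sum>j\<in>UNIV. slice (\<lambda>y. (du j 3 y)\<^sup>2) x)"
    unfolding speed_sq_def by (rule sum_mono)
  also have "\<dots> = slice (\<lambda>y. \<Sum>j\<in>UNIV. (du j 3 y)\<^sup>2) x"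
    unfolding slice_def
    by (rule integral_sum[symmetric]) (auto intro!: slice_integrable[where f="\<lambda>y. (du _ 3 y)\<^sup>2"] continuous_intros du_cont)
  also have "\<dots> \<le> slice Q x"
    by (intro slice_mono continuous_intros du_cont Q_cont)
       (auto simp: energy_density_def sum_3)
  finally show ?thesis .
qed

lemma slice_V_nonneg [simp]: "0 \<le> slice V x" and slice_Q_nonneg [simp]: "0 \<le> slice Q x"
  by (auto intro: slice_nonneg V_cont Q_cont)

lemma slice_V_le_slice_Q: "slice V x \<le> slice Q x"
proof (rule slice_le_const[OF V_cont])
  fix s :: real assume "0 \<le> s" "s \<le> 1"
  then have "V (pt (x $ 1) (x $ 2) s) \<le> slice Q (pt (x $ 1) (x $ 2) s)"
    by (intro V_le_slice_Q) (simp add: pt_in_closed_slab)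
  then show "V (pt (x $ 1) (x $ 2) s) \<le> slice Q x" by (simp add: slice_def)
qed

text \<open>
  The gradients of \<open>\<phi> = cutoff R d\<close> and of \<open>\<Phi> = cutoff_slope R d \<cdot> W\<close>. The four flux densities are the terms
  of the energy identity for this choice: they come from the viscous term, from the correction \<open>\<Phi> e\<^sub>3\<close> in the
  viscous term, from that correction in the convective term, and from the transport of kinetic energy.
\<close>

definition dphi where "dphi R d i x = (if i = 3 then 0 else cutoff_slope R d x * x $ i)"
definition dPhi where "dPhi R d i x = (if i = 3 then 0 else cutoff_curv R d x * x $ i) * W x +
   cutoff_slope R d x * (if i = 3 then w x else - x $ i * u 3 x)"

definition flux_visc where "flux_visc R d x = (\<Sum>j\<in>UNIV. \<Sum>i\<in>UNIV. dphi R d i x * du j i x * u j x)"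
definition flux_shear where "flux_shear R d x = (\<Sum>i\<in>UNIV. du 3 i x * dPhi R d i x)"
definition flux_conv where "flux_conv R d x = (\<Sum>i\<in>UNIV. u i x * du 3 i x) * (cutoff_slope R d x * W x)"
definition flux_kin where "flux_kin R d x = V x / 2 * (cutoff_slope R d x * w x)"
definition flux where "flux R d x = - flux_visc R d x + flux_shear R d x + flux_conv R d x + flux_kin R d x"

lemma flux_cont: 
   "continuous_on closed_slab (flux R d)"
proof -
  have "has_grad (\<lambda>x. cutoff_slope R d x * W x) (dPhi R d)"
    using has_grad_mult[OF cutoff_slope_grad W_grad] by (simp add: dPhi_def[abs_def])
  then have c: "continuous_on closed_slab (dPhi R d i)" for i by (rule has_gradD)
  have c': "continuous_on closed_slab (dphi R d i)" for i
    using has_gradD(2)[OF cutoff_grad] by (simp add: dphi_def[abs_def])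
  show ?thesis
    unfolding flux_def[abs_def] flux_visc_def flux_shear_def flux_conv_def flux_kin_def
    by (intro continuous_intros c c' u_cont du_cont V_cont w_cont has_gradD(1)[OF cutoff_slope_grad] has_gradD(1)[OF W_grad]) auto
qed

lemma energy_balance:
  assumes R: "0 \<le> R" and d: "0 < d" and M: "R + d \<le> M"
  shows "integral (cyl_box M) (\<lambda>x. cutoff R d x * Q x) = integral (cyl_box M) (flux R d)"
proof -
  have phi: "has_grad (cutoff R d) (dphi R d)"
    using cutoff_grad by (simp add: dphi_def[abs_def])
  have Phi: "has_grad (\<lambda>x. cutoff_slope R d x * W x) (dPhi R d)"
    using has_grad_mult[OF cutoff_slope_grad W_grad] by (simp add: dPhi_def[abs_def])
  have compat: "(\<Sum>i\<in>UNIV. u i x * dphi R d i x) = cutoff_slope R d x * w x" for x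
    by (simp add: sum_3 dphi_def w_def algebra_simps)
  have "integral (cyl_box M) (\<lambda>x. cutoff R d x * Q x) =
    integral (cyl_box M) (\<lambda>x. - (\<Sum>j\<in>UNIV. \<Sum>i\<in>UNIV. dphi R d i x * du j i x * u j x)
       + (\<Sum>i\<in>UNIV. du 3 i x * dPhi R d i x) + (\<Sum>i\<in>UNIV. u i x * du 3 i x) * (cutoff_slope R d x * W x)
       + V x / 2 * (\<Sum>i\<in>UNIV. u i x * dphi R d i x))"
  proof (rule energy_identity[OF phi Phi])
    show "0 \<le> M" using R d M by simp
    fix x :: "real ^ 3" assume "\<bar>x $ 1\<bar> \<ge> M \<or> \<bar>x $ 2\<bar> \<ge> M"
    then have "(R + d)\<^sup>2 \<le> radius_sq x"
      using R d M by (intro radius_sq_ge_of_coord) auto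
    then show "cutoff R d x = 0 \<and> cutoff_slope R d x * W x = 0"
      using cutoff_outside[OF R d] by simp
  next
    fix x :: "real ^ 3" assume "x $ 3 = 0 \<or> x $ 3 = 1"
    then show "cutoff_slope R d x * W x = 0" using W_top W_bottom by auto
  next
    show "dPhi R d 3 x = (\<Sum>i\<in>UNIV. u i x * dphi R d i x)" for x
      by (simp add: compat dPhi_def)
  qed
  then show ?thesis
    by (simp only: compat flux_def[abs_def] flux_visc_def flux_shear_def flux_conv_def flux_kin_def)
qed

lemma flux_eq_0:
  assumes "cutoff_slope R d x = 0" "cutoff_curv R d x = 0"
  shows "flux R d x = 0"
  using assms
  by (simp add: flux_def flux_visc_def flux_shear_def flux_conv_def flux_kin_def dphi_def dPhi_def sum_3)

lemma sum_dphi_sq: "(\<Sum>i\<in>UNIV. (dphi R d i x)\<^sup>2) = (cutoff_slope R d x)\<^sup>2 * radius_sq x"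
  by (simp add: sum_3 dphi_def radius_sq_def power_mult_distrib algebra_simps)

text \<open>
  The next four bounds are applications of the Cauchy--Schwarz inequality. They are stated for squares so
  that \<open>young_of_square\<close> applies.
\<close>

lemma flux_visc_sq: "(flux_visc R d x)\<^sup>2 \<le> (cutoff_slope R d x)\<^sup>2 * radius_sq x * V x * Q x"
proof -
  have "flux_visc R d x = (\<Sum>j\<in>UNIV. u j x * (\<Sum>i\<in>UNIV. dphi R d i x * du j i x))"
    by (simp add: flux_visc_def sum_distrib_left mult_ac)
  also have "\<dots>\<^sup>2 \<le> V x * (\<Sum>j\<in>UNIV. (\<Sum>i\<in>UNIV. dphi R d i x * du j i x)\<^sup>2)"
    unfolding speed_sq_def by (rule Cauchy_Schwarz_ineq_sum)
  also have "\<dots> \<le> V x * (\<Sum>j\<in>UNIV. (\<Sum>i\<in>UNIV. (dphi R d i x)\<^sup>2) * (\<Sum>i\<in>UNIV. (du j i x)\<^sup>2))"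
    by (intro mult_left_mono sum_mono Cauchy_Schwarz_ineq_sum) auto
  also have "\<dots> = (cutoff_slope R d x)\<^sup>2 * radius_sq x * V x * Q x"
    by (simp add: sum_dphi_sq energy_density_def sum_distrib_left mult_ac)
  finally show ?thesis .
qed

lemma du_row_le_Q: "(\<Sum>i\<in>UNIV. (du j i x)\<^sup>2) \<le> Q x"
  unfolding energy_density_def by (rule member_le_sum) (auto intro: sum_nonneg)

lemma flux_conv_sq:
  assumes "x \<in> closed_slab"
  shows "(flux_conv R d x)\<^sup>2 \<le> (cutoff_slope R d x)\<^sup>2 * radius_sq x * V x * Q x * slice V x"
proof -
  have "(\<Sum>i\<in>UNIV. u i x * du 3 i x)\<^sup>2 \<le> V x * (\<Sum>i\<in>UNIV. (du 3 i x)\<^sup>2)"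
    unfolding speed_sq_def by (rule Cauchy_Schwarz_ineq_sum)
  also have "\<dots> \<le> V x * Q x" by (intro mult_left_mono du_row_le_Q) auto
  finally have "(flux_conv R d x)\<^sup>2 \<le> (V x * Q x) * ((cutoff_slope R d x)\<^sup>2 * (radius_sq x * slice V x))"
    unfolding flux_conv_def power_mult_distrib
    by (intro mult_mono W_sq_le[OF assms] mult_nonneg_nonneg order_refl) auto
  then show ?thesis by (simp add: mult_ac)
qed

lemma flux_kin_sq: "(flux_kin R d x)\<^sup>2 \<le> (cutoff_slope R d x)\<^sup>2 * radius_sq x * V x ^ 3 / 4"
proof -
  have "(flux_kin R d x)\<^sup>2 = (V x)\<^sup>2 / 4 * (cutoff_slope R d x)\<^sup>2 * (w x)\<^sup>2"
    by (simp add: flux_kin_def power_mult_distrib power_divide)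
  also have "\<dots> \<le> (V x)\<^sup>2 / 4 * (cutoff_slope R d x)\<^sup>2 * (radius_sq x * V x)"
    by (intro mult_left_mono w_sq_le) auto
  finally show ?thesis by (simp add: power2_eq_square power3_eq_cube mult_ac)
qed

text \<open>
  Since \<open>\<partial>\<^sub>i\<Phi>\<close> equals \<open>x\<^sub>i (cutoff_curv W - cutoff_slope u\<^sub>3)\<close> for \<open>i = 1, 2\<close> and \<open>cutoff_slope w\<close> for
  \<open>i = 3\<close>, the gradient of \<open>u\<close> occurs in this term only once.
\<close>

lemma flux_shear_sq:
  assumes "x \<in> closed_slab"
  shows "(flux_shear R d x)\<^sup>2 \<le> Q x * (2 * ((cutoff_curv R d x)\<^sup>2 * (radius_sq x)\<^sup>2 * slice V x) +
     2 * ((cutoff_slope R d x)\<^sup>2 * radius_sq x * V x))"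
proof -
  let ?k = "cutoff_curv R d x" and ?p = "cutoff_slope R d x"
  have "(flux_shear R d x)\<^sup>2 \<le> (\<Sum>i\<in>UNIV. (du 3 i x)\<^sup>2) * (\<Sum>i\<in>UNIV. (dPhi R d i x)\<^sup>2)"
    unfolding flux_shear_def by (rule Cauchy_Schwarz_ineq_sum)
  also have "\<dots> \<le> Q x * (\<Sum>i\<in>UNIV. (dPhi R d i x)\<^sup>2)"
    by (intro mult_right_mono du_row_le_Q sum_nonneg) auto
  also have "\<dots> \<le> Q x * (2 * (?k\<^sup>2 * (radius_sq x)\<^sup>2 * slice V x) + 2 * (?p\<^sup>2 * radius_sq x * V x))"
  proof (intro mult_left_mono)
    have "(\<Sum>i\<in>UNIV. (dPhi R d i x)\<^sup>2) = radius_sq x * (?k * W x - ?p * u 3 x)\<^sup>2 + ?p\<^sup>2 * (w x)\<^sup>2"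
      by (simp add: sum_3 dPhi_def radius_sq_def power2_eq_square algebra_simps)
    also have "\<dots> \<le> radius_sq x * (2 * (?k * W x)\<^sup>2 + 2 * (?p * u 3 x)\<^sup>2) + ?p\<^sup>2 * (w x)\<^sup>2"
    proof -
      have "0 \<le> (?k * W x + ?p * u 3 x)\<^sup>2" by simp
      then have "(?k * W x - ?p * u 3 x)\<^sup>2 \<le> 2 * (?k * W x)\<^sup>2 + 2 * (?p * u 3 x)\<^sup>2"
        by (simp add: power2_eq_square algebra_simps)
      then show ?thesis by (intro add_right_mono mult_left_mono) auto
    qed
    also have "\<dots> = 2 * (?k\<^sup>2 * radius_sq x * (W x)\<^sup>2) + ?p\<^sup>2 * (2 * radius_sq x * (u 3 x)\<^sup>2 + (w x)\<^sup>2)"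
      by (simp add: power_mult_distrib algebra_simps)
    also have "\<dots> \<le> 2 * (?k\<^sup>2 * radius_sq x * (radius_sq x * slice V x)) +
        ?p\<^sup>2 * (2 * radius_sq x * (u 3 x)\<^sup>2 + radius_sq x * ((u 1 x)\<^sup>2 + (u 2 x)\<^sup>2))"
      by (intro add_mono mult_left_mono W_sq_le[OF assms] order_refl w_sq_le_horizontal) auto
    also have "\<dots> \<le> 2 * (?k\<^sup>2 * radius_sq x * (radius_sq x * slice V x)) + ?p\<^sup>2 * (2 * radius_sq x * V x)"
    proof (intro add_left_mono mult_left_mono)
      have "radius_sq x * ((u 1 x)\<^sup>2 + (u 2 x)\<^sup>2) \<le> 2 * radius_sq x * ((u 1 x)\<^sup>2 + (u 2 x)\<^sup>2)"
        by (intro mult_right_mono) auto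
      then show "2 * radius_sq x * (u 3 x)\<^sup>2 + radius_sq x * ((u 1 x)\<^sup>2 + (u 2 x)\<^sup>2) \<le> 2 * radius_sq x * V x"
        by (simp add: speed_sq_def sum_3 algebra_simps)
    qed auto
    also have "\<dots> = 2 * (?k\<^sup>2 * (radius_sq x)\<^sup>2 * slice V x) + 2 * (?p\<^sup>2 * radius_sq x * V x)"
      by (simp add: power2_eq_square mult_ac)
    finally show "(\<Sum>i\<in>UNIV. (dPhi R d i x)\<^sup>2) \<le> 2 * (?k\<^sup>2 * (radius_sq x)\<^sup>2 * slice V x) + 2 * (?p\<^sup>2 * radius_sq x * V x)" .
  qed auto
  finally show ?thesis .
qed

end

section \<open>Energy bound from a bound on the speed\<close>

context axisym_flow
begin

text \<open>
  A Caccioppoli inequality for the cutoff between \<open>R\<close> and \<open>2 R\<close>. Three of the four fluxes contain \<open>\<nabla>u\<close>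
  linearly and carry a weight bounded by the square root of \<open>\<phi>\<close>; each of them gives up \<open>\<phi> |\<nabla>u|\<^sup>2 / 8\<close>, which
  is absorbed. What remains is a constant, integrated over a box of volume \<open>16 R\<^sup>2\<close>.
\<close>

lemma caccioppoli:
  assumes R: "1 \<le> R" and m: "0 \<le> m"
    and bound: "\<And>x. x \<in> closed_slab \<Longrightarrow> radius_sq x \<le> (2 * R)\<^sup>2 \<Longrightarrow> V x \<le> m\<^sup>2"
  shows "integral (cyl_box (2 * R)) (\<lambda>x. cutoff R R x * Q x) \<le>
     200000000 * R\<^sup>2 * (m\<^sup>2 / R\<^sup>2 + m ^ 3 / R + m ^ 4 / R\<^sup>2)"
proof -
  define K where "K = 4000000 * (m\<^sup>2 / R\<^sup>2 + m ^ 3 / R + m ^ 4 / R\<^sup>2)"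
  have R0: "0 < R" "0 \<le> R" using R by auto
  have RR: "R + R = 2 * R" by simp
  have K0: "0 \<le> K" unfolding K_def using m R0 by simp
  have pt: "flux R R x \<le> 3 / 8 * (cutoff R R x * Q x) + K" if x: "x \<in> closed_slab" for x
  proof (cases "(2 * R)\<^sup>2 \<le> radius_sq x")
    case True
    then have "flux R R x = 0"
      by (intro flux_eq_0 cutoff_outside) (use R0 RR in auto)
    then show ?thesis using K0 cutoff_bounds[OF R0(2,1), of x] by simp
  next
    case False
    define f where "f = cutoff R R x"
    define P where "P = (cutoff_slope R R x)\<^sup>2 * radius_sq x"
    have f: "0 \<le> f" "f \<le> 1" using cutoff_bounds[OF R0(2,1), of x] by (auto simp: f_def)
    have P: "0 \<le> P" "P \<le> 1024 * f / R\<^sup>2"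
      using cutoff_slope_bound[OF R0(2,1), of x] by (auto simp: P_def f_def)
    have Vm: "V x \<le> m\<^sup>2" using bound[OF x] False by simp
    have Hm: "slice V x \<le> m\<^sup>2"
    proof (rule slice_le_const[OF V_cont])
      fix s :: real assume "0 \<le> s" "s \<le> 1"
      then show "V (pt (x $ 1) (x $ 2) s) \<le> m\<^sup>2"
        using False by (intro bound) (auto simp: pt_in_closed_slab radius_sq_def)
    qed
    have fQ: "0 \<le> f * Q x" using f by simp
    have "(flux_visc R R x)\<^sup>2 \<le> P * V x * Q x"
      using flux_visc_sq[of R R x] by (simp add: P_def)
    also have "\<dots> \<le> (1024 * f / R\<^sup>2) * m\<^sup>2 * Q x"
      using P Vm f by (intro mult_mono mult_nonneg_nonneg) auto
    also have "\<dots> = (f * Q x) * (1024 * (m\<^sup>2 / R\<^sup>2))" by simp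
    finally have 1: "\<bar>flux_visc R R x\<bar> \<le> (f * Q x) / 8 + 2 * (1024 * (m\<^sup>2 / R\<^sup>2))"
      by (rule young_of_square) (use fQ in auto)
    have curv: "(cutoff_curv R R x)\<^sup>2 * (radius_sq x)\<^sup>2 \<le> 921600 * f / R\<^sup>2"
    proof -
      have "R\<^sup>2 \<le> R ^ 4" using R by (intro power_increasing) auto
      then have "921600 * f / R ^ 4 \<le> 921600 * f / R\<^sup>2"
        using f R0 by (intro divide_left_mono) auto
      then show ?thesis using cutoff_curv_bound[OF R0(2,1), of x] by (simp add: f_def)
    qed
    have "(flux_shear R R x)\<^sup>2 \<le> Q x * (2 * ((cutoff_curv R R x)\<^sup>2 * (radius_sq x)\<^sup>2 * slice V x) + 2 * (P * V x))"
      using flux_shear_sq[OF x, of R R] by (simp add: P_def)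
    also have "\<dots> \<le> Q x * (2 * ((921600 * f / R\<^sup>2) * m\<^sup>2) + 2 * ((1024 * f / R\<^sup>2) * m\<^sup>2))"
      using P Vm Hm f curv by (intro mult_left_mono add_mono mult_mono) auto
    also have "\<dots> = (f * Q x) * (1845248 * (m\<^sup>2 / R\<^sup>2))" by (simp add: field_simps)
    finally have 2: "\<bar>flux_shear R R x\<bar> \<le> (f * Q x) / 8 + 2 * (1845248 * (m\<^sup>2 / R\<^sup>2))"
      by (rule young_of_square) (use fQ in auto)
    have "(flux_conv R R x)\<^sup>2 \<le> P * V x * Q x * slice V x"
      using flux_conv_sq[OF x, of R R] by (simp add: P_def)
    also have "\<dots> \<le> (1024 * f / R\<^sup>2) * m\<^sup>2 * Q x * m\<^sup>2"
      using P Vm Hm f by (intro mult_mono mult_nonneg_nonneg) auto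
    also have "\<dots> = (f * Q x) * (1024 * (m ^ 4 / R\<^sup>2))" by (simp add: power2_eq_square power4_eq_xxxx)
    finally have 3: "\<bar>flux_conv R R x\<bar> \<le> (f * Q x) / 8 + 2 * (1024 * (m ^ 4 / R\<^sup>2))"
      by (rule young_of_square) (use fQ in auto)
    have "(flux_kin R R x)\<^sup>2 \<le> P * V x ^ 3 / 4"
      using flux_kin_sq[of R R x] by (simp add: P_def)
    also have "\<dots> \<le> (1024 * 1 / R\<^sup>2) * (m\<^sup>2) ^ 3 / 4"
    proof (intro divide_right_mono mult_mono power_mono)
      show "P \<le> 1024 * 1 / R\<^sup>2"
        using P(2) f R0 by (meson divide_right_mono mult_left_mono order_trans zero_le_numeral zero_le_power2)
    qed (use P Vm in auto)
    also have "\<dots> = (16 * (m ^ 3 / R))\<^sup>2"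
      by (simp add: power_mult_distrib power_divide flip: power_mult)
    finally have "\<bar>flux_kin R R x\<bar>\<^sup>2 \<le> (16 * (m ^ 3 / R))\<^sup>2" by simp
    then have 4: "\<bar>flux_kin R R x\<bar> \<le> 16 * (m ^ 3 / R)"
      by (rule power2_le_imp_le) (use m R0 in auto)
    have nn: "0 \<le> m\<^sup>2 / R\<^sup>2" "0 \<le> m ^ 3 / R" "0 \<le> m ^ 4 / R\<^sup>2" using m R0 by auto
    have collect: "- v + s + c + k \<le> 3 / 8 * g + 4000000 * (A + B + C)"
      if "\<bar>v\<bar> \<le> g / 8 + 2 * (1024 * A)" "\<bar>s\<bar> \<le> g / 8 + 2 * (1845248 * A)" "\<bar>c\<bar> \<le> g / 8 + 2 * (1024 * C)"
        "\<bar>k\<bar> \<le> 16 * B" "0 \<le> A" "0 \<le> B" "0 \<le> C" for v s c k g A B C :: real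
      using that by (simp add: abs_le_iff)
    show ?thesis
      unfolding flux_def K_def f_def[symmetric] by (rule collect[OF 1 2 3 4 nn])
  qed
  define X where "X = integral (cyl_box (2 * R)) (\<lambda>x. cutoff R R x * Q x)"
  have fc: "continuous_on closed_slab (\<lambda>x. cutoff R R x * Q x)"
    by (intro continuous_intros Q_cont has_gradD(1)[OF cutoff_grad])
  have "X = integral (cyl_box (2 * R)) (flux R R)"
    unfolding X_def by (rule energy_balance) (use R0 in auto)
  also have "\<dots> \<le> integral (cyl_box (2 * R)) (\<lambda>x. 3 / 8 * (cutoff R R x * Q x) + K)"
    by (intro integral_cyl_box_mono flux_cont continuous_intros fc pt)
  also have "\<dots> = integral (cyl_box (2 * R)) (\<lambda>x. 3 / 8 * (cutoff R R x * Q x)) + integral (cyl_box (2 * R)) (\<lambda>x. K)"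
    by (intro integral_add integrable_cyl_box continuous_intros fc)
  also have "\<dots> = 3 / 8 * X + 4 * (2 * R)\<^sup>2 * K"
    using R0 by (subst integral_cyl_box_const) (auto simp: X_def)
  finally have "X \<le> 8 / 5 * (16 * R\<^sup>2 * K)" by (simp add: power2_eq_square)
  also have "\<dots> \<le> 200000000 * R\<^sup>2 * (m\<^sup>2 / R\<^sup>2 + m ^ 3 / R + m ^ 4 / R\<^sup>2)"
  proof -
    have "0 \<le> R\<^sup>2 * (m\<^sup>2 / R\<^sup>2 + m ^ 3 / R + m ^ 4 / R\<^sup>2)" using m R0 by simp
    moreover have "8 / 5 * (16 * r * (4000000 * z)) \<le> 200000000 * r * z" if "0 \<le> r * z" for r z :: real
      using that by simp
    ultimately show ?thesis unfolding K_def by blast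
  qed
  finally show ?thesis by (simp add: X_def)
qed

section \<open>Radial dependence gives control on a circle\<close>

lemma slice_V_deriv:
  "((\<lambda>t. slice V (pt t y 0)) has_real_derivative slice (\<lambda>x. \<Sum>j\<in>UNIV. 2 * (u j x * du j 1 x)) (pt t y 0)) (at t)"
proof -
  have "((\<lambda>t. integral (cbox 0 1) (\<lambda>s. V (pt t y s))) has_real_derivative
      integral (cbox 0 1) (\<lambda>s. \<Sum>j\<in>UNIV. 2 * (u j (pt t y s) * du j 1 (pt t y s)))) (at t within UNIV)"
  proof (rule leibniz_rule_field_derivative)
    fix t s :: real assume "s \<in> cbox 0 1"
    then have s: "0 \<le> s" "s \<le> 1" by auto
    show "((\<lambda>t. V (pt t y s)) has_real_derivative (\<Sum>j\<in>UNIV. 2 * (u j (pt t y s) * du j 1 (pt t y s)))) (at t within UNIV)"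
      unfolding speed_sq_def
      by (auto intro!: derivative_eq_intros has_gradD(3)[OF u_grad] s simp: mult_ac)
  next
    show "(\<lambda>s. V (pt t y s)) integrable_on cbox 0 1" for t
      using slice_integrable[OF V_cont] by simp
  next
    show "continuous_on (UNIV \<times> cbox 0 1) (\<lambda>(t, s). \<Sum>j\<in>UNIV. 2 * (u j (pt t y s) * du j 1 (pt t y s)))"
      unfolding case_prod_beta
      by (intro continuous_intros continuous_on_slab_pt[OF u_cont] continuous_on_slab_pt[OF du_cont]) auto
  qed auto
  then show ?thesis by (simp add: slice_def)
qed

lemma slice_V_deriv_bound:
  "\<bar>slice (\<lambda>x. \<Sum>j\<in>UNIV. 2 * (u j x * du j 1 x)) x\<bar> \<le> 2 * slice Q x"
proof -
  let ?f = "\<lambda>x. \<Sum>j\<in>UNIV. 2 * (u j x * du j 1 x)"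
  have fc: "continuous_on closed_slab ?f" by (intro continuous_intros u_cont du_cont)
  have "\<bar>?f y\<bar> \<le> V y + Q y" for y
  proof -
    have "\<bar>?f y\<bar> \<le> (\<Sum>j\<in>UNIV. \<bar>2 * (u j y * du j 1 y)\<bar>)" by (rule sum_abs)
    also have "\<dots> \<le> (\<Sum>j\<in>UNIV. (u j y)\<^sup>2 + (\<Sum>i\<in>UNIV. (du j i y)\<^sup>2))"
    proof (rule sum_mono)
      fix j
      have "0 \<le> (\<bar>u j y\<bar> - \<bar>du j 1 y\<bar>)\<^sup>2" by simp
      then have "\<bar>2 * (u j y * du j 1 y)\<bar> \<le> (u j y)\<^sup>2 + (du j 1 y)\<^sup>2"
        by (simp add: power2_diff abs_mult)
      also have "(du j 1 y)\<^sup>2 \<le> (\<Sum>i\<in>UNIV. (du j i y)\<^sup>2)" by (simp add: sum_3)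
      finally show "\<bar>2 * (u j y * du j 1 y)\<bar> \<le> (u j y)\<^sup>2 + (\<Sum>i\<in>UNIV. (du j i y)\<^sup>2)" by simp
    qed
    also have "\<dots> = V y + Q y" by (simp add: speed_sq_def energy_density_def sum.distrib)
    finally show ?thesis .
  qed
  then have "norm (slice ?f x) \<le> slice (\<lambda>y. V y + Q y) x"
    unfolding slice_def
    by (intro integral_norm_bound_integral slice_integrable[OF fc]
          slice_integrable[where f="\<lambda>y. V y + Q y"] continuous_intros V_cont Q_cont) auto
  also have "\<dots> = slice V x + slice Q x"
    unfolding slice_def by (intro integral_add slice_integrable V_cont Q_cont) auto
  finally show ?thesis using slice_V_le_slice_Q[of x] by simp
qed

lemma slice_V_radial:
  assumes "radius_sq x = radius_sq y"
  shows "slice V x = slice V y"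
  unfolding slice_def
  by (intro Henstock_Kurzweil_Integration.integral_cong)
     (use assms in \<open>auto simp: speed_sq_def radius_sq_def pt_in_closed_slab intro!: radial\<close>)

definition window_energy where "window_energy R = integral (cyl_box (R + 2)) (\<lambda>x. window R x * Q x)"

text \<open>
  The gain from axisymmetry. For every \<open>y\<close> in \<open>[0, R]\<close> the horizontal line at distance \<open>y\<close> from the
  axis meets the annulus \<open>R \<le> r \<le> R + 1\<close> in a segment \<open>[a, b]\<close> of length at least \<open>1\<close> that contains a point with
  the same radius as \<open>x\<close>. Along this segment the vertical average of \<open>|u|\<^sup>2\<close> and its
  derivative are controlled by the energy, so its value at that point, which is its value at \<open>x\<close>, is at most
  three times the energy on the segment. Integrating over \<open>y\<close> produces the factor \<open>R\<close>.
\<close>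

lemma slice_V_le_window_energy:
  assumes R: "1 \<le> R" and x: "R\<^sup>2 \<le> radius_sq x" "radius_sq x \<le> (R + 1)\<^sup>2"
  shows "R * slice V x \<le> 3 * window_energy R"
proof -
  let ?M = "R + 2"
  let ?g = "\<lambda>y. integral {-?M..?M} (\<lambda>t. window R (pt t y 0) * slice Q (pt t y 0))"
  have cont: "continuous_on A (\<lambda>p. window R (pt (f p) (g p) 0) * slice Q (pt (f p) (g p) 0))"
    if "continuous_on A f" "continuous_on A g" for A :: "'b::topological_space set" and f g
    using that by (intro continuous_intros continuous_on_slab_pt[OF window_cont] continuous_on_slab_pt[OF slice_cont[OF Q_cont]]) auto
  have line: "slice V x \<le> 3 * ?g y" if y: "0 \<le> y" "y \<le> R" for y
  proof -
    define a where "a = sqrt (R\<^sup>2 - y\<^sup>2)"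
    define b where "b = sqrt ((R + 1)\<^sup>2 - y\<^sup>2)"
    have y2: "y\<^sup>2 \<le> R\<^sup>2" using y by (intro power_mono) auto
    then have a: "0 \<le> a" "a\<^sup>2 = R\<^sup>2 - y\<^sup>2" by (auto simp: a_def)
    have "R\<^sup>2 \<le> (R + 1)\<^sup>2" using R by (intro power_mono) auto
    then have b: "0 \<le> b" "b\<^sup>2 = (R + 1)\<^sup>2 - y\<^sup>2" using y2 by (auto simp: b_def)
    have "a\<^sup>2 \<le> R\<^sup>2" using a by simp
    then have "a \<le> R" by (rule power2_le_imp_le) (use R in simp)
    \<comment> \<open>\<open>b\<^sup>2 - a\<^sup>2 = 2 R + 1\<close>, and \<open>(a + 1)\<^sup>2 - a\<^sup>2 = 2 a + 1\<close>\<close>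
    then have "(a + 1)\<^sup>2 \<le> b\<^sup>2" using a b by (simp add: power2_eq_square algebra_simps)
    then have ab: "a + 1 \<le> b" by (rule power2_le_imp_le[OF _ b(1)])
    have "b\<^sup>2 \<le> (R + 1)\<^sup>2" using b by simp
    then have bM: "b \<le> R + 1" by (rule power2_le_imp_le) (use R in simp)
    define t where "t = sqrt (radius_sq x - y\<^sup>2)"
    have t: "t \<in> {a..b}" unfolding t_def a_def b_def using x by (auto intro!: real_sqrt_le_mono)
    have t2: "t\<^sup>2 + y\<^sup>2 = radius_sq x" using x y2 by (simp add: t_def)
    have win: "window R (pt s y 0) = 1" if "s \<in> {a..b}" for s
    proof (rule window_bounds(3)[OF R])
      have "a\<^sup>2 \<le> s\<^sup>2" "s\<^sup>2 \<le> b\<^sup>2" using that a(1) by (auto intro!: power_mono)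
      then show "R\<^sup>2 \<le> radius_sq (pt s y 0)" "radius_sq (pt s y 0) \<le> (R + 1)\<^sup>2"
        using a(2) b(2) by auto
    qed
    have Qc: "continuous_on A (\<lambda>s. slice Q (pt s y 0))" for A
      by (intro continuous_on_slab_pt[OF slice_cont[OF Q_cont]] continuous_intros) auto
    have Vc: "continuous_on A (\<lambda>s. slice V (pt s y 0))" for A
      by (intro continuous_on_slab_pt[OF slice_cont[OF V_cont]] continuous_intros) auto
    have "slice V x = slice V (pt t y 0)" by (rule slice_V_radial) (simp add: t2)
    also have "\<dots> \<le> integral {a..b} (\<lambda>s. slice V (pt s y 0)) + integral {a..b} (\<lambda>s. 2 * slice Q (pt s y 0))"
    proof (rule le_integral_of_derivative_bound[OF ab slice_V_deriv _ _ _ _ t])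
      show "continuous_on {a..b} (\<lambda>s. slice (\<lambda>x. \<Sum>j\<in>UNIV. 2 * (u j x * du j 1 x)) (pt s y 0))"
        by (intro continuous_on_slab_pt[OF slice_cont] continuous_intros u_cont du_cont) auto
      show "\<bar>slice (\<lambda>x. \<Sum>j\<in>UNIV. 2 * (u j x * du j 1 x)) (pt s y 0)\<bar> \<le> 2 * slice Q (pt s y 0)" for s
        by (rule slice_V_deriv_bound)
    qed (auto intro!: continuous_intros Qc)
    also have "integral {a..b} (\<lambda>s. slice V (pt s y 0)) \<le> integral {a..b} (\<lambda>s. slice Q (pt s y 0))"
      by (intro integral_le integrable_continuous_interval Qc Vc slice_V_le_slice_Q)
    also have "integral {a..b} (\<lambda>s. slice Q (pt s y 0)) + integral {a..b} (\<lambda>s. 2 * slice Q (pt s y 0)) =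
        3 * integral {a..b} (\<lambda>s. slice Q (pt s y 0))" by simp
    also have "integral {a..b} (\<lambda>s. slice Q (pt s y 0)) = integral {a..b} (\<lambda>s. window R (pt s y 0) * slice Q (pt s y 0))"
      by (intro Henstock_Kurzweil_Integration.integral_cong) (simp add: win)
    also have "\<dots> \<le> ?g y"
      using a(1) bM R window_bounds(1)[OF R]
      by (intro integral_subset_le integrable_continuous_interval cont continuous_intros) auto
    finally show ?thesis by simp
  qed
  have gc: "continuous_on A ?g" for A
  proof -
    have "continuous_on A (\<lambda>y. integral (cbox (-?M) ?M) (\<lambda>t. window R (pt t y 0) * slice Q (pt t y 0)))"
      by (rule integral_continuous_on_param, unfold case_prod_beta) (intro cont continuous_intros)
    then show ?thesis by simp
  qed
  have g0: "0 \<le> ?g y" for y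
    using window_bounds(1)[OF R] by (intro integral_nonneg integrable_continuous_interval cont continuous_intros) auto
  have "R * slice V x = integral {0..R} (\<lambda>y. slice V x)" using R by simp
  also have "\<dots> \<le> integral {0..R} (\<lambda>y. 3 * ?g y)"
    by (intro integral_le integrable_continuous_interval continuous_intros gc line) auto
  also have "\<dots> \<le> integral {-?M..?M} (\<lambda>y. 3 * ?g y)"
    using R g0 by (intro integral_subset_le integrable_continuous_interval continuous_intros gc) auto
  also have "\<dots> = 3 * integral {-?M..?M} ?g" by simp
  also have "integral {-?M..?M} ?g = integral (cyl_box ?M) (\<lambda>x. window R x * slice Q x)"
  proof -
    have "window R (pt t y s) * slice Q (pt t y s) = window R (pt t y 0) * slice Q (pt t y 0)" for t y s
    proof -
      have "window R (pt t y s) = window R (pt t y 0)" by (rule window_indep) simp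
      then show ?thesis by (simp add: slice_def)
    qed
    then have "integral {0..1} (\<lambda>s. window R (pt t y s) * slice Q (pt t y s)) =
        integral {0..1::real} (\<lambda>s. window R (pt t y 0) * slice Q (pt t y 0))" for t y
      by (intro Henstock_Kurzweil_Integration.integral_cong)
    then show ?thesis
      by (subst integral_cyl_box_swap) (auto intro!: continuous_intros window_cont slice_cont Q_cont)
  qed
  also have "\<dots> = window_energy R"
    unfolding window_energy_def
    by (rule integral_weight_slice[symmetric, OF Q_cont window_cont])
       (auto intro!: window_indep simp: radius_sq_def)
  finally show ?thesis .
qed

end

section \<open>Quartic growth of the energy\<close>

text \<open>
  Suppose \<open>b k \<ge> \<delta> k\<^sup>4\<close> but the increment is below \<open>15 \<delta> k\<^sup>3\<close>, which is an upper bound for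
  \<open>\<delta> ((k + 1)\<^sup>4 - k\<^sup>4)\<close>. Inserting \<open>\<mu> = m k\<close> into the hypothesis gives
  \<open>b k \<le> \<delta> k\<^sup>4 (15 K / k + 15 m K + 225 K \<delta> / m)\<close>. The constants \<open>m\<close>, \<open>\<delta>\<close> and \<open>N\<close> are chosen to make
  each of the three terms at most \<open>1/4\<close>, a contradiction. So the bound \<open>\<delta> k\<^sup>4\<close> propagates
  from \<open>k\<close> to \<open>k + 1\<close>.
\<close>

lemma quartic_growth:
  fixes b :: "nat \<Rightarrow> real"
  assumes K: "0 < K" and mono: "\<And>k. b k \<le> b (Suc k)" and pos: "0 < b k0"
    and step: "\<And>k \<mu>. 1 \<le> k \<Longrightarrow> 0 < \<mu> \<Longrightarrow>
      b k \<le> K * ((b (Suc k) - b k) + \<mu> * (b (Suc k) - b k) + (b (Suc k) - b k)\<^sup>2 / (real k * \<mu>))"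
  obtains \<delta> N where "0 < \<delta>" "\<And>k. N \<le> k \<Longrightarrow> \<delta> * real k ^ 4 \<le> b k"
proof -
  define N where "N = max k0 (nat \<lceil>60 * K\<rceil> + 1)"
  have N: "60 * K < real N" "1 \<le> N" "k0 \<le> N" unfolding N_def by linarith+
  have bN: "0 < b N" using pos lift_Suc_mono_le[of b k0 N] mono N(3) by fastforce
  define m where "m = 1 / (60 * K)"
  have m: "0 < m" "15 * m * K = 1 / 4" using K by (auto simp: m_def)
  define \<delta> where "\<delta> = min (b N / real N ^ 4) (m / (900 * K))"
  have d: "0 < \<delta>" using bN N m K by (simp add: \<delta>_def)
  have dm: "225 * K * \<delta> / m \<le> 1 / 4"
  proof -
    have "\<delta> \<le> m / (900 * K)" by (simp add: \<delta>_def)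
    then have "225 * K * \<delta> \<le> 225 * K * (m / (900 * K))" using K by (intro mult_left_mono) auto
    also have "\<dots> = m / 4" using K by simp
    finally show ?thesis using m by (simp add: field_simps)
  qed
  have "\<delta> * real k ^ 4 \<le> b k" if "N \<le> k" for k
    using that
  proof (induction k rule: dec_induct)
    case base
    have "\<delta> * real N ^ 4 \<le> b N / real N ^ 4 * real N ^ 4"
      by (intro mult_right_mono) (auto simp: \<delta>_def)
    then show ?case using N by simp
  next
    case (step k)
    define r where "r = real k"
    define e where "e = b (Suc k) - b k"
    have r: "60 * K < r" "1 \<le> r" using step.hyps N by (auto simp: r_def)
    have e0: "0 \<le> e" using mono by (simp add: e_def)
    have inc: "15 * \<delta> * r ^ 3 \<le> e"
    proof (rule ccontr)
      assume "\<not> ?thesis"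
      then have e: "e \<le> 15 * \<delta> * r ^ 3" by simp
      have "b k \<le> K * (e + m * r * e + e\<^sup>2 / (r * (m * r)))"
        using assms(4)[of k "m * r"] m r by (simp add: e_def r_def)
      also have "\<dots> \<le> K * (15 * \<delta> * r ^ 3 + m * r * (15 * \<delta> * r ^ 3) + (15 * \<delta> * r ^ 3)\<^sup>2 / (r * (m * r)))"
        using K m r e e0 by (intro mult_left_mono add_mono divide_right_mono power_mono) auto
      also have "\<dots> = \<delta> * r ^ 4 * (15 * K / r + 15 * m * K + 225 * K * \<delta> / m)"
        using r m by (simp add: field_simps power2_eq_square power3_eq_cube power4_eq_xxxx)
      also have "\<dots> < \<delta> * r ^ 4 * 1"
      proof (intro mult_strict_left_mono)
        have "15 * K / r \<le> 1 / 4" using r K by (simp add: field_simps)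
        then show "15 * K / r + 15 * m * K + 225 * K * \<delta> / m < 1" using m(2) dm by linarith
      qed (use d r in auto)
      finally show False using step.IH by (simp add: r_def)
    qed
    have "\<delta> * (r + 1) ^ 4 \<le> \<delta> * (r ^ 4 + 15 * r ^ 3)"
    proof (intro mult_left_mono)
      have "r ^ 2 \<le> r ^ 3" "r \<le> r ^ 3" "1 \<le> r ^ 3"
        using r power_increasing[of 2 3 r] power_increasing[of 1 3 r] by auto
      moreover have "(r + 1) ^ 4 = r ^ 4 + 4 * r ^ 3 + 6 * r ^ 2 + 4 * r + 1"
        by (simp add: power2_eq_square power3_eq_cube power4_eq_xxxx algebra_simps)
      ultimately show "(r + 1) ^ 4 \<le> r ^ 4 + 15 * r ^ 3" by linarith
    qed (use d in simp)
    also have "\<dots> \<le> b (Suc k)" using inc step.IH by (simp add: e_def r_def algebra_simps)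
    finally show ?case by (simp add: r_def add.commute)
  qed
  then show ?thesis using that d by blast
qed

context axisym_flow
begin

definition disk_energy where "disk_energy R = integral (cyl_box (R + 1)) (\<lambda>x. cutoff R 1 x * Q x)"

lemma cutoff_Q_cont: "continuous_on closed_slab (\<lambda>x. cutoff R d x * Q x)"
  by (intro continuous_intros cutoff_cont Q_cont)

lemma disk_energy_eq:
  assumes "0 \<le> R" "R + 1 \<le> M"
  shows "disk_energy R = integral (cyl_box M) (\<lambda>x. cutoff R 1 x * Q x)"
  unfolding disk_energy_def
  using assms by (intro integral_cyl_box_extend[symmetric]) (auto intro!: cutoff_outside radius_sq_ge_of_coord)

lemma disk_energy_nonneg: "0 \<le> R \<Longrightarrow> 0 \<le> disk_energy R"
  unfolding disk_energy_def
  by (intro integral_nonneg integrable_cyl_box cutoff_Q_cont mult_nonneg_nonneg cutoff_bounds) auto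

lemma disk_energy_mono:
  assumes "0 \<le> R" "R + 1 \<le> R'"
  shows "disk_energy R \<le> disk_energy R'"
proof -
  have "disk_energy R = integral (cyl_box (R' + 1)) (\<lambda>x. cutoff R 1 x * Q x)"
    by (rule disk_energy_eq) (use assms in auto)
  also have "\<dots> \<le> disk_energy R'"
    unfolding disk_energy_def
  proof (intro integral_cyl_box_mono cutoff_Q_cont mult_right_mono)
    fix x
    have le: "(R + 1)\<^sup>2 \<le> R'\<^sup>2" using assms by (intro power_mono) auto
    show "cutoff R 1 x \<le> cutoff R' 1 x"
    proof (cases "(R + 1)\<^sup>2 \<le> radius_sq x")
      case True
      then show ?thesis using cutoff_outside(1)[of R 1 x] cutoff_bounds(1)[of R' 1 x] assms by simp
    next
      case False
      then show ?thesis using cutoff_inside(1)[of R' 1 x] cutoff_bounds(2)[of R 1 x] assms le by simp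
    qed
  qed auto
  finally show ?thesis .
qed

lemma window_energy_eq:
  assumes "1 \<le> R"
  shows "window_energy R = disk_energy (R + 1) - disk_energy (R - 1)"
proof -
  have "window_energy R = integral (cyl_box (R + 2)) (\<lambda>x. cutoff (R + 1) 1 x * Q x - cutoff (R - 1) 1 x * Q x)"
    by (simp add: window_energy_def window_def left_diff_distrib)
  also have "\<dots> = integral (cyl_box (R + 2)) (\<lambda>x. cutoff (R + 1) 1 x * Q x) - integral (cyl_box (R + 2)) (\<lambda>x. cutoff (R - 1) 1 x * Q x)"
    by (intro integral_diff integrable_cyl_box cutoff_Q_cont)
  also have "\<dots> = disk_energy (R + 1) - disk_energy (R - 1)"
    using assms by (simp add: disk_energy_eq[of "R + 1" "R + 2"] disk_energy_eq[of "R - 1" "R + 2"])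
  finally show ?thesis .
qed

text \<open>This is \<open>|\<nabla>\<phi>|\<close> for the cutoff of unit width.\<close>

definition flux_weight where "flux_weight R x = sqrt ((cutoff_slope R 1 x)\<^sup>2 * radius_sq x)"

lemma flux_weight_sq: "(flux_weight R x)\<^sup>2 = (cutoff_slope R 1 x)\<^sup>2 * radius_sq x"
  and flux_weight_nonneg: "0 \<le> flux_weight R x"
  by (auto simp: flux_weight_def)

text \<open>
  The two viscous fluxes are quadratic and are bounded with the constant weight \<open>window\<close>. The two
  remaining ones are cubic; there the square root of the energy is split off with a free parameter \<open>l\<close>, and
  the weight \<open>|\<nabla>\<phi>|\<close> is kept because it lives exactly on the annulus \<open>R \<le> r \<le> R + 1\<close>, where the
  vertical average of \<open>|u|\<^sup>2\<close> is known to be small.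
\<close>

lemma flux_bound:
  assumes R: "1 \<le> R" and l: "0 < l" and x: "x \<in> closed_slab"
  shows "flux R 1 x \<le> window R x * (Q x / 4 + 6144 * V x + 3686400 * slice V x) +
     flux_weight R x * (2 * l * V x + slice Q x * V x / l + slice V x * Q x / l)" (is "_ \<le> ?rhs")
proof -
  have R0: "0 \<le> R" "(0::real) < 1" using R by auto
  let ?z = "flux_weight R x" and ?H = "slice V x" and ?D = "slice Q x"
  have nn: "0 \<le> window R x * (Q x / 4 + 6144 * V x + 3686400 * ?H)"
     "0 \<le> ?z * (2 * l * V x + ?D * V x / l + ?H * Q x / l)"
    using window_bounds(1)[OF R] flux_weight_nonneg l by (auto intro!: mult_nonneg_nonneg add_nonneg_nonneg divide_nonneg_pos)
  show ?thesis
  proof (cases "R\<^sup>2 \<le> radius_sq x \<and> radius_sq x \<le> (R + 1)\<^sup>2")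
    case False
    then have "cutoff_slope R 1 x = 0" "cutoff_curv R 1 x = 0"
      using cutoff_inside[OF R0] cutoff_outside[OF R0] by (meson linear)+
    then have "flux R 1 x = 0"
      by (rule flux_eq_0)
    then show ?thesis using nn by simp
  next
    case True
    then have win: "window R x = 1" using window_bounds(3)[OF R] by simp
    have f: "cutoff R 1 x \<le> 1" by (rule cutoff_bounds[OF R0])
    have P: "?z\<^sup>2 \<le> 1024" using cutoff_slope_bound[OF R0, of x] f by (simp add: flux_weight_sq)
    have curv: "(cutoff_curv R 1 x)\<^sup>2 * (radius_sq x)\<^sup>2 \<le> 921600" using cutoff_curv_bound[OF R0, of x] f by simp
    have "(flux_visc R 1 x)\<^sup>2 \<le> ?z\<^sup>2 * V x * Q x"
      using flux_visc_sq by (simp add: flux_weight_sq)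
    also have "\<dots> \<le> 1024 * V x * Q x" using P by (intro mult_mono) auto
    finally have "(flux_visc R 1 x)\<^sup>2 \<le> Q x * (1024 * V x)" by (simp add: mult_ac)
    then have 1: "\<bar>flux_visc R 1 x\<bar> \<le> Q x / 8 + 2 * (1024 * V x)" by (rule young_of_square) auto
    have "(flux_shear R 1 x)\<^sup>2 \<le> Q x * (2 * ((cutoff_curv R 1 x)\<^sup>2 * (radius_sq x)\<^sup>2 * ?H) + 2 * (?z\<^sup>2 * V x))"
      using flux_shear_sq[OF x] by (simp add: flux_weight_sq)
    also have "\<dots> \<le> Q x * (2 * (921600 * ?H) + 2 * (1024 * V x))"
      using P curv by (intro mult_left_mono add_mono mult_right_mono) auto
    finally have 2: "\<bar>flux_shear R 1 x\<bar> \<le> Q x / 8 + 2 * (2 * (921600 * ?H) + 2 * (1024 * V x))"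
      by (rule young_of_square) auto
    have am_gm: "a * b \<le> (l * a + b / l)\<^sup>2" if "0 \<le> a" "0 \<le> b" for a b :: real
    proof -
      have "0 \<le> (l * a)\<^sup>2 + (b / l)\<^sup>2 + a * b" using that by simp
      then show ?thesis using l by (simp add: power2_sum)
    qed
    have "(flux_conv R 1 x)\<^sup>2 \<le> ?z\<^sup>2 * (V x * (?H * Q x))"
      using flux_conv_sq[OF x] by (simp add: flux_weight_sq mult_ac)
    also have "\<dots> \<le> ?z\<^sup>2 * (l * V x + (?H * Q x) / l)\<^sup>2"
      by (intro mult_left_mono am_gm) auto
    also have "\<dots> = (?z * (l * V x + ?H * Q x / l))\<^sup>2" by (simp add: power_mult_distrib)
    finally have "\<bar>flux_conv R 1 x\<bar>\<^sup>2 \<le> (?z * (l * V x + ?H * Q x / l))\<^sup>2" by simp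
    then have 3: "\<bar>flux_conv R 1 x\<bar> \<le> ?z * (l * V x + ?H * Q x / l)"
      by (rule power2_le_imp_le) (use l flux_weight_nonneg in \<open>auto intro!: mult_nonneg_nonneg add_nonneg_nonneg divide_nonneg_pos\<close>)
    have "(flux_kin R 1 x)\<^sup>2 \<le> ?z\<^sup>2 * V x ^ 3 / 4"
      using flux_kin_sq by (simp add: flux_weight_sq)
    also have "\<dots> \<le> ?z\<^sup>2 * (V x * (?D * V x))"
    proof -
      have "V x ^ 3 = V x * (V x * V x)" by (simp add: power3_eq_cube)
      also have "\<dots> \<le> V x * (?D * V x)"
        by (intro mult_left_mono mult_right_mono V_le_slice_Q x) auto
      finally have le: "V x ^ 3 \<le> V x * (?D * V x)" .
      have "V x ^ 3 / 4 \<le> V x ^ 3" by simp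
      with le have "V x ^ 3 / 4 \<le> V x * (?D * V x)" by linarith
      then have "?z\<^sup>2 * (V x ^ 3 / 4) \<le> ?z\<^sup>2 * (V x * (?D * V x))" by (rule mult_left_mono) simp
      then show ?thesis by simp
    qed
    also have "\<dots> \<le> ?z\<^sup>2 * (l * V x + (?D * V x) / l)\<^sup>2"
      by (intro mult_left_mono am_gm) auto
    also have "\<dots> = (?z * (l * V x + ?D * V x / l))\<^sup>2" by (simp add: power_mult_distrib)
    finally have "\<bar>flux_kin R 1 x\<bar>\<^sup>2 \<le> (?z * (l * V x + ?D * V x / l))\<^sup>2" by simp
    then have 4: "\<bar>flux_kin R 1 x\<bar> \<le> ?z * (l * V x + ?D * V x / l)"
      by (rule power2_le_imp_le) (use l flux_weight_nonneg in \<open>auto intro!: mult_nonneg_nonneg add_nonneg_nonneg divide_nonneg_pos\<close>)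
    have "flux R 1 x \<le> \<bar>flux_visc R 1 x\<bar> + \<bar>flux_shear R 1 x\<bar> + \<bar>flux_conv R 1 x\<bar> + \<bar>flux_kin R 1 x\<bar>"
      unfolding flux_def by linarith
    also have "\<dots> \<le> (Q x / 8 + 2 * (1024 * V x)) + (Q x / 8 + 2 * (2 * (921600 * ?H) + 2 * (1024 * V x))) +
        ?z * (l * V x + ?H * Q x / l) + ?z * (l * V x + ?D * V x / l)"
      by (intro add_mono 1 2 3 4)
    also have "\<dots> = ?rhs" by (simp add: win algebra_simps)
    finally show ?thesis .
  qed
qed


lemma flux_weight_cont: "continuous_on closed_slab (flux_weight R)"
  unfolding flux_weight_def[abs_def] radius_sq_def
  by (intro continuous_intros has_gradD(1)[OF cutoff_slope_grad])

lemma flux_weight_le_window: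
  assumes R: "1 \<le> R"
  shows "flux_weight R x * slice V x \<le> 96 * window_energy R / R * window R x"
proof (cases "R\<^sup>2 \<le> radius_sq x \<and> radius_sq x \<le> (R + 1)\<^sup>2")
  case True
  have win: "window R x = 1" using window_bounds(3)[OF R] True by simp
  have "(flux_weight R x)\<^sup>2 \<le> 1024 * cutoff R 1 x"
    using cutoff_slope_bound[of R 1 x] R by (simp add: flux_weight_sq)
  also have "\<dots> \<le> 32\<^sup>2" using cutoff_bounds(2)[of R 1 x] R by simp
  finally have "flux_weight R x \<le> 32" by (rule power2_le_imp_le) simp
  moreover have "slice V x \<le> 3 * window_energy R / R"
    using slice_V_le_window_energy[OF R] True R by (simp add: field_simps)
  ultimately have "flux_weight R x * slice V x \<le> 32 * (3 * window_energy R / R)"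
    by (intro mult_mono) auto
  then show ?thesis by (simp add: win)
next
  case False
  have R0: "0 \<le> R" "(0::real) < 1" using R by auto
  have "cutoff_slope R 1 x = 0"
    using False cutoff_inside[OF R0] cutoff_outside[OF R0] by (meson linear)
  then have z: "flux_weight R x = 0" by (simp add: flux_weight_def)
  have "0 \<le> window_energy R"
    unfolding window_energy_def
    by (intro integral_nonneg integrable_cyl_box continuous_intros window_cont Q_cont mult_nonneg_nonneg window_bounds(1)[OF R]) auto
  then show ?thesis using window_bounds(1)[OF R] R by (simp add: z)
qed

text \<open>
  Integrate \<open>flux_bound\<close>. All weights are independent of the height, so \<open>V\<close> and \<open>Q\<close> may be replaced by
  their vertical averages; in each cubic term one average of \<open>V\<close> can then be estimated by \<open>3 e / R\<close>, and the
  area \<open>36 R\<close> and the energy \<open>e\<close> remain as factors of \<open>l\<close> and \<open>1 / l\<close>.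
\<close>

lemma disk_energy_growth:
  assumes R: "1 \<le> R" and l: "0 < l"
  defines "e \<equiv> window_energy R"
  shows "disk_energy R \<le> 4000000 * (e + l * e + e\<^sup>2 / (R * l))"
proof -
  let ?I = "integral (cyl_box (R + 2))"
  let ?H = "slice V" and ?D = "slice Q" and ?z = "flux_weight R" and ?w = "window R"
  note conts = continuous_intros V_cont Q_cont slice_cont window_cont flux_weight_cont
  have w0: "0 \<le> ?w x" for x by (rule window_bounds[OF R])
  have indep: "?w x = ?w y" "?z x = ?z y" "?H x = ?H y" "?D x = ?D y" if "x $ 1 = y $ 1" "x $ 2 = y $ 2" for x y
    using that cutoff_indep_height[of x y] window_indep[of x y] by (simp_all add: flux_weight_def slice_def radius_sq_def)
  have eD: "?I (\<lambda>x. ?w x * ?D x) = e"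
    unfolding e_def window_energy_def by (rule integral_weight_slice[symmetric]) (intro conts indep; assumption)+
  have e0: "0 \<le> e"
    unfolding e_def window_energy_def
    by (intro integral_nonneg integrable_cyl_box conts mult_nonneg_nonneg w0) auto
  have eH: "?I (\<lambda>x. ?w x * ?H x) \<le> e"
    unfolding eD[symmetric] by (intro integral_cyl_box_mono conts mult_left_mono slice_V_le_slice_Q w0)
  have eV: "?I (\<lambda>x. ?w x * V x) \<le> e"
  proof -
    have "?I (\<lambda>x. ?w x * V x) = ?I (\<lambda>x. ?w x * ?H x)"
      by (rule integral_weight_slice) (intro conts indep; assumption)+
    then show ?thesis using eH by simp
  qed
  have eQ: "?I (\<lambda>x. ?w x * Q x) = e" by (simp add: e_def window_energy_def)
  have zV: "?I (\<lambda>x. ?z x * V x) = ?I (\<lambda>x. ?z x * ?H x)"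
    by (rule integral_weight_slice) (intro conts indep; assumption)+
  have zDV: "?I (\<lambda>x. (?z x * ?D x) * V x) = ?I (\<lambda>x. (?z x * ?D x) * ?H x)"
    by (rule integral_weight_slice) (intro conts arg_cong2[where f="(*)"] indep; assumption)+
  have zHQ: "?I (\<lambda>x. (?z x * ?H x) * Q x) = ?I (\<lambda>x. (?z x * ?H x) * ?D x)"
    by (rule integral_weight_slice) (intro conts arg_cong2[where f="(*)"] indep; assumption)+
  define c where "c = 96 * e / R"
  have c0: "0 \<le> c" using e0 R by (simp add: c_def)
  have zH: "?z x * ?H x \<le> c * ?w x" for x
    using flux_weight_le_window[OF R, of x] by (simp add: c_def e_def)
  have a1: "?I (\<lambda>x. ?z x * ?H x) \<le> c * (36 * R)"
  proof -
    have "?I (\<lambda>x. ?z x * ?H x) \<le> ?I (\<lambda>x. c * ?w x)"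
      by (intro integral_cyl_box_mono conts zH)
    also have "\<dots> = c * ?I ?w" by simp
    also have "\<dots> \<le> c * (36 * R)" by (intro mult_left_mono window_area R c0)
    finally show ?thesis .
  qed
  have a2: "?I (\<lambda>x. (?z x * ?H x) * ?D x) \<le> c * e"
  proof -
    have "?I (\<lambda>x. (?z x * ?H x) * ?D x) \<le> ?I (\<lambda>x. c * (?w x * ?D x))"
    proof (intro integral_cyl_box_mono conts)
      show "?z x * ?H x * ?D x \<le> c * (?w x * ?D x)" for x
        using mult_right_mono[OF zH[of x] slice_Q_nonneg[of x]] by (simp add: mult_ac)
    qed
    also have "\<dots> = c * e" using eD by simp
    finally show ?thesis .
  qed
  have "disk_energy R = ?I (\<lambda>x. cutoff R 1 x * Q x)"
    by (rule disk_energy_eq) (use R in auto)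
  also have "\<dots> = ?I (flux R 1)"
    by (rule energy_balance) (use R in auto)
  also have "\<dots> \<le> ?I (\<lambda>x. (1 / 4 * (?w x * Q x) + 6144 * (?w x * V x) + 3686400 * (?w x * ?H x)) +
     (2 * l * (?z x * V x) + 1 / l * (?z x * ?D x * V x) + 1 / l * (?z x * ?H x * Q x)))"
  proof (intro integral_cyl_box_mono conts flux_cont)
    fix x assume "x \<in> closed_slab"
    from flux_bound[OF R l this]
    show "flux R 1 x \<le> (1 / 4 * (?w x * Q x) + 6144 * (?w x * V x) + 3686400 * (?w x * ?H x)) +
     (2 * l * (?z x * V x) + 1 / l * (?z x * ?D x * V x) + 1 / l * (?z x * ?H x * Q x))"
      by (simp add: algebra_simps)
  qed
  also have "\<dots> = (1 / 4 * ?I (\<lambda>x. ?w x * Q x) + 6144 * ?I (\<lambda>x. ?w x * V x) + 3686400 * ?I (\<lambda>x. ?w x * ?H x)) +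
     (2 * l * ?I (\<lambda>x. ?z x * V x) + 1 / l * ?I (\<lambda>x. ?z x * ?D x * V x) + 1 / l * ?I (\<lambda>x. ?z x * ?H x * Q x))"
    unfolding integral_mult_right[symmetric]
    by ((subst integral_add; (intro integrable_cyl_box conts)?), (subst integral_add; (intro integrable_cyl_box conts)?)+)?
       simp
  also have "\<dots> \<le> (1 / 4 * e + 6144 * e + 3686400 * e) + (2 * l * (c * (36 * R)) + 1 / l * (c * e) + 1 / l * (c * e))"
  proof (intro add_mono mult_left_mono)
    show "?I (\<lambda>x. ?z x * ?D x * V x) \<le> c * e" using zDV a2 by (simp add: mult_ac)
  qed (use eQ eV eH zV zHQ a1 a2 l in auto)
  also have "\<dots> \<le> 4000000 * (e + l * e + e\<^sup>2 / (R * l))"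
  proof -
    have "2 * l * (c * (36 * R)) = 6912 * (l * e)" using R by (simp add: c_def)
    moreover have "1 / l * (c * e) = 96 * (e\<^sup>2 / (R * l))" using R l by (simp add: c_def power2_eq_square field_simps)
    moreover have "0 \<le> l * e" "0 \<le> e\<^sup>2 / (R * l)" using e0 l R by auto
    moreover have "1 / 4 * e + 6144 * e + 3686400 * e + (X + Y + Y) \<le> 4000000 * (e + p + q)"
      if "X = 6912 * p" "Y = 96 * q" "0 \<le> p" "0 \<le> q" for X Y p q :: real
      using that e0 by simp
    ultimately show ?thesis by blast
  qed
  finally show ?thesis .
qed

text \<open>
  If the energy vanished on every disc, the pointwise Poincare inequality would force \<open>u = 0\<close>. Once it
  is positive, \<open>quartic_growth\<close> applies to the radii \<open>2 k\<close>: a window around \<open>2 k + 1\<close> compares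
  the radii \<open>2 k\<close> and \<open>2 k + 2\<close>.
\<close>

lemma disk_energy_quartic:
  assumes x: "x \<in> closed_slab" "V x \<noteq> 0"
  obtains \<delta> where "0 < \<delta>" "\<forall>\<^sub>F R in at_top. \<delta> * R ^ 4 \<le> disk_energy R"
proof -
  define k0 where "k0 = nat \<lceil>\<bar>x $ 1\<bar> + \<bar>x $ 2\<bar>\<rceil>"
  let ?b = "\<lambda>k::nat. disk_energy (2 * real k)"
  have k0: "\<bar>x $ 1\<bar> + \<bar>x $ 2\<bar> \<le> real k0" by (simp add: k0_def)
  have "?b k0 \<noteq> 0"
  proof
    let ?M = "2 * real k0 + 1"
    let ?f = "\<lambda>y. cutoff (2 * real k0) 1 y * Q y"
    assume "?b k0 = 0"
    then have "(?f has_integral 0) (cyl_box ?M)"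
      using integrable_integral[OF integrable_cyl_box[OF cutoff_Q_cont]] by (metis disk_energy_def)
    then have hi: "(?f has_integral 0) (cbox (pt (-?M) (-?M) 0) (pt ?M ?M 1))" by (simp add: cyl_box_def)
    have "Q (pt (x $ 1) (x $ 2) s) = 0" if s: "0 \<le> s" "s \<le> 1" for s
    proof -
      have "?f (pt (x $ 1) (x $ 2) s) = 0"
      proof (rule has_integral_0_cbox_imp_0[OF _ _ hi])
        show "continuous_on (cbox (pt (-?M) (-?M) 0) (pt ?M ?M 1)) ?f"
          by (rule continuous_on_subset[OF cutoff_Q_cont cyl_box_sub[unfolded cyl_box_def]])
        show "0 \<le> ?f y" for y by (intro mult_nonneg_nonneg cutoff_bounds) auto
        show "box (pt (-?M) (-?M) 0) (pt ?M ?M 1) \<noteq> {}"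
          by (simp add: interval_ne_empty_cart forall_3)
        show "pt (x $ 1) (x $ 2) s \<in> cbox (pt (-?M) (-?M) 0) (pt ?M ?M 1)"
          using s k0 by (auto simp: mem_cbox_pt abs_le_iff)
      qed
      moreover have "cutoff (2 * real k0) 1 (pt (x $ 1) (x $ 2) s) = 1"
      proof (rule cutoff_inside)
        have "(x $ 1)\<^sup>2 + (x $ 2)\<^sup>2 \<le> (\<bar>x $ 1\<bar> + \<bar>x $ 2\<bar>)\<^sup>2" by (simp add: power2_sum)
        also have "\<dots> \<le> (2 * real k0)\<^sup>2" using k0 by (intro power_mono) auto
        finally show "radius_sq (pt (x $ 1) (x $ 2) s) \<le> (2 * real k0)\<^sup>2" by simp
      qed auto
      ultimately show ?thesis by simp
    qed
    then have "slice Q x \<le> 0" by (intro slice_le_const Q_cont) auto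
    then show False using V_le_slice_Q[OF x(1)] V_nonneg[of x] x(2) by linarith
  qed
  then have pos: "0 < ?b k0" using disk_energy_nonneg[of "2 * real k0"] by simp
  obtain \<delta> N where \<delta>: "0 < \<delta>" "\<And>k. N \<le> k \<Longrightarrow> \<delta> * real k ^ 4 \<le> ?b k"
  proof (rule quartic_growth[of 4000000 ?b k0])
    show "?b k \<le> ?b (Suc k)" for k by (rule disk_energy_mono) auto
    fix k :: nat and \<mu> :: real assume k: "1 \<le> k" and m: "0 < \<mu>"
    let ?R = "2 * real k + 1" and ?e = "?b (Suc k) - ?b k"
    have e: "window_energy ?R = ?e" by (subst window_energy_eq) (auto simp: algebra_simps)
    have "?b k \<le> disk_energy ?R" by (rule disk_energy_mono) auto
    also have "\<dots> \<le> 4000000 * (?e + \<mu> * ?e + ?e\<^sup>2 / (?R * \<mu>))"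
      using disk_energy_growth[of ?R \<mu>] m by (simp add: e)
    also have "\<dots> \<le> 4000000 * (?e + \<mu> * ?e + ?e\<^sup>2 / (real k * \<mu>))"
      using k m by (intro mult_left_mono add_left_mono divide_left_mono mult_right_mono) auto
    finally show "?b k \<le> 4000000 * (?e + \<mu> * ?e + ?e\<^sup>2 / (real k * \<mu>))" .
  qed (use pos in auto)
  have "\<forall>\<^sub>F R in at_top. \<delta> / 4096 * R ^ 4 \<le> disk_energy R"
    using eventually_ge_at_top[of "2 * real N + 5"]
  proof eventually_elim
    case (elim R)
    define t where "t = (R - 1) / 2"
    define k where "k = nat \<lfloor>t\<rfloor>"
    have R: "R = 2 * t + 1" by (simp add: t_def field_simps)
    then have "real k = of_int \<lfloor>t\<rfloor>" using elim by (simp add: k_def)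
    then have "real k \<le> t" "t \<le> real k + 1" by linarith+
    then have k: "2 * real k + 1 \<le> R" "R \<le> 2 * real k + 3" unfolding R by linarith+
    have "N \<le> k" using k elim by linarith
    have "R \<le> 8 * real k" using k elim by linarith
    then have "R ^ 4 \<le> (8 * real k) ^ 4" using elim by (intro power_mono) auto
    then have "\<delta> / 4096 * R ^ 4 \<le> \<delta> / 4096 * (8 * real k) ^ 4" using \<delta> by (intro mult_left_mono) auto
    also have "\<dots> = \<delta> * real k ^ 4" by (simp add: power_mult_distrib)
    also have "\<dots> \<le> ?b k" by (rule \<delta>(2)[OF \<open>N \<le> k\<close>])
    also have "\<dots> \<le> disk_energy R" by (rule disk_energy_mono) (use k in auto)
    finally show ?case .
  qed
  then show ?thesis using that[of "\<delta> / 4096"] \<delta> by simp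
qed

text \<open>
  For large \<open>R\<close> the speed is at most \<open>m = 2 \<epsilon> R\<close> on \<open>r \<le> 2 R\<close>: outside a fixed radius by hypothesis, inside by
  compactness. With this \<open>m\<close> every term of the Caccioppoli inequality is at most a multiple
  of \<open>\<epsilon>\<^sup>2 R\<^sup>4\<close>.
\<close>

lemma disk_energy_small_of_sublinear:
  assumes sub: "\<And>\<epsilon>. 0 < \<epsilon> \<Longrightarrow> \<exists>R0. \<forall>x\<in>closed_slab. R0\<^sup>2 \<le> radius_sq x \<longrightarrow> V x \<le> \<epsilon>\<^sup>2 * radius_sq x"
    and eps: "0 < \<epsilon>" "\<epsilon> \<le> 1"
  shows "\<forall>\<^sub>F R in at_top. disk_energy (R - 1) \<le> 5600000000 * \<epsilon>\<^sup>2 * R ^ 4"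
proof -
  obtain R0 where R0: "\<And>x. x \<in> closed_slab \<Longrightarrow> R0\<^sup>2 \<le> radius_sq x \<Longrightarrow> V x \<le> \<epsilon>\<^sup>2 * radius_sq x"
    using sub[OF eps(1)] by blast
  let ?B = "cyl_box \<bar>R0\<bar>"
  have "compact (V ` ?B)"
    using continuous_on_subset[OF V_cont cyl_box_sub] by (intro compact_continuous_image) (auto simp: cyl_box_def)
  then obtain m0 where m0: "\<And>x. x \<in> ?B \<Longrightarrow> V x \<le> m0"
    by (metis bdd_above.unfold bounded_imp_bdd_above compact_imp_bounded image_eqI)
  show ?thesis
    using eventually_ge_at_top[of "max 2 (\<bar>m0\<bar> / \<epsilon>\<^sup>2)"]
  proof eventually_elim
    case (elim R)
    have R: "2 \<le> R" "\<bar>m0\<bar> / \<epsilon>\<^sup>2 \<le> R" using elim by auto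
    define m where "m = 2 * \<epsilon> * R"
    have m: "0 \<le> m" using R eps by (simp add: m_def)
    have cac: "integral (cyl_box (2 * R)) (\<lambda>x. cutoff R R x * Q x) \<le>
       200000000 * R\<^sup>2 * (m\<^sup>2 / R\<^sup>2 + m ^ 3 / R + m ^ 4 / R\<^sup>2)"
    proof (rule caccioppoli)
      fix x assume x: "x \<in> closed_slab" "radius_sq x \<le> (2 * R)\<^sup>2"
      show "V x \<le> m\<^sup>2"
      proof (cases "R0\<^sup>2 \<le> radius_sq x")
        case True
        have "V x \<le> \<epsilon>\<^sup>2 * radius_sq x" by (rule R0[OF x(1) True])
        also have "\<dots> \<le> \<epsilon>\<^sup>2 * (2 * R)\<^sup>2" using x by (intro mult_left_mono) auto
        finally show ?thesis by (simp add: m_def power_mult_distrib mult_ac)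
      next
        case False
        have "(x $ 1)\<^sup>2 \<le> R0\<^sup>2" "(x $ 2)\<^sup>2 \<le> R0\<^sup>2"
          using False zero_le_power2[of "x $ 1"] zero_le_power2[of "x $ 2"] unfolding radius_sq_def by linarith+
        then have "\<bar>x $ 1\<bar> \<le> \<bar>R0\<bar>" "\<bar>x $ 2\<bar> \<le> \<bar>R0\<bar>" by (simp_all add: abs_le_square_iff)
        then have "x \<in> ?B" using x(1) by (auto simp: cyl_box_def mem_cbox_pt closed_slab_def abs_le_iff)
        then have "V x \<le> \<bar>m0\<bar>" using m0 by (meson abs_ge_self order_trans)
        also have "\<dots> \<le> \<epsilon>\<^sup>2 * R" using R eps by (simp add: field_simps)
        also have "\<dots> \<le> \<epsilon>\<^sup>2 * (4 * R\<^sup>2)"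
          using R by (intro mult_left_mono) (auto simp: power2_eq_square)
        finally show ?thesis by (simp add: m_def power_mult_distrib)
      qed
    qed (use R m in auto)
    have "disk_energy (R - 1) = integral (cyl_box (2 * R)) (\<lambda>x. cutoff (R - 1) 1 x * Q x)"
      by (rule disk_energy_eq) (use R in auto)
    also have "\<dots> \<le> integral (cyl_box (2 * R)) (\<lambda>x. cutoff R R x * Q x)"
    proof (intro integral_cyl_box_mono cutoff_Q_cont mult_right_mono)
      show "cutoff (R - 1) 1 x \<le> cutoff R R x" for x
        using cutoff_outside(1)[of "R - 1" 1 x] cutoff_inside(1)[of R R x]
          cutoff_bounds(1)[of R R x] cutoff_bounds(2)[of "R - 1" 1 x] R
        by (cases "R\<^sup>2 \<le> radius_sq x") auto
    qed auto
    also note cac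
    also have "200000000 * R\<^sup>2 * (m\<^sup>2 / R\<^sup>2 + m ^ 3 / R + m ^ 4 / R\<^sup>2) =
        200000000 * (4 * (\<epsilon>\<^sup>2 * R\<^sup>2) + 8 * (\<epsilon> ^ 3 * R ^ 4) + 16 * (\<epsilon> ^ 4 * R ^ 4))"
      using R by (simp add: m_def field_simps power2_eq_square power3_eq_cube power4_eq_xxxx)
    also have "\<dots> \<le> 200000000 * (4 * (\<epsilon>\<^sup>2 * R ^ 4) + 8 * (\<epsilon>\<^sup>2 * R ^ 4) + 16 * (\<epsilon>\<^sup>2 * R ^ 4))"
      using R eps by (intro mult_left_mono add_mono mult_right_mono power_increasing power_decreasing) auto
    finally show ?case by simp
  qed
qed

lemma flow_trivial:
  assumes "\<not> (\<exists>\<delta>>0. \<forall>\<^sub>F R in at_top. \<delta> * R ^ 4 \<le> disk_energy R) \<or>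
    (\<forall>\<epsilon>>0. \<exists>R0. \<forall>x\<in>closed_slab. R0\<^sup>2 \<le> radius_sq x \<longrightarrow> V x \<le> \<epsilon>\<^sup>2 * radius_sq x)"
    and x: "x \<in> closed_slab"
  shows "V x = 0"
proof (rule ccontr)
  assume "V x \<noteq> 0"
  then obtain \<delta> where d: "0 < \<delta>" "\<forall>\<^sub>F R in at_top. \<delta> * R ^ 4 \<le> disk_energy R"
    using disk_energy_quartic[OF x] by blast
  then have sub: "\<forall>\<epsilon>>0. \<exists>R0. \<forall>x\<in>closed_slab. R0\<^sup>2 \<le> radius_sq x \<longrightarrow> V x \<le> \<epsilon>\<^sup>2 * radius_sq x"
    using assms by blast
  \<comment> \<open>so small that the upper bound \<open>5600000000 \<epsilon>\<^sup>2 R\<^sup>4\<close> lies below \<open>\<delta> (R / 2)\<^sup>4\<close>\<close>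
  define \<epsilon> where "\<epsilon> = min 1 (sqrt (\<delta> / 200000000000))"
  have e: "0 < \<epsilon>" "\<epsilon> \<le> 1" using d by (auto simp: \<epsilon>_def)
  have "\<epsilon>\<^sup>2 \<le> (sqrt (\<delta> / 200000000000))\<^sup>2" using e by (intro power_mono) (auto simp: \<epsilon>_def)
  then have e2: "5600000000 * \<epsilon>\<^sup>2 < \<delta> / 16" using d by simp
  have "\<forall>\<^sub>F R in at_top. \<delta> * (R - 1) ^ 4 \<le> disk_energy (R - 1)"
    by (rule eventually_at_top_minus_one[OF d(2)])
  moreover have "\<forall>\<^sub>F R in at_top. disk_energy (R - 1) \<le> 5600000000 * \<epsilon>\<^sup>2 * R ^ 4"
    by (rule disk_energy_small_of_sublinear) (use sub e in auto)
  ultimately have "\<forall>\<^sub>F R::real in at_top. False"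
    using eventually_ge_at_top[of 2]
  proof eventually_elim
    case (elim R)
    have "(R / 2) ^ 4 \<le> (R - 1) ^ 4" using elim by (intro power_mono) auto
    then have "\<delta> / 16 * R ^ 4 \<le> \<delta> * (R - 1) ^ 4" using d by (simp add: power_divide)
    also have "\<dots> \<le> 5600000000 * \<epsilon>\<^sup>2 * R ^ 4" using elim by linarith
    also have "\<dots> < \<delta> / 16 * R ^ 4" using e2 elim by (intro mult_strict_right_mono) auto
    finally show False by simp
  qed
  then show False by simp
qed

end

section \<open>From smooth vector fields to flows\<close>

text \<open>The derivative relative to the closed slab, in contrast to \<open>partial\<close>, is meaningful on the walls too.\<close>

definition slab_partial :: "3 \<Rightarrow> (real ^ 3 \<Rightarrow> 'b::real_normed_vector) \<Rightarrow> real ^ 3 \<Rightarrow> 'b" where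
  "slab_partial i f x = frechet_derivative f (at x within closed_slab) (axis i 1)"

lemma curve_derivative:
  fixes f :: "real ^ 3 \<Rightarrow> 'b::real_normed_vector"
  assumes f: "f differentiable_on closed_slab" and L: "bounded_linear L"
    and g: "(g has_vector_derivative v) (at t within T)" "g ` T \<subseteq> closed_slab" "t \<in> T"
  shows "((\<lambda>s. L (f (g s))) has_real_derivative
    L (\<Sum>i\<in>UNIV. (v $ i) *\<^sub>R slab_partial i f (g t))) (at t within T)"
proof -
  let ?f' = "frechet_derivative f (at (g t) within closed_slab)"
  have "(f has_derivative ?f') (at (g t) within closed_slab)"
    using f g by (auto simp: differentiable_on_def frechet_derivative_works)
  then have lin: "linear ?f'" and f': "(f has_derivative ?f') (at (g t) within g ` T)"
    using g(2) by (auto intro: has_derivative_linear has_derivative_subset)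
  have "((\<lambda>s. f (g s)) has_derivative (\<lambda>h. ?f' (h *\<^sub>R v))) (at t within T)"
    using has_derivative_in_compose[OF g(1)[unfolded has_vector_derivative_def] f'] .
  then have d: "((\<lambda>s. L (f (g s))) has_derivative (\<lambda>h. L (?f' (h *\<^sub>R v)))) (at t within T)"
    by (rule bounded_linear.has_derivative[OF L])
  have "?f' v = ?f' (\<Sum>i\<in>UNIV. (v $ i) *\<^sub>R axis i 1)"
    by (rule arg_cong[where f="?f'"]) (simp add: vec_eq_iff axis_def if_distrib cong: if_cong)
  also have "\<dots> = (\<Sum>i\<in>UNIV. (v $ i) *\<^sub>R slab_partial i f (g t))"
    by (simp add: linear_sum[OF lin] linear_cmul[OF lin] slab_partial_def)
  finally have v: "?f' v = (\<Sum>i\<in>UNIV. (v $ i) *\<^sub>R slab_partial i f (g t))" .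
  interpret L: bounded_linear L by (rule L)
  show ?thesis
    by (rule has_derivative_imp_has_field_derivative[OF d])
       (simp add: linear_cmul[OF lin] L.scaleR v)
qed

lemma has_grad_of_Ck_on:
  fixes f :: "real ^ 3 \<Rightarrow> 'b::real_normed_vector"
  assumes f: "Ck_on (Suc (Suc k)) f closed_slab" and L: "bounded_linear L"
  shows "has_grad (\<lambda>x. L (f x)) (\<lambda>i x. L (slab_partial i f x))"
proof -
  have diff: "f differentiable_on closed_slab" using f by simp
  have cont: "continuous_on closed_slab (slab_partial i f)" for i
    using f by (auto simp: slab_partial_def[abs_def] dest!: differentiable_imp_continuous_on)
  interpret L: bounded_linear L by (rule L)
  have line: "pt t b c = pt a b c + (t - a) *\<^sub>R axis 1 1" "pt a t c = pt a b c + (t - b) *\<^sub>R axis 2 1"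
      "pt a b t = pt a b c + (t - c) *\<^sub>R axis 3 1" for a b c t
    by (simp_all add: vec_eq_iff forall_3 axis_def)
  have axis: "(\<Sum>j\<in>UNIV. (axis i 1 $ j) *\<^sub>R slab_partial j f x) = slab_partial i f x" for i x
    by (simp add: axis_def if_distrib[where f="\<lambda>r. r *\<^sub>R _"] cong: if_cong)
  show ?thesis
  proof (intro has_gradI L.continuous_on cont differentiable_imp_continuous_on diff)
    fix a b c :: real assume c: "0 \<le> c" "c \<le> 1"
    have "((\<lambda>t. pt a b c + (t - a) *\<^sub>R axis 1 1) has_vector_derivative axis 1 1) (at a within UNIV)"
      by (auto intro!: derivative_eq_intros)
    then have "((\<lambda>t. pt t b c) has_vector_derivative axis 1 1) (at a within UNIV)"
      by (simp only: line(1)[of _ b c a, symmetric])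
    from curve_derivative[OF diff L this] c
    show "((\<lambda>t. L (f (pt t b c))) has_real_derivative L (slab_partial 1 f (pt a b c))) (at a)"
      by (simp add: image_subset_iff pt_in_closed_slab axis)
    have "((\<lambda>t. pt a b c + (t - b) *\<^sub>R axis 2 1) has_vector_derivative axis 2 1) (at b within UNIV)"
      by (auto intro!: derivative_eq_intros)
    then have "((\<lambda>t. pt a t c) has_vector_derivative axis 2 1) (at b within UNIV)"
      by (simp only: line(2)[of a _ c b, symmetric])
    from curve_derivative[OF diff L this] c
    show "((\<lambda>t. L (f (pt a t c))) has_real_derivative L (slab_partial 2 f (pt a b c))) (at b)"
      by (simp add: image_subset_iff pt_in_closed_slab axis)
    have "((\<lambda>t. pt a b c + (t - c) *\<^sub>R axis 3 1) has_vector_derivative axis 3 1) (at c within {0..1})"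
      by (auto intro!: derivative_eq_intros)
    then have "((\<lambda>t. pt a b t) has_vector_derivative axis 3 1) (at c within {0..1})"
      by (simp only: line(3)[of a b _ c, symmetric])
    from curve_derivative[OF diff L this] c
    show "((\<lambda>t. L (f (pt a b t))) has_real_derivative L (slab_partial 3 f (pt a b c))) (at c within {0..1})"
      by (simp add: image_subset_iff pt_in_closed_slab axis)
  qed
qed

lemma Ck_on_slab_partial:
  "Ck_on (Suc k) f closed_slab \<Longrightarrow> Ck_on k (slab_partial i f) closed_slab"
  by (simp add: slab_partial_def[abs_def])

lemma open_slab: "open slab"
proof -
  have "slab = {x. 0 < x $ 3} \<inter> {x. x $ 3 < 1}" by (auto simp: slab_def)
  moreover have "open ({x. 0 < x $ 3} \<inter> {x. x $ 3 < 1} :: (real ^ 3) set)"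
    by (intro open_Int open_halfspace_component_gt_cart open_halfspace_component_lt_cart)
  ultimately show ?thesis by simp
qed

lemma slab_subset: "slab \<subseteq> closed_slab"
  by (auto simp: slab_def closed_slab_def)

lemma at_within_slab: "x \<in> slab \<Longrightarrow> at x within closed_slab = at x"
  using at_within_interior interior_maximal[OF slab_subset open_slab] by blast

lemma partial_eq_slab_partial: "x \<in> slab \<Longrightarrow> partial i f x = slab_partial i f x"
  by (simp add: partial_def slab_partial_def at_within_slab)

lemma partial_partial_eq:
  assumes x: "x \<in> slab" and f: "slab_partial i f differentiable_on closed_slab"
  shows "partial k (partial i f) x = slab_partial k (slab_partial i f) x"
proof -
  have "(slab_partial i f has_derivative frechet_derivative (slab_partial i f) (at x)) (at x)"
  proof -
    have "slab_partial i f differentiable at x within closed_slab"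
      using f x slab_subset by (auto simp: differentiable_on_def)
    then show ?thesis by (simp only: at_within_slab[OF x] frechet_derivative_works)
  qed
  then have "(partial i f has_derivative frechet_derivative (slab_partial i f) (at x)) (at x)"
    by (rule has_derivative_transform_within_open[OF _ open_slab x]) (simp add: partial_eq_slab_partial)
  then have "frechet_derivative (partial i f) (at x) = frechet_derivative (slab_partial i f) (at x)"
    by (metis frechet_derivative_at)
  then show ?thesis by (simp add: partial_def[of k] slab_partial_def[of k] at_within_slab[OF x])
qed

text \<open>
  The equations are given in the open slab and the rotation identities away from the axis; by continuity
  both extend.
\<close>

lemma zero_on_closed_slab:
  fixes g :: "real ^ 3 \<Rightarrow> real"
  assumes g: "continuous_on closed_slab g" "\<And>x. x \<in> slab \<Longrightarrow> g x = 0" and x: "x \<in> closed_slab"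
  shows "g x = 0"
proof -
  have "g (pt (x $ 1) (x $ 2) (x $ 3)) = 0"
  proof (rule continuous_constant_on_closure[where S="{0<..<1::real}" and x="x $ 3"
        and f="\<lambda>s. g (pt (x $ 1) (x $ 2) s)"])
    show "continuous_on (closure {0<..<1}) (\<lambda>s. g (pt (x $ 1) (x $ 2) s))"
      by (intro continuous_on_slab_pt[OF g(1)] continuous_intros) auto
    show "x $ 3 \<in> closure {0<..<1}" using x by (simp add: closed_slab_def)
  qed (auto intro!: g(2) simp: slab_def)
  then show ?thesis by (simp add: pt_eta)
qed

lemma zero_on_axis:
  fixes g :: "real ^ 3 \<Rightarrow> real"
  assumes g: "continuous_on closed_slab g" "\<And>x. x \<in> closed_slab \<Longrightarrow> 0 < radius_sq x \<Longrightarrow> g x = 0"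
    and x: "x \<in> closed_slab"
  shows "g x = 0"
proof (cases "0 < radius_sq x")
  case False
  then have x0: "x $ 1 = 0" "x $ 2 = 0"
    using radius_sq_nonneg[of x] by (auto simp: radius_sq_def not_less sum_power2_le_zero_iff)
  have c: "x $ 3 \<in> {0..1}" using x by (simp add: closed_slab_def)
  have "g (pt 0 0 (x $ 3)) = 0"
  proof (rule continuous_constant_on_closure[where S="{0::real<..}" and x=0
        and f="\<lambda>t. g (pt t 0 (x $ 3))"])
    show "continuous_on (closure {0::real<..}) (\<lambda>t. g (pt t 0 (x $ 3)))"
      by (intro continuous_on_slab_pt[OF g(1)] continuous_intros c)
    show "g (pt t 0 (x $ 3)) = 0" if "t \<in> {0::real<..}" for t
      using that c by (intro g(2)) (auto simp: pt_in_closed_slab)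
  qed simp
  then show ?thesis using pt_eta[of x] x0 by simp
qed (use assms in auto)

lemma polar_coordinates:
  assumes "0 < radius_sq x"
  obtains \<theta> where "x = cyl (sqrt (radius_sq x)) \<theta> (x $ 3)"
proof -
  let ?r = "sqrt (radius_sq x)"
  have "(x $ 1 / ?r)\<^sup>2 + (x $ 2 / ?r)\<^sup>2 = 1"
    using assms by (simp add: power_divide flip: radius_sq_def add_divide_distrib)
  then obtain t where "x $ 1 / ?r = cos t" "x $ 2 / ?r = sin t"
    by (metis sincos_total_2pi)
  then have "x = cyl ?r t (x $ 3)"
    using assms by (simp add: cyl_def vec_eq_iff forall_3 field_simps)
  then show ?thesis using that by blast
qed

text \<open>The cylindrical components are constant in the angle; rotate the frame back to Cartesian coordinates.\<close>

lemma axisymmetric_components: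
  assumes "axisymmetric u" "0 < r" "z \<in> {0..1}"
  defines "\<alpha> \<equiv> u (cyl r 0 z) $ 1" and "\<beta> \<equiv> u (cyl r 0 z) $ 2"
  shows "u (cyl r \<theta> z) $ 1 = \<alpha> * cos \<theta> - \<beta> * sin \<theta>"
    and "u (cyl r \<theta> z) $ 2 = \<alpha> * sin \<theta> + \<beta> * cos \<theta>"
    and "u (cyl r \<theta> z) $ 3 = u (cyl r 0 z) $ 3"
proof -
  let ?v = "u (cyl r \<theta> z)"
  have eqs: "?v \<bullet> e_r \<theta> = u (cyl r 0 z) \<bullet> e_r 0" "?v \<bullet> e_theta \<theta> = u (cyl r 0 z) \<bullet> e_theta 0"
    "?v \<bullet> e_z = u (cyl r 0 z) \<bullet> e_z"
    using assms(1-3) unfolding axisymmetric_def by blast+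
  have r: "?v $ 1 * cos \<theta> + ?v $ 2 * sin \<theta> = \<alpha>" and t: "?v $ 2 * cos \<theta> - ?v $ 1 * sin \<theta> = \<beta>"
    and z: "?v $ 3 = u (cyl r 0 z) $ 3"
    using eqs by (simp_all add: e_r_def e_theta_def e_z_def inner_vec_def sum_3 \<alpha>_def \<beta>_def)
  have "\<alpha> * cos \<theta> - \<beta> * sin \<theta> = ?v $ 1 * ((cos \<theta>)\<^sup>2 + (sin \<theta>)\<^sup>2)"
    unfolding r[symmetric] t[symmetric] by algebra
  then show "?v $ 1 = \<alpha> * cos \<theta> - \<beta> * sin \<theta>" by simp
  have "\<alpha> * sin \<theta> + \<beta> * cos \<theta> = ?v $ 2 * ((cos \<theta>)\<^sup>2 + (sin \<theta>)\<^sup>2)"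
    unfolding r[symmetric] t[symmetric] by algebra
  then show "?v $ 2 = \<alpha> * sin \<theta> + \<beta> * cos \<theta>" by simp
  show "?v $ 3 = u (cyl r 0 z) $ 3" by (rule z)
qed

lemma axisymmetric_norm:
  assumes u: "axisymmetric u" and x: "x \<in> closed_slab" "0 < radius_sq x"
  shows "(\<Sum>j\<in>UNIV. (u x $ j)\<^sup>2) = (speed u (sqrt (radius_sq x)) (x $ 3))\<^sup>2"
proof -
  let ?r = "sqrt (radius_sq x)"
  have z: "x $ 3 \<in> {0..1}" using x by (simp add: closed_slab_def)
  have r: "0 < ?r" using x by simp
  obtain \<theta> where \<theta>: "x = cyl ?r \<theta> (x $ 3)" using polar_coordinates[OF x(2)] by blast
  let ?a = "u (cyl ?r 0 (x $ 3)) $ 1" and ?b = "u (cyl ?r 0 (x $ 3)) $ 2"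
  have "(\<Sum>j\<in>UNIV. (u (cyl ?r \<theta> (x $ 3)) $ j)\<^sup>2) =
      (?a\<^sup>2 + ?b\<^sup>2) * ((cos \<theta>)\<^sup>2 + (sin \<theta>)\<^sup>2) + (u (cyl ?r 0 (x $ 3)) $ 3)\<^sup>2"
    unfolding sum_3 axisymmetric_components[OF u r z, of \<theta>] by algebra
  also have "\<dots> = (speed u ?r (x $ 3))\<^sup>2"
    by (simp add: speed_def power2_norm_eq_inner inner_vec_def sum_3) (simp add: power2_eq_square)
  finally show ?thesis using \<theta> by simp
qed

text \<open>
  Differentiate along the circle through \<open>x\<close> about the axis, once by the chain rule and once with
  the formulas of \<open>axisymmetric_components\<close>.
\<close>

lemma rotation_identity:
  assumes u: "axisymmetric u" "u differentiable_on closed_slab" and x: "x \<in> closed_slab" "0 < radius_sq x"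
  shows "x $ 1 * slab_partial 2 u x $ 1 - x $ 2 * slab_partial 1 u x $ 1 = - u x $ 2"
    and "x $ 1 * slab_partial 2 u x $ 2 - x $ 2 * slab_partial 1 u x $ 2 = u x $ 1"
proof -
  let ?r = "sqrt (radius_sq x)" and ?z = "x $ 3"
  have z: "?z \<in> {0..1}" using x by (simp add: closed_slab_def)
  have r: "0 < ?r" using x by simp
  obtain \<theta> where \<theta>: "cyl ?r \<theta> ?z = x" using polar_coordinates[OF x(2)] by metis
  let ?a = "u (cyl ?r 0 ?z) $ 1" and ?b = "u (cyl ?r 0 ?z) $ 2"
  have x12: "?r * cos \<theta> = x $ 1" "?r * sin \<theta> = x $ 2"
    using arg_cong[OF \<theta>, of "\<lambda>v. v $ 1"] arg_cong[OF \<theta>, of "\<lambda>v. v $ 2"] by (simp_all add: cyl_def)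
  have cyl: "cyl ?r s ?z = (?r * cos s) *\<^sub>R axis 1 1 + (?r * sin s) *\<^sub>R axis 2 1 + ?z *\<^sub>R axis 3 1" for s
    by (simp add: cyl_def vec_eq_iff forall_3 axis_def)
  have v: "((\<lambda>s. cyl ?r s ?z) has_vector_derivative (pt (- x $ 2) (x $ 1) 0)) (at \<theta>)"
  proof -
    have "((\<lambda>s. cyl ?r s ?z) has_vector_derivative ((- ?r * sin \<theta>) *\<^sub>R axis 1 1 + (?r * cos \<theta>) *\<^sub>R axis 2 1)) (at \<theta>)"
      unfolding cyl has_vector_derivative_def
      by (auto intro!: derivative_eq_intros simp: algebra_simps)
    moreover have "(- ?r * sin \<theta>) *\<^sub>R axis 1 1 + (?r * cos \<theta>) *\<^sub>R axis 2 1 = pt (- x $ 2) (x $ 1) 0"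
      using x12 by (simp add: vec_eq_iff forall_3 axis_def)
    ultimately show ?thesis by simp
  qed
  have "((\<lambda>s. u (cyl ?r s ?z) $ j) has_real_derivative
     (\<Sum>i\<in>UNIV. (pt (- x $ 2) (x $ 1) 0 $ i) *\<^sub>R slab_partial i u (cyl ?r \<theta> ?z)) $ j) (at \<theta>)" for j
  proof (rule curve_derivative[OF u(2) bounded_linear_vec_nth v])
    show "range (\<lambda>s. cyl ?r s ?z) \<subseteq> closed_slab"
      using z by (auto simp: cyl_def pt_in_closed_slab)
  qed simp
  then have D: "((\<lambda>s. u (cyl ?r s ?z) $ j) has_real_derivative
     x $ 1 * slab_partial 2 u x $ j - x $ 2 * slab_partial 1 u x $ j) (at \<theta>)" for j
    by (simp add: sum_3 \<theta>)
  have "((\<lambda>s. u (cyl ?r s ?z) $ 1) has_real_derivative - (?a * sin \<theta> + ?b * cos \<theta>)) (at \<theta>)"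
  proof -
    have "(\<lambda>s. u (cyl ?r s ?z) $ 1) = (\<lambda>s. ?a * cos s - ?b * sin s)"
      by (rule ext) (rule axisymmetric_components(1)[OF u(1) r z])
    then show ?thesis by (simp only:) (auto intro!: derivative_eq_intros)
  qed
  from DERIV_unique[OF D this]
  show "x $ 1 * slab_partial 2 u x $ 1 - x $ 2 * slab_partial 1 u x $ 1 = - u x $ 2"
    using axisymmetric_components(2)[OF u(1) r z, of \<theta>] \<theta> by simp
  have "((\<lambda>s. u (cyl ?r s ?z) $ 2) has_real_derivative (?a * cos \<theta> - ?b * sin \<theta>)) (at \<theta>)"
  proof -
    have "(\<lambda>s. u (cyl ?r s ?z) $ 2) = (\<lambda>s. ?a * sin s + ?b * cos s)"
      by (rule ext) (rule axisymmetric_components(2)[OF u(1) r z])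
    then show ?thesis by (simp only:) (auto intro!: derivative_eq_intros)
  qed
  from DERIV_unique[OF D this]
  show "x $ 1 * slab_partial 2 u x $ 2 - x $ 2 * slab_partial 1 u x $ 2 = u x $ 1"
    using axisymmetric_components(1)[OF u(1) r z, of \<theta>] \<theta> by simp
qed


lemma no_slip_axisym_flow:
  fixes u :: "real ^ 3 \<Rightarrow> real ^ 3"
  assumes NS: "smooth_steady_NS u" and ns: "no_slip u" and ax: "axisymmetric u"
  obtains ddu p dp where "axisym_flow (\<lambda>j x. u x $ j) (\<lambda>j i x. slab_partial i u x $ j) ddu p dp"
proof -
  obtain P where P: "smooth_on P closed_slab" and u: "smooth_on u closed_slab"
    and eqs: "\<And>x. x \<in> slab \<Longrightarrow> - laplacian u x + convection u x + gradient P x = 0"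
       "\<And>x. x \<in> slab \<Longrightarrow> divergence u x = 0"
    using NS unfolding smooth_steady_NS_def by blast
  have uC: "Ck_on k u closed_slab" and PC: "Ck_on k P closed_slab" for k
    using u P by (auto simp: smooth_on_def)
  have duC: "Ck_on k (slab_partial i u) closed_slab" for k i by (rule Ck_on_slab_partial[OF uC])
  have udiff: "u differentiable_on closed_slab" using uC[of 1] by simp
  have dudiff: "slab_partial i u differentiable_on closed_slab" for i using duC[of 1 i] by simp
  let ?u = "\<lambda>j x. u x $ j" and ?du = "\<lambda>j i x. slab_partial i u x $ j"
    and ?ddu = "\<lambda>j i k x. slab_partial k (slab_partial i u) x $ j" and ?dp = "\<lambda>i x. slab_partial i P x"
  have ug: "has_grad (?u j) (?du j)" for j
    by (rule has_grad_of_Ck_on[OF uC bounded_linear_vec_nth])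
  have dug: "has_grad (?du j i) (?ddu j i)" for j i
    by (rule has_grad_of_Ck_on[OF duC bounded_linear_vec_nth])
  have pg: "has_grad P ?dp"
    by (rule has_grad_of_Ck_on[OF PC bounded_linear_ident])
  note conts = continuous_intros has_gradD(1)[OF ug] has_gradD(2)[OF ug] has_gradD(2)[OF dug] has_gradD(2)[OF pg]
  have "axisym_flow ?u ?du ?ddu P ?dp"
  proof (rule axisym_flow.intro[OF ug dug pg])
    fix j x assume x: "x \<in> closed_slab"
    show "- (\<Sum>i\<in>UNIV. ?ddu j i i x) + (\<Sum>i\<in>UNIV. ?u i x * ?du j i x) + ?dp j x = 0"
    proof (rule zero_on_closed_slab[OF _ _ x])
      show "continuous_on closed_slab (\<lambda>x. - (\<Sum>i\<in>UNIV. ?ddu j i i x) + (\<Sum>i\<in>UNIV. ?u i x * ?du j i x) + ?dp j x)"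
        by (intro conts)
      fix y assume y: "y \<in> slab"
      have lap: "laplacian u y = (\<Sum>i\<in>UNIV. slab_partial i (slab_partial i u) y)"
        unfolding laplacian_def by (intro sum.cong refl partial_partial_eq y dudiff)
      have "(- laplacian u y + convection u y + gradient P y) $ j = 0" using eqs(1)[OF y] by simp
      then show "- (\<Sum>i\<in>UNIV. ?ddu j i i y) + (\<Sum>i\<in>UNIV. ?u i y * ?du j i y) + ?dp j y = 0"
        by (simp add: lap convection_def gradient_def partial_eq_slab_partial[OF y])
    qed
  next
    fix x assume x: "x \<in> closed_slab"
    show "(\<Sum>i\<in>UNIV. ?du i i x) = 0"
    proof (rule zero_on_closed_slab[OF _ _ x])
      show "continuous_on closed_slab (\<lambda>x. \<Sum>i\<in>UNIV. ?du i i x)" by (intro conts)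
      show "(\<Sum>i\<in>UNIV. ?du i i y) = 0" if "y \<in> slab" for y
        using eqs(2)[OF that] by (simp add: divergence_def partial_eq_slab_partial[OF that])
    qed
  next
    show "?u j x = 0" if "x $ 3 = 0 \<or> x $ 3 = 1" for j x
      using ns that by (auto simp: no_slip_def)
  next
    fix x assume x: "x \<in> closed_slab"
    have "x $ 1 * ?du 1 2 x - x $ 2 * ?du 1 1 x + ?u 2 x = 0"
      by (rule zero_on_axis[OF _ _ x]) (auto intro!: conts simp: rotation_identity(1)[OF ax udiff])
    then show "x $ 1 * ?du 1 2 x - x $ 2 * ?du 1 1 x = - ?u 2 x" by simp
    have "x $ 1 * ?du 2 2 x - x $ 2 * ?du 2 1 x - ?u 1 x = 0"
      by (rule zero_on_axis[OF _ _ x]) (auto intro!: conts simp: rotation_identity(2)[OF ax udiff])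
    then show "x $ 1 * ?du 2 2 x - x $ 2 * ?du 2 1 x = ?u 1 x" by simp
  next
    fix x y :: "real ^ 3"
    assume xy: "x \<in> closed_slab" "(x $ 1)\<^sup>2 + (x $ 2)\<^sup>2 = (y $ 1)\<^sup>2 + (y $ 2)\<^sup>2" "x $ 3 = y $ 3"
    then have y: "y \<in> closed_slab" and r: "radius_sq x = radius_sq y" by (auto simp: closed_slab_def radius_sq_def)
    show "(\<Sum>j\<in>UNIV. (?u j x)\<^sup>2) = (\<Sum>j\<in>UNIV. (?u j y)\<^sup>2)"
    proof (cases "0 < radius_sq x")
      case True
      then show ?thesis using axisymmetric_norm[OF ax xy(1)] axisymmetric_norm[OF ax y] r xy(3) by simp
    next
      case False
      then have "x $ 1 = 0" "x $ 2 = 0" "y $ 1 = 0" "y $ 2 = 0"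
        using r radius_sq_nonneg[of x] by (auto simp: radius_sq_def not_less sum_power2_le_zero_iff)
      then have "x = y" using xy(3) by (simp add: vec_eq_iff forall_3)
      then show ?thesis by simp
    qed
  qed
  then show ?thesis using that by blast
qed

section \<open>The Liouville theorem\<close>

lemma disk_energy_le_energy:
  fixes u :: "real ^ 3 \<Rightarrow> real ^ 3"
  assumes flow: "axisym_flow (\<lambda>j x. u x $ j) (\<lambda>j i x. slab_partial i u x $ j) ddu p dp" and R: "1 \<le> R"
  shows "axisym_flow.disk_energy (\<lambda>j i x. slab_partial i u x $ j) (R - 1) \<le> energy u R"
proof -
  interpret axisym_flow "\<lambda>j x. u x $ j" "\<lambda>j i x. slab_partial i u x $ j" ddu p dp by (rule flow)
  let ?B = "box (pt (-R) (-R) 0) (pt R R 1)" and ?f = "\<lambda>x. cutoff (R - 1) 1 x * Q x"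
  define A where "A = {x \<in> slab. radius_sq x < R\<^sup>2}"
  have memB: "x \<in> ?B \<longleftrightarrow> \<bar>x $ 1\<bar> < R \<and> \<bar>x $ 2\<bar> < R \<and> x \<in> slab" for x
    by (auto simp: mem_box_cart forall_3 slab_def)
  have "A = slab \<inter> {x. radius_sq x < R\<^sup>2}" by (auto simp: A_def)
  moreover have "open {x. radius_sq x < R\<^sup>2}"
    unfolding radius_sq_def by (intro open_Collect_less continuous_intros)
  ultimately have "open A" using open_slab by (simp add: open_Int)
  then have A: "A \<in> sets lborel" by simp
  have AB: "A \<subseteq> ?B"
  proof
    fix x assume x: "x \<in> A"
    have "\<bar>t\<bar> < R" if "t\<^sup>2 < R\<^sup>2" for t
      using power2_less_imp_less[of "\<bar>t\<bar>" R] that R by simp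
    moreover have "radius_sq x < R\<^sup>2" using x by (simp add: A_def)
    then have "(x $ 1)\<^sup>2 < R\<^sup>2" "(x $ 2)\<^sup>2 < R\<^sup>2"
      using zero_le_power2[of "x $ 1"] zero_le_power2[of "x $ 2"] unfolding radius_sq_def by linarith+
    ultimately show "x \<in> ?B" using x by (auto simp: memB A_def)
  qed
  have int: "set_integrable lborel S g" if "continuous_on closed_slab g" "S \<subseteq> cyl_box R" "S \<in> sets lborel" for g :: "real ^ 3 \<Rightarrow> real" and S
  proof -
    have "set_integrable lborel (cyl_box R) g"
      unfolding set_integrable_def
      by (rule borel_integrable_compact) (use continuous_on_subset[OF that(1) cyl_box_sub] in \<open>auto simp: cyl_box_def\<close>)
    then show ?thesis using that(3,2) by (rule set_integrable_subset)
  qed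
  have Bsub: "?B \<subseteq> cyl_box R" unfolding cyl_box_def by (rule box_subset_cbox)
  have fB: "set_integrable lborel ?B ?f" by (intro int cutoff_Q_cont Bsub) auto
  have QA: "set_integrable lborel A Q" by (intro int Q_cont A) (use AB Bsub in auto)
  have "disk_energy (R - 1) = integral ?B ?f"
    by (simp add: disk_energy_def cyl_box_def integral_open_interval)
  also have "\<dots> = (LINT x:?B|lborel. ?f x)"
    by (rule set_borel_integral_eq_integral(2)[symmetric, OF fB])
  also have "\<dots> \<le> (LINT x:A|lborel. Q x)"
    unfolding set_lebesgue_integral_def
  proof (rule integral_mono[OF fB[unfolded set_integrable_def] QA[unfolded set_integrable_def]])
    fix x
    show "indicat_real ?B x *\<^sub>R ?f x \<le> indicat_real A x *\<^sub>R Q x"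
    proof (cases "x \<in> A")
      case True
      have "?f x \<le> 1 * Q x" by (intro mult_right_mono cutoff_bounds) (use R in auto)
      then show ?thesis using True AB by auto
    next
      case False
      have "?f x = 0" if "x \<in> ?B"
        using that False R cutoff_outside(1)[of "R - 1" 1 x] by (auto simp: A_def memB not_less)
      then show ?thesis using False by (auto simp: indicator_def)
    qed
  qed
  also have "\<dots> = energy u R"
    unfolding energy_def set_lebesgue_integral_def
  proof (rule Bochner_Integration.integral_cong[OF refl])
    fix x
    have "Q x = grad_norm_sq u x" if "x \<in> slab"
      unfolding energy_density_def grad_norm_sq_def partial_eq_slab_partial[OF that] by (rule sum.swap)
    then show "indicat_real A x *\<^sub>R Q x = indicat_real {x \<in> slab. (x $ 1)\<^sup>2 + (x $ 2)\<^sup>2 < R\<^sup>2} x *\<^sub>R grad_norm_sq u x"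
      by (auto simp: A_def radius_sq_def indicator_def)
  qed
  finally show ?thesis .
qed

lemma speed_le_SUP:
  fixes u :: "real ^ 3 \<Rightarrow> real ^ 3"
  assumes "continuous_on closed_slab u" "z \<in> {0..1}"
  shows "speed u R z \<le> (SUP z\<in>{0..1}. speed u R z)"
proof (rule cSUP_upper[OF assms(2)])
  have "continuous_on {0..1} (\<lambda>z. u (cyl R 0 z))"
    unfolding cyl_def by (rule continuous_on_slab_pt[OF assms(1)]) (auto intro!: continuous_intros)
  then have "continuous_on {0..1} (\<lambda>z. speed u R z)"
    unfolding speed_def by (rule continuous_on_norm)
  then show "bdd_above (speed u R ` {0..1})"
    by (intro bounded_imp_bdd_above compact_imp_bounded compact_continuous_image) auto
qed

text \<open>
  Under (a) the energy cannot grow like \<open>R\<^sup>4\<close>, and under (b) the speed is sublinear in the radius; each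
  case is one of the alternatives of \<open>flow_trivial\<close>.
\<close>

theorem theorem1p1:
  fixes u :: "real ^ 3 \<Rightarrow> real ^ 3"
  assumes "smooth_steady_NS u"
    and "no_slip u"
    and "axisymmetric u"
    and "Liminf at_top (\<lambda>R::real. ereal (energy u R / R ^ 4)) = 0
       \<or> ((\<lambda>R::real. (SUP z\<in>{0..1}. speed u R z) / R) \<longlongrightarrow> 0) at_top"
  shows "\<forall>x\<in>closed_slab. u x = 0"
proof -
  obtain ddu p dp where flow: "axisym_flow (\<lambda>j x. u x $ j) (\<lambda>j i x. slab_partial i u x $ j) ddu p dp"
    using no_slip_axisym_flow[OF assms(1-3)] .
  interpret axisym_flow "\<lambda>j x. u x $ j" "\<lambda>j i x. slab_partial i u x $ j" ddu p dp by (rule flow)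
  have ucont: "continuous_on closed_slab u"
    using assms(1) unfolding smooth_steady_NS_def smooth_on_def using Ck_on.simps(1) by blast
  have "\<not> (\<exists>\<delta>>0. \<forall>\<^sub>F R in at_top. \<delta> * R ^ 4 \<le> disk_energy R) \<or>
    (\<forall>\<epsilon>>0. \<exists>R0. \<forall>x\<in>closed_slab. R0\<^sup>2 \<le> radius_sq x \<longrightarrow> V x \<le> \<epsilon>\<^sup>2 * radius_sq x)"
    using assms(4)
  proof
    assume a: "Liminf at_top (\<lambda>R::real. ereal (energy u R / R ^ 4)) = 0"
    have False if d: "0 < \<delta>" "\<forall>\<^sub>F R in at_top. \<delta> * R ^ 4 \<le> disk_energy R" for \<delta>
    proof -
      have "\<forall>\<^sub>F R in at_top. \<delta> * (R - 1) ^ 4 \<le> disk_energy (R - 1)"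
        by (rule eventually_at_top_minus_one[OF d(2)])
      then have "\<forall>\<^sub>F R in at_top. ereal (\<delta> / 16) \<le> ereal (energy u R / R ^ 4)"
        using eventually_ge_at_top[of 2]
      proof eventually_elim
        case (elim R)
        have "(R / 2) ^ 4 \<le> (R - 1) ^ 4" using elim by (intro power_mono) auto
        then have "\<delta> / 16 * R ^ 4 \<le> \<delta> * (R - 1) ^ 4" using d by (simp add: power_divide)
        also have "\<dots> \<le> disk_energy (R - 1)" by (rule elim)
        also have "\<dots> \<le> energy u R" by (rule disk_energy_le_energy[OF flow]) (use elim in simp)
        finally show ?case using elim by (simp add: field_simps)
      qed
      then have "ereal (\<delta> / 16) \<le> Liminf at_top (\<lambda>R::real. ereal (energy u R / R ^ 4))"
        by (rule Liminf_bounded)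
      then show False using a d by simp
    qed
    then show ?thesis by blast
  next
    assume b: "((\<lambda>R::real. (SUP z\<in>{0..1}. speed u R z) / R) \<longlongrightarrow> 0) at_top"
    have "\<exists>R0. \<forall>x\<in>closed_slab. R0\<^sup>2 \<le> radius_sq x \<longrightarrow> V x \<le> \<epsilon>\<^sup>2 * radius_sq x" if e: "0 < \<epsilon>" for \<epsilon>
    proof -
      have "\<forall>\<^sub>F R in at_top. (SUP z\<in>{0..1}. speed u R z) / R < \<epsilon>"
        using b e by (rule order_tendstoD(2))
      then obtain R1 where R1: "\<And>R. R1 \<le> R \<Longrightarrow> (SUP z\<in>{0..1}. speed u R z) / R < \<epsilon>"
        by (auto simp: eventually_at_top_linorder)
      define R0 where "R0 = max 1 R1"
      have "V x \<le> \<epsilon>\<^sup>2 * radius_sq x" if x: "x \<in> closed_slab" "R0\<^sup>2 \<le> radius_sq x" for x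
      proof -
        let ?r = "sqrt (radius_sq x)"
        have r: "R0 \<le> ?r" using x(2) by (intro real_le_rsqrt)
        then have r0: "0 < ?r" "R1 \<le> ?r" by (auto simp: R0_def)
        have "speed u ?r (x $ 3) \<le> (SUP z\<in>{0..1}. speed u ?r z)"
          using x(1) by (intro speed_le_SUP[OF ucont]) (auto simp: closed_slab_def)
        also have "\<dots> \<le> \<epsilon> * ?r" using R1[OF r0(2)] r0(1) by (simp add: divide_less_eq)
        finally have "(speed u ?r (x $ 3))\<^sup>2 \<le> (\<epsilon> * ?r)\<^sup>2"
          by (rule power_mono) (simp add: speed_def)
        then show ?thesis
          using axisymmetric_norm[OF assms(3) x(1)] r0(1) by (simp add: speed_sq_def power_mult_distrib)
      qed
      then show ?thesis by blast
    qed
    then show ?thesis by blast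
  qed
  then have V0: "V x = 0" if "x \<in> closed_slab" for x
    using that by (rule flow_trivial)
  show ?thesis
  proof
    fix x assume "x \<in> closed_slab"
    then have "(\<Sum>j\<in>UNIV. (u x $ j)\<^sup>2) = 0" using V0 by (simp add: speed_sq_def)
    then show "u x = 0" by (simp add: sum_nonneg_eq_0_iff vec_eq_iff)
  qed
qed

end
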